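(* Let $\Phi$ be a Drinfeld module over $\bar k$ of rank $d$, let $x\in\bar k$ be a non-torsion point separable over $k$ with $D=[k(x):k]$, and let $L,t\in\mathbb{N}$ satisfy $L^2>tDc(\Phi)$. Let $N\in A$ have degree $\deg_T(N)=\left[\frac1d\log L\right]+1$. For $0\le h\le t-1$ and $0\le i,j\le L-1$ let $\alpha_{h,(i,j)}:=d^{(h)}\big(X^i(\Phi(N)(X))^j\big)\big|_{X=x}\in k(\Phi,x)$, and let $\Sigma:=\sum_{h=0}^{t-1}h\big((\alpha_{h,(i,j)})_{0\le i,j\le L-1}\big)$. Then there exists a nonzero polynomial $G(X,Y)=\sum_{i=0}^{L-1}\sum_{j=0}^{L-1}p_{ij}X^iY^j\in A[X,Y]$ such that $G_N(X):=G(X,\Phi(N)(X))$ is a nonzero polynomial, $d^{(h)}G_N(x)=0$ for all $0\le h\le t-1$ (i.e. $G_N$ vanishes at $x$ with multiplicity at least $t$), and $$\deg_T(p_{ij})\le\frac{Dc(\Phi)}{L^2-tDc(\Phi)}\,\Sigma\quad\text{for all }0\le i,j\le L-1.$$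
   Context: $A=\mathbb{F}_q[T]$, $k=\mathbb{F}_q(T)$, $\bar k$ an algebraic closure, $\tau$ the $q$-Frobenius. A Drinfeld module of rank $d$ is an injective $\mathbb{F}_q$-algebra homomorphism $\Phi:A\to\bar k\{\tau\}$ with $\Phi(T)=T+a_1\tau+\dots+a_d\tau^d$, $a_d\ne0$; $c(\Phi)=[k(a_1,\dots,a_d):k]$. $x$ is torsion if $\Phi(a)(x)=0$ for some nonzero $a\in A$. $\log=\log_q$, $[\cdot]$ is the integer part. For a polynomial $P(X)$, its divided derivatives $d^{(h)}P(X)$ are defined by $P(X+H)=\sum_{h\ge0}d^{(h)}P(X)H^h$ in $\bar k[X][H]$. Places of $k$: $v(y)=\deg_T(l)v_l(y)$ for monic irreducible $l$, $v_\infty=-\deg_T$; $n_w=[K_w:k_v]$; Weil height of a vector $(y_1,\dots,y_n)\in K^n$: $h(y_1,\dots,y_n)=\frac1{[K:k]}\sum_wn_w\max_i\{0,-w(y_i)\}$. *)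

theory Defs
  imports
    "HOL-Algebra.Algebraic_Closure_Type"
    "HOL-Algebra.Embedded_Algebras"
    "HOL-Algebra.Generated_Fields"
    "HOL-Algebra.QuotRing"
    "HOL-Library.Cardinality"
    Complex_Main
begin

hide_const (open) Polynomials.degree Polynomials.lead_coeff UnivPoly.monom UnivPoly.coeff

text \<open>
  The finite field is the type \<open>'a\<close>, so \<open>q = CARD('a)\<close>, \<open>A = 'a poly\<close> and
  \<open>k = 'a poly fract\<close>. Subfields of the algebraic closure are sets, and
  \<open>range to_ac\<close> is the copy of \<open>k\<close>.
\<close>

type_synonym 'a kbar = "'a poly fract alg_closure"

abbreviation kbar_ring :: "'a::field kbar ring" where
  "kbar_ring \<equiv> ring_of_type_algebra"

abbreviation base_field :: "'a::field kbar set" where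
  "base_field \<equiv> range to_ac"

definition of_A :: "'a::field poly \<Rightarrow> 'a kbar" where
  "of_A a = to_ac (Fract a 1)"

definition adjoin :: "'a::field kbar set \<Rightarrow> 'a kbar set" where
  "adjoin S = generate_field kbar_ring (base_field \<union> S)"

definition ext_degree :: "'a::field kbar set \<Rightarrow> nat" where
  "ext_degree K = ring.dim kbar_ring base_field K"

definition separable_over_k :: "'a::field kbar \<Rightarrow> bool" where
  "separable_over_k x \<longleftrightarrow>
     (\<exists>p :: 'a poly fract poly. lead_coeff p = 1 \<and> irreducible p \<and>
        poly (map_poly to_ac p) x = 0 \<and> rsquarefree (map_poly to_ac p))"


section \<open>Drinfeld modules\<close>

text \<open>
  An element \<open>\<Sum> c\<^sub>i \<tau>\<^sup>i\<close> of the twisted polynomial ring is stored as the ordinary polynomial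
  with coefficients \<open>c\<^sub>i\<close>; addition is the one of \<^typ>\<open>'b poly\<close>, multiplication
  is determined by \<open>\<tau> c = c\<^sup>q \<tau>\<close>.
\<close>

definition twisted_mult :: "'a::{field,finite} kbar poly \<Rightarrow> 'a kbar poly \<Rightarrow> 'a kbar poly" where
  "twisted_mult f g =
     (\<Sum>i\<le>degree f. \<Sum>j\<le>degree g. monom (coeff f i * coeff g j ^ (CARD('a) ^ i)) (i + j))"

text \<open>The polynomial \<open>\<Sum> c\<^sub>i X\<^bsup>q\<^sup>i\<^esup>\<close> by which \<open>\<Sum> c\<^sub>i \<tau>\<^sup>i\<close> acts.\<close>

definition twisted_to_poly :: "'a::{field,finite} kbar poly \<Rightarrow> 'a kbar poly" where
  "twisted_to_poly f = (\<Sum>i\<le>degree f. monom (coeff f i) (CARD('a) ^ i))"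

definition drinfeld_module :: "('a::{field,finite} poly \<Rightarrow> 'a kbar poly) \<Rightarrow> nat \<Rightarrow> bool" where
  "drinfeld_module \<Phi> d \<longleftrightarrow>
     inj \<Phi> \<and>
     (\<forall>a b. \<Phi> (a + b) = \<Phi> a + \<Phi> b) \<and>
     (\<forall>a b. \<Phi> (a * b) = twisted_mult (\<Phi> a) (\<Phi> b)) \<and>
     (\<forall>c. \<Phi> [:c:] = [:of_A [:c:]:]) \<and>
     d \<ge> 1 \<and> degree (\<Phi> [:0, 1:]) = d \<and> coeff (\<Phi> [:0, 1:]) 0 = of_A [:0, 1:]"

definition drinfeld_coeffs :: "('a::{field,finite} poly \<Rightarrow> 'a kbar poly) \<Rightarrow> nat \<Rightarrow> 'a kbar set" where
  "drinfeld_coeffs \<Phi> d = {coeff (\<Phi> [:0, 1:]) i |i. 1 \<le> i \<and> i \<le> d}"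

definition drinfeld_torsion :: "('a::{field,finite} poly \<Rightarrow> 'a kbar poly) \<Rightarrow> 'a kbar \<Rightarrow> bool" where
  "drinfeld_torsion \<Phi> x \<longleftrightarrow> (\<exists>a. a \<noteq> 0 \<and> poly (twisted_to_poly (\<Phi> a)) x = 0)"


section \<open>Divided derivatives\<close>

text \<open>
  \<open>P(X + H)\<close> is formed in \<^typ>\<open>'b poly poly\<close> with inner variable \<open>X\<close> and outer variable \<open>H\<close>.
\<close>

definition divided_deriv :: "nat \<Rightarrow> 'b::comm_ring_1 poly \<Rightarrow> 'b poly" where
  "divided_deriv h P = coeff (pcompose (map_poly (\<lambda>c. [:c:]) P) [:[:0, 1:], 1:]) h"


section \<open>Places and local degrees\<close>

text \<open>
  Valuations are real-valued functions; the value \<open>\<infinity>\<close> at 0, as well as the value outside the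
  field of definition, is replaced by the dummy 0. Consequently the definitions below treat
  the zero element separately wherever this matters.
\<close>

text \<open>
  The library's \<open>multiplicity\<close> would require type-class structure on the coefficients
  that a general \<open>field\<close> does not carry.
\<close>

definition ord_at :: "'a::field poly \<Rightarrow> 'a poly \<Rightarrow> nat" where
  "ord_at l a = Max {n. l ^ n dvd a}"

definition base_places :: "('a::field poly fract \<Rightarrow> real) set" where
  "base_places = {v. v 0 = 0 \<and>
     ((\<forall>a b. a \<noteq> 0 \<longrightarrow> b \<noteq> 0 \<longrightarrow> v (Fract a b) = real (degree b) - real (degree a)) \<or>
      (\<exists>l. lead_coeff l = 1 \<and> irreducible l \<and>
         (\<forall>a b. a \<noteq> 0 \<longrightarrow> b \<noteq> 0 \<longrightarrow>
            v (Fract a b) = real (degree l) * (real (ord_at l a) - real (ord_at l b)))))}"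

definition valuation_on :: "'b::field set \<Rightarrow> ('b \<Rightarrow> real) \<Rightarrow> bool" where
  "valuation_on K w \<longleftrightarrow>
     (\<forall>x\<in>K - {0}. \<forall>y\<in>K - {0}. w (x * y) = w x + w y) \<and>
     (\<forall>x\<in>K - {0}. \<forall>y\<in>K - {0}. x + y \<noteq> 0 \<longrightarrow> w (x + y) \<ge> min (w x) (w y)) \<and>
     (\<forall>x. x \<notin> K - {0} \<longrightarrow> w x = 0)"

definition places :: "'a::field kbar set \<Rightarrow> ('a kbar \<Rightarrow> real) set" where
  "places K = {w. valuation_on K w \<and> (\<exists>v\<in>base_places. \<forall>y. w (to_ac y) = v y)}"

definition cauchy_seqs :: "'b::field set \<Rightarrow> ('b \<Rightarrow> real) \<Rightarrow> (nat \<Rightarrow> 'b) set" where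
  "cauchy_seqs K w = {s. range s \<subseteq> K \<and>
     (\<forall>B. \<exists>M. \<forall>m\<ge>M. \<forall>n\<ge>M. s m = s n \<or> w (s m - s n) \<ge> B)}"

definition null_seqs :: "'b::field set \<Rightarrow> ('b \<Rightarrow> real) \<Rightarrow> (nat \<Rightarrow> 'b) set" where
  "null_seqs K w = {s. range s \<subseteq> K \<and> (\<forall>B. \<exists>M. \<forall>n\<ge>M. s n = 0 \<or> w (s n) \<ge> B)}"

definition cauchy_ring :: "'b::field set \<Rightarrow> ('b \<Rightarrow> real) \<Rightarrow> (nat \<Rightarrow> 'b) ring" where
  "cauchy_ring K w =
     \<lparr> carrier = cauchy_seqs K w,
       monoid.mult = (\<lambda>s t n. s n * t n),
       one = (\<lambda>_. 1),
       ring.zero = (\<lambda>_. 0),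
       add = (\<lambda>s t n. s n + t n) \<rparr>"

definition completion :: "'b::field set \<Rightarrow> ('b \<Rightarrow> real) \<Rightarrow> (nat \<Rightarrow> 'b) set ring" where
  "completion K w = cauchy_ring K w Quot null_seqs K w"

text \<open>The completion of \<open>k\<close>, embedded in the completion of \<open>K\<close> as the closure of \<open>k\<close>.\<close>

definition completion_base :: "'a::field kbar set \<Rightarrow> ('a kbar \<Rightarrow> real) \<Rightarrow> (nat \<Rightarrow> 'a kbar) set set" where
  "completion_base K w =
     (\<lambda>s. null_seqs K w +>\<^bsub>cauchy_ring K w\<^esub> s) ` cauchy_seqs base_field w"

definition local_degree :: "'a::field kbar set \<Rightarrow> ('a kbar \<Rightarrow> real) \<Rightarrow> nat" where
  "local_degree K w =
     ring.dim (completion K w) (completion_base K w) (carrier (completion K w))"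


section \<open>The Weil height of a vector\<close>

text \<open>
  The coordinates are \<open>y i\<close> for \<open>i\<close> in the finite set \<open>I\<close>. A zero coordinate contributes
  \<open>max {0, -\<infinity>} = 0\<close>, in accordance with the dummy value \<open>w 0 = 0\<close>.
  Only finitely many places have a nonzero maximum; the sum is restricted to these, as a sum over
  the infinite set of all places would be 0 by convention.
\<close>

definition local_max :: "('a kbar \<Rightarrow> real) \<Rightarrow> 'i set \<Rightarrow> ('i \<Rightarrow> 'a::field kbar) \<Rightarrow> real" where
  "local_max w I y = Max (insert 0 ((\<lambda>i. - w (y i)) ` I))"

definition weil_height :: "'a::field kbar set \<Rightarrow> 'i set \<Rightarrow> ('i \<Rightarrow> 'a kbar) \<Rightarrow> real" where
  "weil_height K I y =
     1 / real (ext_degree K) *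
     (\<Sum>w\<in>{w \<in> places K. local_max w I y \<noteq> 0}. real (local_degree K w) * local_max w I y)"


section \<open>Substitution into bivariate polynomials\<close>

text \<open>
  A polynomial in \<open>A[X,Y]\<close> is an element of \<open>A[X][Y]\<close>, i.e. the outer variable is \<open>Y\<close>.
\<close>

definition bivariate :: "nat \<Rightarrow> (nat \<Rightarrow> nat \<Rightarrow> 'a::field poly) \<Rightarrow> 'a poly poly poly" where
  "bivariate L p = (\<Sum>i<L. \<Sum>j<L. monom (monom (p i j) i) j)"

definition subst_Y :: "'a::field poly poly poly \<Rightarrow> 'a kbar poly \<Rightarrow> 'a kbar poly" where
  "subst_Y G F = poly (map_poly (map_poly of_A) G) F"

end

theory Submission
  imports Defs
begin

text \<open>
  This is Siegel's lemma over the function field \<open>K = k(\<Phi>, x)\<close>, by counting over \<open>\<F>\<^sub>q\<close>. Put \<open>n = [K : k]\<close>,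
  which is at most \<open>D c\<close>. For fixed \<open>h\<close>, the sums \<open>\<Sum> p\<^sub>i\<^sub>j \<alpha>\<^sub>h\<^sub>i\<^sub>j\<close> with \<open>deg p\<^sub>i\<^sub>j \<le> B\<close> form a finite group \<open>W\<close>. Removing
  the poles of the \<open>\<alpha>\<^sub>h\<^sub>i\<^sub>j\<close> one place at a time costs a factor \<open>q\<close> to the power
  \<open>\<Sum> n\<^sub>w max {0, - w(\<alpha>\<^sub>h\<^sub>i\<^sub>j)} = n h(\<alpha>\<^sub>h)\<close>. What remains has only poles of order \<open>B\<close> at infinity. It
  has at most \<open>q\<^bsup>n(B+1)\<^esup>\<close> elements: modulo \<open>T\<^bsup>B+1\<^esup>\<close> the integers of \<open>K\<close> have at most that many classes, and a
  multiple of \<open>T\<^bsup>B+1\<^esup>\<close> among them would, after division, have no pole and a zero at infinity.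
  The pigeonhole principle gives a relation as soon as \<open>L\<^sup>2 (B + 1) > n \<Sigma> + t n (B + 1)\<close>, and the choice
  of \<open>deg N\<close> makes \<open>deg \<Phi>(N)(X) > L\<close>, so that no cancellation can occur in \<open>G(X, \<Phi>(N)(X))\<close>.
\<close>

section \<open>Indices of additive subgroups\<close>

text \<open>The height is built from dimensions of completions, whereas the count needs indices of
  fractional ideals. The bridge is a family in the valuation ring of \<open>w\<close> that is a
  basis modulo a uniformizer of \<open>k\<close>: successive approximation makes it a basis of the
  completion, so its length is the local degree. Only upper bounds for indices are sought, and
  [K : k] enters as the largest number of linearly independent elements.

  That an element without poles and vanishing at infinity is 0 depends on a supply of places. They
  come from Zorn's lemma: a subring of the algebraic closure that contains 1/s and is maximal
  without s is a valuation ring. Its valuation is real because every nonzero element has a power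
  that is a unit times an element of \<open>k\<close>.

  The sum in the height is meaningful only if finitely many places contribute, so the finiteness of
  the set of poles is proved as well, from the independence of the places above a given place of
  \<open>k\<close>.\<close>

definition add_subgroup :: "'b::ab_group_add set \<Rightarrow> bool" where
  "add_subgroup Y \<longleftrightarrow> 0 \<in> Y \<and> (\<forall>x\<in>Y. \<forall>y\<in>Y. x - y \<in> Y)"

text \<open>Finite sets of pairwise incongruent elements stand in for the quotient, so
  \<open>Y\<close> may be any set, contained in \<open>A\<close> or not. For subgroups this says
  that the index of \<open>A \<inter> Y\<close> in \<open>A\<close> is at most \<open>N\<close>. The
  bound is real because the indices at a place are estimated by powers of q with real
  exponents.\<close>

definition index_le :: "'b::ab_group_add set \<Rightarrow> 'b set \<Rightarrow> real \<Rightarrow> bool" where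
  "index_le A Y N \<longleftrightarrow> (\<forall>S. finite S \<longrightarrow> S \<subseteq> A \<longrightarrow>
     (\<forall>s\<in>S. \<forall>s'\<in>S. s - s' \<in> Y \<longrightarrow> s = s') \<longrightarrow> real (card S) \<le> N)"

lemma add_subgroup_0: "add_subgroup Y \<Longrightarrow> 0 \<in> Y"
  and add_subgroup_diff: "add_subgroup Y \<Longrightarrow> x \<in> Y \<Longrightarrow> y \<in> Y \<Longrightarrow> x - y \<in> Y"
  by (auto simp: add_subgroup_def)

lemma add_subgroup_uminus: "add_subgroup Y \<Longrightarrow> x \<in> Y \<Longrightarrow> - x \<in> Y"
  using add_subgroup_diff[of Y 0 x] by (auto simp: add_subgroup_0)

lemma add_subgroup_add: "add_subgroup Y \<Longrightarrow> x \<in> Y \<Longrightarrow> y \<in> Y \<Longrightarrow> x + y \<in> Y"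
  using add_subgroup_diff[of Y x "- y"] by (auto simp: add_subgroup_uminus)

lemma add_subgroup_sum:
  "add_subgroup Y \<Longrightarrow> (\<And>i. i \<in> I \<Longrightarrow> f i \<in> Y) \<Longrightarrow> sum f I \<in> Y"
  by (induction I rule: infinite_finite_induct)
     (auto simp: add_subgroup_0 intro: add_subgroup_add)

lemma add_subgroup_Int: "add_subgroup A \<Longrightarrow> add_subgroup Y \<Longrightarrow> add_subgroup (A \<inter> Y)"
  by (auto simp: add_subgroup_def)

lemma add_subgroup_INT: "(\<And>i. i \<in> I \<Longrightarrow> add_subgroup (Y i)) \<Longrightarrow> add_subgroup (\<Inter>i\<in>I. Y i)"
  by (auto simp: add_subgroup_def)

lemma add_subgroup_mult:
  fixes a :: "'b::ring"
  assumes "add_subgroup Y"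
  shows "add_subgroup ((*) a ` Y)"
  unfolding add_subgroup_def
proof (intro conjI ballI)
  show "0 \<in> (*) a ` Y" using add_subgroup_0[OF assms] by (intro image_eqI[of _ _ 0]) auto
  fix x y assume "x \<in> (*) a ` Y" "y \<in> (*) a ` Y"
  then obtain u v where "x = a * u" "y = a * v" "u \<in> Y" "v \<in> Y" by blast
  then show "x - y \<in> (*) a ` Y"
    using add_subgroup_diff[OF assms] by (intro image_eqI[of _ _ "u - v"]) (auto simp: right_diff_distrib)
qed

text \<open>Algebraicity over the constants appears below as a relation s = p(1/s); this clears its
  denominators.\<close>

lemma poly_inverse_times_power:
  fixes x :: "'b::field"
  assumes "x \<noteq> 0"
  shows "poly p (inverse x) * x ^ degree p = (\<Sum>i\<le>degree p. coeff p i * x ^ (degree p - i))"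
  unfolding poly_altdef sum_distrib_right
proof (rule sum.cong[OF refl])
  fix i assume "i \<in> {..degree p}"
  then have "x ^ degree p = x ^ i * x ^ (degree p - i)" by (simp flip: power_add)
  then show "coeff p i * inverse x ^ i * x ^ degree p = coeff p i * x ^ (degree p - i)"
    using assms by (simp add: power_inverse)
qed

lemma one_less_card: "1 < CARD('a::{field,finite})"
proof -
  have "card {0, 1 :: 'a} \<le> CARD('a)" by (rule card_mono) auto
  then show ?thesis by simp
qed

lemma index_leD:
  "index_le A Y N \<Longrightarrow> finite S \<Longrightarrow> S \<subseteq> A \<Longrightarrow>
    (\<And>s s'. s \<in> S \<Longrightarrow> s' \<in> S \<Longrightarrow> s - s' \<in> Y \<Longrightarrow> s = s') \<Longrightarrow> real (card S) \<le> N"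
  unfolding index_le_def by blast

lemma index_leI:
  "(\<And>S. finite S \<Longrightarrow> S \<subseteq> A \<Longrightarrow> (\<And>s s'. s \<in> S \<Longrightarrow> s' \<in> S \<Longrightarrow> s - s' \<in> Y \<Longrightarrow> s = s') \<Longrightarrow>
     real (card S) \<le> N) \<Longrightarrow> index_le A Y N"
  unfolding index_le_def by blast

lemma index_le_nonneg: "index_le A Y N \<Longrightarrow> 0 \<le> N"
  using index_leD[of A Y N "{}"] by auto

lemma index_le_mono:
  assumes "index_le A Y N" "A' \<subseteq> A" "Y \<subseteq> Y'" "N \<le> N'"
  shows "index_le A' Y' N'"
proof (rule index_leI)
  fix S assume S: "finite S" "S \<subseteq> A'" "\<And>s s'. s \<in> S \<Longrightarrow> s' \<in> S \<Longrightarrow> s - s' \<in> Y' \<Longrightarrow> s = s'"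
  have "real (card S) \<le> N"
    by (rule index_leD[OF assms(1)]) (use S assms(2,3) in blast)+
  then show "real (card S) \<le> N'" using assms(4) by simp
qed

text \<open>Choose representatives modulo \<open>Y\<close> inside \<open>S\<close> itself: they are
  pairwise incongruent, so there are at most \<open>M\<close>. The elements with a given
  representative, shifted by it, lie in \<open>Y\<close> and stay incongruent modulo
  \<open>Z\<close>, so there are at most \<open>N\<close>.\<close>

lemma index_le_trans:
  assumes AY: "index_le A Y M" and YZ: "index_le Y Z N" and Y: "add_subgroup Y"
  shows "index_le A Z (M * N)"
proof (rule index_leI)
  fix S assume S: "finite S" "S \<subseteq> A" and Z: "\<And>s s'. s \<in> S \<Longrightarrow> s' \<in> S \<Longrightarrow> s - s' \<in> Z \<Longrightarrow> s = s'"
  define f where "f s = (SOME s'. s' \<in> S \<and> s - s' \<in> Y)" for s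
  have f: "f s \<in> S \<and> s - f s \<in> Y" if "s \<in> S" for s
    unfolding f_def by (rule someI[of _ s]) (use that Y in \<open>auto simp: add_subgroup_0\<close>)
  have f_eq: "f s = f s'" if "s - s' \<in> Y" for s s'
  proof -
    have "s - u \<in> Y \<longleftrightarrow> s' - u \<in> Y" for u
      using add_subgroup_add[OF Y that, of "s' - u"] add_subgroup_diff[OF Y _ that, of "s - u"]
      by (auto simp: algebra_simps)
    then show ?thesis by (simp add: f_def)
  qed
  have fib: "real (card {s \<in> S. f s = r}) \<le> N" if "r \<in> f ` S" for r
  proof -
    have "card ((\<lambda>s. s - r) ` {s \<in> S. f s = r}) = card {s \<in> S. f s = r}"
      by (rule card_image) (auto simp: inj_on_def)
    moreover have "real (card ((\<lambda>s. s - r) ` {s \<in> S. f s = r})) \<le> N"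
      by (rule index_leD[OF YZ]) (use S f Z in \<open>auto\<close>)
    ultimately show ?thesis by simp
  qed
  have "real (card (f ` S)) \<le> M"
  proof (rule index_leD[OF AY])
    fix a b assume "a \<in> f ` S" "b \<in> f ` S" and d: "a - b \<in> Y"
    then obtain s s' where s: "s \<in> S" "a = f s" "s' \<in> S" "b = f s'" by blast
    have "(s - a) + (a - b) - (s' - b) \<in> Y"
      using add_subgroup_diff[OF Y add_subgroup_add[OF Y _ d], of "s - a" "s' - b"] f s by simp
    then show "a = b" using f_eq[of s s'] s by simp
  qed (use S f in auto)
  moreover have "real (card S) = (\<Sum>r\<in>f ` S. real (card {s \<in> S. f s = r}))"
  proof -
    have "card S = (\<Sum>r\<in>f ` S. card {s \<in> S. f s = r})"
      using sum.image_gen[OF S(1), of "\<lambda>_. 1::nat" f] by simp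
    then show ?thesis by simp
  qed
  moreover have "(\<Sum>r\<in>f ` S. real (card {s \<in> S. f s = r})) \<le> (\<Sum>r\<in>f ` S. N)"
    by (rule sum_mono) (rule fib)
  ultimately show "real (card S) \<le> M * N"
    using mult_right_mono[of "real (card (f ` S))" M N] index_le_nonneg[OF YZ] by simp
qed

lemma index_le_Int:
  assumes "index_le A Y N" "add_subgroup A"
  shows "index_le A (A \<inter> Y) N"
proof (rule index_leI)
  fix S assume "finite S" "S \<subseteq> A" "\<And>s s'. s \<in> S \<Longrightarrow> s' \<in> S \<Longrightarrow> s - s' \<in> A \<inter> Y \<Longrightarrow> s = s'"
  then show "real (card S) \<le> N"
    using assms(2) by (intro index_leD[OF assms(1)]) (simp_all add: add_subgroup_diff subset_iff)
qed

text \<open>Conditions at finitely many places are imposed one after another: inside the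
  intersection already reached, the next subgroup still has index at most \<open>N i\<close>. The
  case of empty \<open>F\<close> also serves later as the statement that a group has index at most 1
  in itself.\<close>

lemma index_le_INT:
  assumes "finite F" "add_subgroup A"
    and "\<And>i. i \<in> F \<Longrightarrow> add_subgroup (Y i)" "\<And>i. i \<in> F \<Longrightarrow> index_le A (Y i) (N i)"
  shows "index_le A (A \<inter> (\<Inter>i\<in>F. Y i)) (\<Prod>i\<in>F. N i)"
  using assms(1,3,4)
proof (induction F rule: finite_induct)
  case empty
  show ?case
  proof (rule index_leI)
    fix S assume S: "finite S" "S \<subseteq> A"
      "\<And>s s'. s \<in> S \<Longrightarrow> s' \<in> S \<Longrightarrow> s - s' \<in> A \<inter> (\<Inter>i\<in>{}. Y i) \<Longrightarrow> s = s'"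
    then have "s = s'" if "s \<in> S" "s' \<in> S" for s s'
      using that S assms(2) by (simp add: add_subgroup_diff subset_iff)
    then have "card S \<le> 1" using S(1) by (simp add: card_le_Suc0_iff_eq)
    then show "real (card S) \<le> prod N {}" by simp
  qed
next
  case (insert i F)
  let ?A = "A \<inter> (\<Inter>i\<in>F. Y i)"
  have sg: "add_subgroup ?A"
    using insert.prems assms(2) by (intro add_subgroup_Int add_subgroup_INT) auto
  have "index_le ?A (Y i) (N i)"
    by (rule index_le_mono[of A "Y i" "N i"]) (use insert.prems in auto)
  then have "index_le ?A (?A \<inter> Y i) (N i)" by (rule index_le_Int[OF _ sg])
  from index_le_trans[OF insert.IH this sg] insert.prems
  have "index_le A (?A \<inter> Y i) ((\<Prod>i\<in>F. N i) * N i)" by blast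
  moreover have "?A \<inter> Y i = A \<inter> (\<Inter>i\<in>insert i F. Y i)" by auto
  ultimately show ?case using insert.hyps by (simp add: mult.commute)
qed

lemma index_le_mult:
  fixes a :: "'b::field"
  assumes "index_le A Y N" "a \<noteq> 0"
  shows "index_le ((*) a ` A) ((*) a ` Y) N"
proof (rule index_leI)
  fix S assume S: "finite S" "S \<subseteq> (*) a ` A"
    and d: "\<And>s s'. s \<in> S \<Longrightarrow> s' \<in> S \<Longrightarrow> s - s' \<in> (*) a ` Y \<Longrightarrow> s = s'"
  have "card ((*) (inverse a) ` S) = card S"
    by (rule card_image) (use assms(2) in \<open>auto simp: inj_on_def\<close>)
  moreover have "real (card ((*) (inverse a) ` S)) \<le> N"
  proof (rule index_leD[OF assms(1)])
    show "(*) (inverse a) ` S \<subseteq> A"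
    proof
      fix x assume "x \<in> (*) (inverse a) ` S"
      then obtain u where "u \<in> A" "x = inverse a * (a * u)" using S(2) by blast
      then show "x \<in> A" using assms(2) by (simp add: field_simps)
    qed
  next
    fix s s' assume "s \<in> (*) (inverse a) ` S" "s' \<in> (*) (inverse a) ` S" "s - s' \<in> Y"
    then obtain u u' where u: "u \<in> S" "u' \<in> S" "s = inverse a * u" "s' = inverse a * u'"
      by blast
    have "u - u' = a * (s - s')" using u assms(2) by (simp add: field_simps)
    then show "s = s'" using d[of u u'] u \<open>s - s' \<in> Y\<close> by auto
  qed (use S in auto)
  ultimately show "real (card S) \<le> N" by simp
qed

text \<open>Think of C/P as a field acting on U/V: \<open>bound\<close> makes a longest independent
  family exist, and such a family generates. It is applied to the valuation ring at a place modulo a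
  uniformizer of \<open>k\<close>, and to the integers of K modulo T with \<open>C\<close> the
  constants and \<open>P\<close> = {0}.\<close>

lemma residue_basis:
  fixes U V C P :: "'b::field set" and n :: nat
  assumes C: "\<And>c c'. c \<in> C \<Longrightarrow> c' \<in> C \<Longrightarrow> c * c' \<in> C" "\<And>c. c \<in> C \<Longrightarrow> - c \<in> C"
    and V: "add_subgroup V" "\<And>c v. c \<in> C \<Longrightarrow> v \<in> V \<Longrightarrow> c * v \<in> V"
    and P: "\<And>p u. p \<in> P \<Longrightarrow> u \<in> U \<Longrightarrow> p * u \<in> V"
    and inv: "\<And>c. c \<in> C \<Longrightarrow> c \<notin> P \<Longrightarrow> \<exists>c'\<in>C. c' * c - 1 \<in> P"
    and bound: "\<And>r y. (\<And>i. i < r \<Longrightarrow> y i \<in> U) \<Longrightarrow>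
       (\<And>c. (\<forall>i<r. c i \<in> C) \<Longrightarrow> (\<Sum>i<r. c i * y i) \<in> V \<Longrightarrow> (\<forall>i<r. c i \<in> P)) \<Longrightarrow> r \<le> n"
  obtains r y where "r \<le> n" "\<And>i. i < r \<Longrightarrow> y i \<in> U"
    "\<And>c. (\<forall>i<r. c i \<in> C) \<Longrightarrow> (\<Sum>i<r. c i * y i) \<in> V \<Longrightarrow> (\<forall>i<r. c i \<in> P)"
    "\<And>u. u \<in> U \<Longrightarrow> \<exists>c. (\<forall>i<r. c i \<in> C) \<and> u - (\<Sum>i<r. c i * y i) \<in> V"
proof -
  define indep where "indep r y \<longleftrightarrow> (\<forall>i<r. y i \<in> U) \<and>
     (\<forall>c. (\<forall>i<r. c i \<in> C) \<longrightarrow> (\<Sum>i<r. c i * y i) \<in> V \<longrightarrow> (\<forall>i<r. c i \<in> P))" for r and y :: "nat \<Rightarrow> 'b"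
  have le: "r \<le> n" if "indep r y" for r y
    using that bound[of r y] unfolding indep_def by blast
  define r where "r = Max {r. \<exists>y. indep r y}"
  have fin: "finite {r. \<exists>y. indep r y}"
    by (rule finite_subset[of _ "{..n}"]) (use le in auto)
  have "0 \<in> {r. \<exists>y. indep r y}" by (auto simp: indep_def)
  then have "r \<in> {r. \<exists>y. indep r y}" unfolding r_def using fin Max_in by blast
  then obtain y where y: "indep r y" by blast
  have span: "\<exists>c. (\<forall>i<r. c i \<in> C) \<and> u - (\<Sum>i<r. c i * y i) \<in> V" if u: "u \<in> U" for u
  proof -
    have "\<not> indep (Suc r) (y(r := u))"
    proof
      assume "indep (Suc r) (y(r := u))"
      then have "Suc r \<le> r" unfolding r_def using fin by (intro Max_ge) auto
      then show False by simp
    qed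
    then obtain c where c: "\<forall>i<Suc r. c i \<in> C" "(\<Sum>i<Suc r. c i * (y(r := u)) i) \<in> V"
      "\<exists>i<Suc r. c i \<notin> P"
    proof -
      have "\<forall>i<Suc r. (y(r := u)) i \<in> U" using y u by (simp add: indep_def less_Suc_eq)
      then show ?thesis using \<open>\<not> indep (Suc r) (y(r := u))\<close> that unfolding indep_def by blast
    qed
    have sumeq: "(\<Sum>i<Suc r. c i * (y(r := u)) i) = (\<Sum>i<r. c i * y i) + c r * u"
      by simp
    have "c r \<notin> P"
    proof
      assume cr: "c r \<in> P"
      then have "(\<Sum>i<r. c i * y i) \<in> V"
        using add_subgroup_diff[OF V(1) c(2) P[OF cr u]] unfolding sumeq by simp
      then have "\<forall>i<r. c i \<in> P" using y c(1) by (simp add: indep_def)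
      then show False using c(3) cr by (metis less_antisym)
    qed
    then obtain c' where c': "c' \<in> C" "c' * c r - 1 \<in> P" using inv c(1) by blast
    \<comment> \<open>The coefficient of \<open>u\<close> is invertible modulo \<open>P\<close>;
      multiplying by \<open>c'\<close> isolates \<open>u\<close> up to an element of
      \<open>P\<close> times \<open>u\<close>, which \<open>V\<close> absorbs.\<close>
    have "c' * ((\<Sum>i<r. c i * y i) + c r * u) - (c' * c r - 1) * u \<in> V"
      using c(2) unfolding sumeq by (intro add_subgroup_diff[OF V(1)] V(2) P c' u)
    moreover have "c' * ((\<Sum>i<r. c i * y i) + c r * u) - (c' * c r - 1) * u =
        u - (\<Sum>i<r. - (c' * c i) * y i)"
      by (simp add: algebra_simps sum_distrib_left sum_negf)
    ultimately show ?thesis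
      using c(1) c'(1) C by (intro exI[of _ "\<lambda>i. - (c' * c i)"]) auto
  qed
  show ?thesis
    by (rule that[of r y]) (use y le span in \<open>auto simp: indep_def\<close>)
qed

text \<open>Filter by the groups \<open>W k\<close> of combinations of the first \<open>k\<close>
  generators modulo \<open>V\<close>. Passing from \<open>W k\<close> to \<open>W (Suc k)\<close>,
  the new coefficient matters only modulo \<open>P\<close>, which costs a factor
  \<open>Q\<close>.\<close>

lemma residue_index:
  fixes U V C P :: "'b::field set" and y :: "nat \<Rightarrow> 'b"
  assumes C: "add_subgroup C" and V: "add_subgroup V"
    and P: "\<And>p u. p \<in> P \<Longrightarrow> u \<in> U \<Longrightarrow> p * u \<in> V"
    and y: "\<And>i. i < r \<Longrightarrow> y i \<in> U"
    and span: "\<And>u. u \<in> U \<Longrightarrow> \<exists>c. (\<forall>i<r. c i \<in> C) \<and> u - (\<Sum>i<r. c i * y i) \<in> V"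
    and Q: "index_le C P Q"
  shows "index_le U V (Q ^ r)"
proof -
  define W where "W k = {u. \<exists>c. (\<forall>i<k. c i \<in> C) \<and> u - (\<Sum>i<k. c i * y i) \<in> V}" for k
  have sg: "add_subgroup (W k)" for k
    unfolding add_subgroup_def
  proof (intro conjI ballI)
    show "0 \<in> W k"
      unfolding W_def by (auto intro!: exI[of _ "\<lambda>_. 0"] simp: add_subgroup_0 C V)
    fix a b assume "a \<in> W k" "b \<in> W k"
    then obtain c c' where c: "\<forall>i<k. c i \<in> C" "a - (\<Sum>i<k. c i * y i) \<in> V"
      "\<forall>i<k. c' i \<in> C" "b - (\<Sum>i<k. c' i * y i) \<in> V" unfolding W_def by blast
    have "(a - b) - (\<Sum>i<k. (c i - c' i) * y i) =
       (a - (\<Sum>i<k. c i * y i)) - (b - (\<Sum>i<k. c' i * y i))"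
      by (simp add: algebra_simps sum_subtractf)
    also have "\<dots> \<in> V" by (intro add_subgroup_diff[OF V] c)
    finally show "a - b \<in> W k"
      unfolding W_def using c add_subgroup_diff[OF C] by (intro CollectI exI[of _ "\<lambda>i. c i - c' i"]) auto
  qed
  have "index_le (W k) V (Q ^ k)" if "k \<le> r" for k
    using that
  proof (induction k)
    case 0
    have "W 0 = V" by (auto simp: W_def)
    then show ?case
      using index_le_INT[of "{}" "V" "\<lambda>_. {}" "\<lambda>_. 0"] V by simp
  next
    case (Suc k)
    have "index_le (W (Suc k)) (W k) Q"
    proof (rule index_leI)
      fix S assume S: "finite S" "S \<subseteq> W (Suc k)"
        and d: "\<And>s s'. s \<in> S \<Longrightarrow> s' \<in> S \<Longrightarrow> s - s' \<in> W k \<Longrightarrow> s = s'"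
      have "\<forall>s\<in>S. \<exists>c. (\<forall>i<Suc k. c i \<in> C) \<and> s - (\<Sum>i<Suc k. c i * y i) \<in> V"
        using S(2) unfolding W_def by blast
      then obtain c where c: "\<And>s. s \<in> S \<Longrightarrow> (\<forall>i<Suc k. c s i \<in> C) \<and> s - (\<Sum>i<Suc k. c s i * y i) \<in> V"
        by metis
      have eq: "s = s'" if s: "s \<in> S" "s' \<in> S" "c s k - c s' k \<in> P" for s s'
      proof (rule d[OF s(1,2)])
        have "(c s k - c s' k) * y k \<in> V" using s(3) y Suc.prems by (intro P) auto
        from add_subgroup_add[OF V add_subgroup_diff[OF V conjunct2[OF c[OF s(1)]] conjunct2[OF c[OF s(2)]]] this]
        have "(s - (\<Sum>i<Suc k. c s i * y i)) - (s' - (\<Sum>i<Suc k. c s' i * y i))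
              + (c s k - c s' k) * y k \<in> V" .
        also have "(s - (\<Sum>i<Suc k. c s i * y i)) - (s' - (\<Sum>i<Suc k. c s' i * y i))
              + (c s k - c s' k) * y k = (s - s') - (\<Sum>i<k. (c s i - c s' i) * y i)"
          by (simp add: algebra_simps sum_subtractf)
        finally show "s - s' \<in> W k" unfolding W_def using c s add_subgroup_diff[OF C]
          by (intro CollectI exI[of _ "\<lambda>i. c s i - c s' i"]) (auto simp: less_Suc_eq)
      qed
      \<comment> \<open>\<open>P\<close> is not assumed to contain 0, so equal coefficients are
        treated apart from congruent ones.\<close>
      have "inj_on (\<lambda>s. c s k) S"
      proof (rule inj_onI)
        fix s s' assume s: "s \<in> S" "s' \<in> S" "c s k = c s' k"
        have "(s - (\<Sum>i<Suc k. c s i * y i)) - (s' - (\<Sum>i<Suc k. c s' i * y i)) \<in> V"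
          by (rule add_subgroup_diff[OF V conjunct2[OF c[OF s(1)]] conjunct2[OF c[OF s(2)]]])
        also have "(s - (\<Sum>i<Suc k. c s i * y i)) - (s' - (\<Sum>i<Suc k. c s' i * y i))
              = (s - s') - (\<Sum>i<k. (c s i - c s' i) * y i)"
          using s(3) by (simp add: algebra_simps sum_subtractf)
        finally have "s - s' \<in> W k" unfolding W_def using c s add_subgroup_diff[OF C]
          by (intro CollectI exI[of _ "\<lambda>i. c s i - c s' i"]) (auto simp: less_Suc_eq)
        then show "s = s'" using d s by blast
      qed
      then have "card ((\<lambda>s. c s k) ` S) = card S" by (rule card_image)
      moreover have "real (card ((\<lambda>s. c s k) ` S)) \<le> Q"
      proof (rule index_leD[OF Q])
        show "(\<lambda>s. c s k) ` S \<subseteq> C" using c by auto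
        fix a b assume "a \<in> (\<lambda>s. c s k) ` S" "b \<in> (\<lambda>s. c s k) ` S" "a - b \<in> P"
        then show "a = b" using eq by blast
      qed (use S in auto)
      ultimately show "real (card S) \<le> Q" by simp
    qed
    from index_le_trans[OF this Suc.IH sg] Suc.prems show ?case by simp
  qed
  moreover have "U \<subseteq> W r" using span unfolding W_def by blast
  ultimately show ?thesis using index_le_mono[of "W r" V "Q ^ r" U V "Q ^ r"] by simp
qed

section \<open>Valuations and completions\<close>

definition intermediate_field :: "'a::field kbar set \<Rightarrow> bool" where
  "intermediate_field K \<longleftrightarrow> range to_ac \<subseteq> K \<and> (\<forall>x\<in>K. \<forall>y\<in>K. x - y \<in> K \<and> x * y \<in> K) \<and>
     (\<forall>x\<in>K. inverse x \<in> K)"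

definition val_ge :: "'b::field set \<Rightarrow> ('b \<Rightarrow> real) \<Rightarrow> real \<Rightarrow> 'b set" where
  "val_ge K w r = {y \<in> K. y = 0 \<or> r \<le> w y}"

locale valued_field =
  fixes K :: "'a::field kbar set" and w :: "'a kbar \<Rightarrow> real"
  assumes K: "intermediate_field K" and w: "valuation_on K w"
begin

lemma K_base [simp, intro]: "to_ac c \<in> K"
  using K by (auto simp: intermediate_field_def)

lemma K_0 [simp, intro]: "0 \<in> K" and K_1 [simp, intro]: "1 \<in> K"
  using K_base[of 0] K_base[of 1] by auto

lemma K_diff [simp, intro]: "x \<in> K \<Longrightarrow> y \<in> K \<Longrightarrow> x - y \<in> K"
  and K_mult [simp, intro]: "x \<in> K \<Longrightarrow> y \<in> K \<Longrightarrow> x * y \<in> K"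
  and K_inverse [simp, intro]: "x \<in> K \<Longrightarrow> inverse x \<in> K"
  using K by (auto simp: intermediate_field_def)

lemma K_divide [simp, intro]: "x \<in> K \<Longrightarrow> y \<in> K \<Longrightarrow> x / y \<in> K"
  by (auto simp: divide_inverse)

lemma K_subgroup: "add_subgroup K"
  by (auto simp: add_subgroup_def)

lemma K_uminus [simp, intro]: "x \<in> K \<Longrightarrow> - x \<in> K"
  and K_add [simp, intro]: "x \<in> K \<Longrightarrow> y \<in> K \<Longrightarrow> x + y \<in> K"
  and K_sum [intro]: "(\<And>i. i \<in> I \<Longrightarrow> f i \<in> K) \<Longrightarrow> sum f I \<in> K"
  using K_subgroup by (auto intro: add_subgroup_uminus add_subgroup_add add_subgroup_sum)

lemma K_power [simp, intro]: "x \<in> K \<Longrightarrow> x ^ n \<in> K"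
  by (induction n) auto

lemma w_mult: "x \<in> K \<Longrightarrow> y \<in> K \<Longrightarrow> x \<noteq> 0 \<Longrightarrow> y \<noteq> 0 \<Longrightarrow> w (x * y) = w x + w y"
  and w_add: "x \<in> K \<Longrightarrow> y \<in> K \<Longrightarrow> x \<noteq> 0 \<Longrightarrow> y \<noteq> 0 \<Longrightarrow> x + y \<noteq> 0 \<Longrightarrow> min (w x) (w y) \<le> w (x + y)"
  and w_outside: "x \<notin> K \<Longrightarrow> w x = 0"
  using w by (auto simp: valuation_on_def)

lemma w_0 [simp]: "w 0 = 0"
  using w by (auto simp: valuation_on_def)

lemma w_1 [simp]: "w 1 = 0"
  using w_mult[of 1 1] by simp

lemma w_inverse: "x \<in> K \<Longrightarrow> x \<noteq> 0 \<Longrightarrow> w (inverse x) = - w x"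
  using w_mult[of x "inverse x"] by simp

lemma w_divide: "x \<in> K \<Longrightarrow> y \<in> K \<Longrightarrow> x \<noteq> 0 \<Longrightarrow> y \<noteq> 0 \<Longrightarrow> w (x / y) = w x - w y"
  by (simp add: divide_inverse w_mult w_inverse K_inverse)

lemma w_power: "x \<in> K \<Longrightarrow> x \<noteq> 0 \<Longrightarrow> w (x ^ n) = n * w x"
  by (induction n) (auto simp: w_mult K_power algebra_simps)

lemma w_uminus: "x \<in> K \<Longrightarrow> w (- x) = w x"
proof (cases "x = 0")
  case False
  assume x: "x \<in> K"
  have "w (- 1) + w (- 1) = w ((- 1) * (- 1))" by (rule w_mult[symmetric]) auto
  then have "w (- 1) = 0" by simp
  then show ?thesis using w_mult[of "- 1" x] x False by auto
qed simp

lemma val_ge_subgroup: "add_subgroup (val_ge K w r)"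
  unfolding add_subgroup_def
proof (intro conjI ballI)
  fix x y assume xy: "x \<in> val_ge K w r" "y \<in> val_ge K w r"
  show "x - y \<in> val_ge K w r"
  proof (cases "x = 0 \<or> y = 0 \<or> x - y = 0")
    case True
    then show ?thesis using xy by (auto simp: val_ge_def w_uminus)
  next
    case False
    then show ?thesis using xy w_add[of x "- y"] by (auto simp: val_ge_def w_uminus)
  qed
qed (auto simp: val_ge_def)

lemma val_ge_base_subgroup: "add_subgroup (to_ac ` {c. to_ac c \<in> val_ge K w r})"
  unfolding add_subgroup_def
proof (intro conjI ballI)
  show "0 \<in> to_ac ` {c. to_ac c \<in> val_ge K w r}"
    using add_subgroup_0[OF val_ge_subgroup] by (intro image_eqI[of _ _ 0]) auto
  fix x y assume "x \<in> to_ac ` {c. to_ac c \<in> val_ge K w r}" "y \<in> to_ac ` {c. to_ac c \<in> val_ge K w r}"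
  then obtain a b where "x = to_ac a" "y = to_ac b" "to_ac a \<in> val_ge K w r" "to_ac b \<in> val_ge K w r"
    by auto
  then show "x - y \<in> to_ac ` {c. to_ac c \<in> val_ge K w r}"
    using add_subgroup_diff[OF val_ge_subgroup] by (intro image_eqI[of _ _ "a - b"]) auto
qed

lemmas val_ge_diff = add_subgroup_diff[OF val_ge_subgroup]
  and val_ge_add = add_subgroup_add[OF val_ge_subgroup]
  and val_ge_uminus = add_subgroup_uminus[OF val_ge_subgroup]
  and val_ge_sum = add_subgroup_sum[OF val_ge_subgroup]
  and val_ge_0 = add_subgroup_0[OF val_ge_subgroup]

lemma val_ge_K: "x \<in> val_ge K w r \<Longrightarrow> x \<in> K"
  by (simp add: val_ge_def)

lemma val_ge_mult: "x \<in> val_ge K w r \<Longrightarrow> y \<in> val_ge K w s \<Longrightarrow> x * y \<in> val_ge K w (r + s)"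
proof (cases "x = 0 \<or> y = 0")
  case False
  then show "x \<in> val_ge K w r \<Longrightarrow> y \<in> val_ge K w s \<Longrightarrow> x * y \<in> val_ge K w (r + s)"
    using w_mult[of x y] by (auto simp: val_ge_def)
qed (auto simp: val_ge_def)

lemma val_ge_mono: "x \<in> val_ge K w r \<Longrightarrow> s \<le> r \<Longrightarrow> x \<in> val_ge K w s"
  by (auto simp: val_ge_def)

lemma val_ge_w: "x \<in> K \<Longrightarrow> x \<in> val_ge K w (w x)"
  by (auto simp: val_ge_def)

text \<open>Carries an index between two levels over to every pair of levels shifted by a value of
  \<open>w\<close>.\<close>

lemma val_ge_eq_mult: "a \<in> K \<Longrightarrow> a \<noteq> 0 \<Longrightarrow> val_ge K w (r + w a) = (*) a ` val_ge K w r"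
proof (intro equalityI subsetI)
  fix x assume a: "a \<in> K" "a \<noteq> 0" and x: "x \<in> val_ge K w (r + w a)"
  then have "x / a \<in> val_ge K w r" using w_divide[of x a] by (cases "x = 0") (auto simp: val_ge_def)
  then show "x \<in> (*) a ` val_ge K w r" using a by (intro image_eqI[of _ _ "x / a"]) auto
next
  fix x assume a: "a \<in> K" "a \<noteq> 0" and "x \<in> (*) a ` val_ge K w r"
  then obtain u where u: "u \<in> val_ge K w r" "x = a * u" by blast
  then show "x \<in> val_ge K w (r + w a)"
    using val_ge_mult[OF u(1) val_ge_w[OF a(1)]] by (simp add: mult.commute)
qed

section \<open>Cauchy sequences and null sequences of a valuation\<close>

lemma cauchy_seqs_eq:
  assumes "F \<subseteq> K"
  shows "cauchy_seqs F w = {s. range s \<subseteq> F \<and> (\<forall>B. \<exists>M. \<forall>m\<ge>M. \<forall>n\<ge>M. s m - s n \<in> val_ge K w B)}"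
  unfolding cauchy_seqs_def
proof (intro Collect_cong conj_cong refl)
  fix s :: "nat \<Rightarrow> 'a kbar" assume "range s \<subseteq> F"
  then have "s m = s n \<or> B \<le> w (s m - s n) \<longleftrightarrow> s m - s n \<in> val_ge K w B" for m n B
    using assms by (auto simp: val_ge_def)
  then show "(\<forall>B. \<exists>M. \<forall>m\<ge>M. \<forall>n\<ge>M. s m = s n \<or> B \<le> w (s m - s n)) \<longleftrightarrow>
      (\<forall>B. \<exists>M. \<forall>m\<ge>M. \<forall>n\<ge>M. s m - s n \<in> val_ge K w B)" by simp
qed

lemma null_seqs_eq:
  "null_seqs K w = {s. range s \<subseteq> K \<and> (\<forall>B. \<exists>M. \<forall>n\<ge>M. s n \<in> val_ge K w B)}"
  unfolding null_seqs_def
proof (intro Collect_cong conj_cong refl)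
  fix s :: "nat \<Rightarrow> 'a kbar" assume "range s \<subseteq> K"
  then have "s n = 0 \<or> B \<le> w (s n) \<longleftrightarrow> s n \<in> val_ge K w B" for n B
    by (auto simp: val_ge_def)
  then show "(\<forall>B. \<exists>M. \<forall>n\<ge>M. s n = 0 \<or> B \<le> w (s n)) \<longleftrightarrow>
      (\<forall>B. \<exists>M. \<forall>n\<ge>M. s n \<in> val_ge K w B)" by simp
qed

lemma cauchyI:
  assumes "F \<subseteq> K" "\<And>n. s n \<in> F" "\<And>B. \<exists>M. \<forall>m\<ge>M. \<forall>n\<ge>M. s m - s n \<in> val_ge K w B"
  shows "s \<in> cauchy_seqs F w"
  using assms by (auto simp: cauchy_seqs_eq)

lemma cauchy_range: "s \<in> cauchy_seqs F w \<Longrightarrow> s n \<in> F"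
  by (auto simp: cauchy_seqs_def)

lemma cauchyE:
  assumes "F \<subseteq> K" "s \<in> cauchy_seqs F w"
  obtains M where "\<And>m n. m \<ge> M \<Longrightarrow> n \<ge> M \<Longrightarrow> s m - s n \<in> val_ge K w B"
proof -
  have "\<forall>B. \<exists>M. \<forall>m\<ge>M. \<forall>n\<ge>M. s m - s n \<in> val_ge K w B"
    using assms(2) by (simp add: cauchy_seqs_eq[OF assms(1)])
  then obtain M where "\<forall>m\<ge>M. \<forall>n\<ge>M. s m - s n \<in> val_ge K w B" by presburger
  then show ?thesis by (intro that) blast
qed

lemma nullI:
  assumes "\<And>n. s n \<in> K" "\<And>B. \<exists>M. \<forall>n\<ge>M. s n \<in> val_ge K w B"
  shows "s \<in> null_seqs K w"
  using assms by (auto simp: null_seqs_eq)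

lemma null_range: "s \<in> null_seqs K w \<Longrightarrow> s n \<in> K"
  by (auto simp: null_seqs_def)

lemma nullE:
  assumes "s \<in> null_seqs K w"
  obtains M where "\<And>n. n \<ge> M \<Longrightarrow> s n \<in> val_ge K w B"
proof -
  have "\<forall>B. \<exists>M. \<forall>n\<ge>M. s n \<in> val_ge K w B"
    using assms by (simp add: null_seqs_eq)
  then obtain M where "\<forall>n\<ge>M. s n \<in> val_ge K w B" by presburger
  then show ?thesis by (intro that) blast
qed

lemma cauchy_bounded:
  assumes "F \<subseteq> K" "s \<in> cauchy_seqs F w"
  obtains M B where "\<And>n. n \<ge> M \<Longrightarrow> s n \<in> val_ge K w B"
proof -
  obtain M where M: "\<And>m n. m \<ge> M \<Longrightarrow> n \<ge> M \<Longrightarrow> s m - s n \<in> val_ge K w 0"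
    using cauchyE[OF assms] by blast
  have "s n \<in> val_ge K w (min 0 (w (s M)))" if "n \<ge> M" for n
  proof -
    have "s M \<in> K" using assms cauchy_range by blast
    then have "(s n - s M) + s M \<in> val_ge K w (min 0 (w (s M)))"
      by (intro val_ge_add val_ge_mono[OF M[OF that order_refl]] val_ge_mono[OF val_ge_w]) auto
    then show ?thesis by simp
  qed
  then show ?thesis using that by blast
qed

lemma cauchy_seqs_mult:
  assumes F: "F \<subseteq> K" "\<And>x y. x \<in> F \<Longrightarrow> y \<in> F \<Longrightarrow> x * y \<in> F"
    and s: "s \<in> cauchy_seqs F w" "t \<in> cauchy_seqs F w"
  shows "(\<lambda>n. s n * t n) \<in> cauchy_seqs F w"
proof -
  obtain M1 B1 where 1: "\<And>n. n \<ge> M1 \<Longrightarrow> s n \<in> val_ge K w B1"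
    using cauchy_bounded[OF F(1) s(1)] by blast
  obtain M2 B2 where 2: "\<And>n. n \<ge> M2 \<Longrightarrow> t n \<in> val_ge K w B2"
    using cauchy_bounded[OF F(1) s(2)] by blast
  have "\<exists>M. \<forall>m\<ge>M. \<forall>n\<ge>M. s m * t m - s n * t n \<in> val_ge K w B" for B
  proof -
    obtain M3 where 3: "\<And>m n. m \<ge> M3 \<Longrightarrow> n \<ge> M3 \<Longrightarrow> s m - s n \<in> val_ge K w (B - B2)"
      using cauchyE[OF F(1) s(1)] by blast
    obtain M4 where 4: "\<And>m n. m \<ge> M4 \<Longrightarrow> n \<ge> M4 \<Longrightarrow> t m - t n \<in> val_ge K w (B - B1)"
      using cauchyE[OF F(1) s(2)] by blast
    have "s m * t m - s n * t n \<in> val_ge K w B"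
      if "m \<ge> Max {M1, M2, M3, M4}" "n \<ge> Max {M1, M2, M3, M4}" for m n
    proof -
      have "s m * (t m - t n) + (s m - s n) * t n \<in> val_ge K w B"
        using val_ge_mult[OF 1 4, of m m n] val_ge_mult[OF 3 2, of m n n] that
        by (intro val_ge_add) auto
      then show ?thesis by (simp add: algebra_simps)
    qed
    then show ?thesis by blast
  qed
  then show ?thesis using F cauchy_range[OF s(1)] cauchy_range[OF s(2)] by (intro cauchyI) auto
qed

lemma cauchy_seqs_diff:
  assumes F: "F \<subseteq> K" "add_subgroup F"
    and s: "s \<in> cauchy_seqs F w" "t \<in> cauchy_seqs F w"
  shows "(\<lambda>n. s n - t n) \<in> cauchy_seqs F w"
proof -
  have "\<exists>M. \<forall>m\<ge>M. \<forall>n\<ge>M. (s m - t m) - (s n - t n) \<in> val_ge K w B" for B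
  proof -
    obtain M3 where 3: "\<And>m n. m \<ge> M3 \<Longrightarrow> n \<ge> M3 \<Longrightarrow> s m - s n \<in> val_ge K w B"
      using cauchyE[OF F(1) s(1)] by blast
    obtain M4 where 4: "\<And>m n. m \<ge> M4 \<Longrightarrow> n \<ge> M4 \<Longrightarrow> t m - t n \<in> val_ge K w B"
      using cauchyE[OF F(1) s(2)] by blast
    have "(s m - t m) - (s n - t n) \<in> val_ge K w B" if "m \<ge> max M3 M4" "n \<ge> max M3 M4" for m n
      using val_ge_diff[OF 3[of m n] 4[of m n]] that by (simp add: algebra_simps)
    then show ?thesis by blast
  qed
  then show ?thesis
    using add_subgroup_diff[OF F(2) cauchy_range[OF s(1)] cauchy_range[OF s(2)]] F(1)
    by (intro cauchyI) auto
qed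

lemma cauchy_seqs_const: "F \<subseteq> K \<Longrightarrow> c \<in> F \<Longrightarrow> (\<lambda>_. c) \<in> cauchy_seqs F w"
  by (rule cauchyI) (auto simp: val_ge_0)

lemma cauchy_seqs_add:
  assumes F: "F \<subseteq> K" "add_subgroup F"
    and s: "s \<in> cauchy_seqs F w" "t \<in> cauchy_seqs F w"
  shows "(\<lambda>n. s n + t n) \<in> cauchy_seqs F w"
  using cauchy_seqs_diff[OF F s(1) cauchy_seqs_diff[OF F cauchy_seqs_const[OF F(1)] s(2)], of 0] F(2)
  by (simp add: add_subgroup_0)

lemma null_seqs_cauchy: "s \<in> null_seqs K w \<Longrightarrow> s \<in> cauchy_seqs K w"
proof (rule cauchyI)
  assume s: "s \<in> null_seqs K w"
  show "\<exists>M. \<forall>m\<ge>M. \<forall>n\<ge>M. s m - s n \<in> val_ge K w B" for B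
    using nullE[OF s, of B] val_ge_diff by metis
qed (auto dest: null_range)

lemma null_seqs_diff:
  assumes "s \<in> null_seqs K w" "t \<in> null_seqs K w"
  shows "(\<lambda>n. s n - t n) \<in> null_seqs K w"
proof -
  have "\<exists>M. \<forall>n\<ge>M. s n - t n \<in> val_ge K w B" for B
  proof -
    obtain M1 M2 where "\<forall>n\<ge>M1. s n \<in> val_ge K w B" "\<forall>n\<ge>M2. t n \<in> val_ge K w B"
      using nullE[OF assms(1)] nullE[OF assms(2)] by metis
    then show ?thesis by (intro exI[of _ "max M1 M2"]) (auto intro: val_ge_diff)
  qed
  then show ?thesis using null_range[OF assms(1)] null_range[OF assms(2)] by (intro nullI) auto
qed

lemma null_seqs_mult:
  assumes s: "s \<in> cauchy_seqs K w" and t: "t \<in> null_seqs K w"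
  shows "(\<lambda>n. s n * t n) \<in> null_seqs K w"
proof -
  obtain M1 B1 where 1: "\<And>n. n \<ge> M1 \<Longrightarrow> s n \<in> val_ge K w B1"
    using cauchy_bounded[OF order_refl s] by blast
  have "\<exists>M. \<forall>n\<ge>M. s n * t n \<in> val_ge K w B" for B
  proof -
    obtain M2 where 2: "\<And>n. n \<ge> M2 \<Longrightarrow> t n \<in> val_ge K w (B - B1)"
      using nullE[OF t] by blast
    have "s n * t n \<in> val_ge K w B" if "n \<ge> max M1 M2" for n
      using val_ge_mult[OF 1 2, of n n] that by simp
    then show ?thesis by blast
  qed
  then show ?thesis using cauchy_range[OF s] null_range[OF t] by (intro nullI) auto
qed

lemma null_seqs_0: "(\<lambda>_. 0) \<in> null_seqs K w"
  by (auto simp: null_seqs_eq val_ge_0)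

lemma one_not_null: "(\<lambda>_. 1) \<notin> null_seqs K w"
proof
  assume *: "(\<lambda>_. 1) \<in> null_seqs K w"
  have "(1 :: 'a kbar) \<in> val_ge K w 1" by (rule nullE[OF *]) blast
  then show False by (simp add: val_ge_def)
qed

text \<open>A Cauchy sequence that is not null eventually has values below a fixed bound
  \<open>B\<close>, so termwise inversion from some index on is again Cauchy. The subfield
  \<open>F\<close> is a parameter since the argument is applied both to K and to
  \<open>k\<close>.\<close>

lemma cauchy_seqs_inverse:
  assumes F: "F \<subseteq> K" "0 \<in> F" "\<And>x. x \<in> F \<Longrightarrow> inverse x \<in> F"
    and s: "s \<in> cauchy_seqs F w" "s \<notin> null_seqs K w"
  obtains t where "t \<in> cauchy_seqs F w" "(\<lambda>n. s n * t n - 1) \<in> null_seqs K w"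
proof -
  have sK: "s n \<in> K" for n using s F cauchy_range by blast
  then obtain B where B: "\<And>M. \<exists>n\<ge>M. s n \<notin> val_ge K w B"
    using s(2) nullI[of s] by blast
  obtain M where M: "\<And>m n. m \<ge> M \<Longrightarrow> n \<ge> M \<Longrightarrow> s m - s n \<in> val_ge K w B"
    using cauchyE[OF F(1) s(1)] by blast
  obtain n0 where n0: "n0 \<ge> M" "s n0 \<notin> val_ge K w B" using B by blast
  have far: "s n \<noteq> 0 \<and> w (s n) < B" if "n \<ge> M" for n
  proof -
    have "s n \<notin> val_ge K w B" using val_ge_add[OF M[OF n0(1) that], of "s n"] n0(2) by auto
    then show ?thesis using sK by (auto simp: val_ge_def)
  qed
  define t where "t n = (if n \<ge> M then inverse (s n) else 0)" for n
  have "\<exists>M. \<forall>m\<ge>M. \<forall>n\<ge>M. t m - t n \<in> val_ge K w B'" for B'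
  proof -
    obtain M' where M': "\<And>m n. m \<ge> M' \<Longrightarrow> n \<ge> M' \<Longrightarrow> s m - s n \<in> val_ge K w (B' + B + B)"
      using cauchyE[OF F(1) s(1)] by blast
    have "t m - t n \<in> val_ge K w B'" if mn: "m \<ge> max M M'" "n \<ge> max M M'" for m n
    proof -
      have inv: "inverse (s i) \<in> val_ge K w (- B)" if "i \<ge> M" for i
        using far[OF that] sK[of i] by (auto simp: val_ge_def w_inverse)
      have "(s n - s m) * inverse (s n) * inverse (s m) \<in> val_ge K w B'"
        using val_ge_mult[OF val_ge_mult[OF M'[of n m] inv[of n]] inv[of m]] mn by simp
      moreover have "t m - t n = (s n - s m) * inverse (s n) * inverse (s m)"
        using mn far[of n] far[of m] by (auto simp: t_def field_simps)
      ultimately show ?thesis by simp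
    qed
    then show ?thesis by blast
  qed
  moreover have "t n \<in> F" for n using F cauchy_range[OF s(1)] by (simp add: t_def)
  ultimately have t: "t \<in> cauchy_seqs F w" using F(1) by (intro cauchyI)
  have "s n * t n - 1 = 0" if "n \<ge> M" for n using far[OF that] that by (simp add: t_def)
  then have "\<exists>M. \<forall>n\<ge>M. s n * t n - 1 \<in> val_ge K w B" for B by (metis val_ge_0)
  moreover have "t n \<in> K" for n using t F(1) cauchy_range by blast
  ultimately have "(\<lambda>n. s n * t n - 1) \<in> null_seqs K w" using sK
    by (intro nullI) auto
  with t show ?thesis using that by blast
qed

lemma cauchy_cring: "cring (cauchy_ring K w)"
proof (intro cringI abelian_groupI comm_monoidI)
  fix s assume s: "s \<in> carrier (cauchy_ring K w)"
  have "(\<lambda>n. 0 - s n) \<in> cauchy_seqs K w"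
    using s by (intro cauchy_seqs_diff cauchy_seqs_const) (auto simp: cauchy_ring_def K_subgroup)
  then show "\<exists>t\<in>carrier (cauchy_ring K w). t \<oplus>\<^bsub>cauchy_ring K w\<^esub> s = \<zero>\<^bsub>cauchy_ring K w\<^esub>"
    by (intro bexI[of _ "\<lambda>n. 0 - s n"]) (auto simp: cauchy_ring_def)
qed (auto simp: cauchy_ring_def algebra_simps K_subgroup
     intro!: cauchy_seqs_add cauchy_seqs_mult cauchy_seqs_const)

lemma null_ideal: "ideal (null_seqs K w) (cauchy_ring K w)"
proof (rule idealI)
  interpret cring "cauchy_ring K w" by (rule cauchy_cring)
  show "Ring.ring (cauchy_ring K w)" by unfold_locales
  have uminus: "(\<lambda>n. - s n) \<in> null_seqs K w" if "s \<in> null_seqs K w" for s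
    using null_seqs_diff[OF null_seqs_0 that] by simp
  have a_inv: "\<ominus>\<^bsub>cauchy_ring K w\<^esub> s = (\<lambda>n. - s n)" if "s \<in> null_seqs K w" for s
    using that uminus[OF that] null_seqs_cauchy
    by (intro minus_equality) (auto simp: cauchy_ring_def)
  show "subgroup (null_seqs K w) (add_monoid (cauchy_ring K w))"
  proof (rule add.subgroupI)
    show "null_seqs K w \<subseteq> carrier (cauchy_ring K w)"
      using null_seqs_cauchy by (auto simp: cauchy_ring_def)
    show "null_seqs K w \<noteq> {}" using null_seqs_0 by blast
    show "\<ominus>\<^bsub>cauchy_ring K w\<^esub> s \<in> null_seqs K w" if "s \<in> null_seqs K w" for s
      using a_inv uminus that by simp
    show "s \<oplus>\<^bsub>cauchy_ring K w\<^esub> t \<in> null_seqs K w" if "s \<in> null_seqs K w" "t \<in> null_seqs K w" for s t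
      using null_seqs_diff[OF that(1) uminus[OF that(2)]] by (simp add: cauchy_ring_def)
  qed
  show "x \<otimes>\<^bsub>cauchy_ring K w\<^esub> a \<in> null_seqs K w" "a \<otimes>\<^bsub>cauchy_ring K w\<^esub> x \<in> null_seqs K w"
    if "a \<in> null_seqs K w" "x \<in> carrier (cauchy_ring K w)" for a x
    using null_seqs_mult[of x a] that by (auto simp: cauchy_ring_def mult.commute)
qed

end

section \<open>The completion as a field over the closure of k\<close>

context valued_field
begin

abbreviation residue_class :: "(nat \<Rightarrow> 'a kbar) \<Rightarrow> (nat \<Rightarrow> 'a kbar) set" where
  "residue_class s \<equiv> null_seqs K w +>\<^bsub>cauchy_ring K w\<^esub> s"

lemma completion_cring: "cring (completion K w)"
  unfolding completion_def
  by (rule ideal.quotient_is_cring[OF null_ideal cauchy_cring])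

lemma completion_hom: "ring_hom_ring (cauchy_ring K w) (completion K w) residue_class"
  unfolding completion_def by (rule ideal.rcos_ring_hom_ring[OF null_ideal])

lemma carrier_completion: "carrier (completion K w) = residue_class ` cauchy_seqs K w"
  by (auto simp: completion_def FactRing_def A_RCOSETS_def' cauchy_ring_def)

lemma zero_completion: "\<zero>\<^bsub>completion K w\<^esub> = null_seqs K w"
  by (simp add: completion_def FactRing_def)

lemma residue_class_zero_iff:
  assumes "s \<in> cauchy_seqs K w"
  shows "residue_class s = \<zero>\<^bsub>completion K w\<^esub> \<longleftrightarrow> s \<in> null_seqs K w"
proof -
  interpret cring "cauchy_ring K w" by (rule cauchy_cring)
  show ?thesis
    using ideal.rcos_const_imp_mem[OF null_ideal, of s] a_rcos_zero[OF null_ideal, of s] assms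
    by (auto simp: zero_completion cauchy_ring_def)
qed

lemma residue_class_add:
  "s \<in> cauchy_seqs K w \<Longrightarrow> t \<in> cauchy_seqs K w \<Longrightarrow>
     residue_class s \<oplus>\<^bsub>completion K w\<^esub> residue_class t = residue_class (\<lambda>n. s n + t n)"
  and residue_class_mult:
  "s \<in> cauchy_seqs K w \<Longrightarrow> t \<in> cauchy_seqs K w \<Longrightarrow>
     residue_class s \<otimes>\<^bsub>completion K w\<^esub> residue_class t = residue_class (\<lambda>n. s n * t n)"
proof -
  interpret ring_hom_ring "cauchy_ring K w" "completion K w" residue_class
    by (rule completion_hom)
  assume "s \<in> cauchy_seqs K w" "t \<in> cauchy_seqs K w"
  then show "residue_class s \<oplus>\<^bsub>completion K w\<^esub> residue_class t = residue_class (\<lambda>n. s n + t n)"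
    "residue_class s \<otimes>\<^bsub>completion K w\<^esub> residue_class t = residue_class (\<lambda>n. s n * t n)"
    using hom_add[of s t] hom_mult[of s t] by (auto simp: cauchy_ring_def)
qed

lemma residue_class_one: "residue_class (\<lambda>_. 1) = \<one>\<^bsub>completion K w\<^esub>"
proof -
  interpret ring_hom_ring "cauchy_ring K w" "completion K w" residue_class
    by (rule completion_hom)
  show ?thesis using hom_one by (simp add: cauchy_ring_def)
qed

lemma residue_class_eq:
  assumes "s \<in> cauchy_seqs K w" "t \<in> cauchy_seqs K w" "(\<lambda>n. s n - t n) \<in> null_seqs K w"
  shows "residue_class s = residue_class t"
proof -
  interpret E: cring "completion K w" by (rule completion_cring)
  have "residue_class t = residue_class (\<lambda>n. s n - t n) \<oplus>\<^bsub>completion K w\<^esub> residue_class t"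
    using assms residue_class_zero_iff[OF null_seqs_cauchy[OF assms(3)]]
    by (auto simp: carrier_completion)
  also have "\<dots> = residue_class s"
    using residue_class_add[OF null_seqs_cauchy[OF assms(3)] assms(2)] by simp
  finally show ?thesis by simp
qed

lemma base_subset: "base_field \<subseteq> K"
  by auto

lemma base_cauchy: "s \<in> cauchy_seqs base_field w \<Longrightarrow> s \<in> cauchy_seqs K w"
  using base_subset by (auto simp: cauchy_seqs_def)

lemma residue_class_inverse:
  assumes F: "F \<subseteq> K" "0 \<in> F" "\<And>x. x \<in> F \<Longrightarrow> inverse x \<in> F"
    and s: "s \<in> cauchy_seqs F w" "cauchy_seqs F w \<subseteq> cauchy_seqs K w"
      "residue_class s \<noteq> \<zero>\<^bsub>completion K w\<^esub>"
  obtains t where "t \<in> cauchy_seqs F w"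
    "residue_class s \<otimes>\<^bsub>completion K w\<^esub> residue_class t = \<one>\<^bsub>completion K w\<^esub>"
proof -
  have "s \<notin> null_seqs K w" using s residue_class_zero_iff by blast
  then obtain t where t: "t \<in> cauchy_seqs F w" "(\<lambda>n. s n * t n - 1) \<in> null_seqs K w"
    using cauchy_seqs_inverse[OF F s(1)] by blast
  have "residue_class (\<lambda>n. s n * t n) = residue_class (\<lambda>_. 1)"
    using s t by (intro residue_class_eq cauchy_seqs_mult cauchy_seqs_const) auto
  then show ?thesis
    using that[OF t(1)] residue_class_mult[of s t] s t residue_class_one by auto
qed

lemma completion_field: "field (completion K w)"
proof -
  interpret E: cring "completion K w" by (rule completion_cring)
  show ?thesis
  proof (rule E.cring_fieldI2)
    show "\<zero>\<^bsub>completion K w\<^esub> \<noteq> \<one>\<^bsub>completion K w\<^esub>"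
      using residue_class_zero_iff[OF cauchy_seqs_const[OF order_refl K_1]] one_not_null
      by (auto simp: residue_class_one)
    fix a assume a: "a \<in> carrier (completion K w)" "a \<noteq> \<zero>\<^bsub>completion K w\<^esub>"
    then obtain s where s: "s \<in> cauchy_seqs K w" "a = residue_class s"
      by (auto simp: carrier_completion)
    obtain t where "t \<in> cauchy_seqs K w"
      "residue_class s \<otimes>\<^bsub>completion K w\<^esub> residue_class t = \<one>\<^bsub>completion K w\<^esub>"
      by (rule residue_class_inverse[of K s]) (use s a in auto)
    then show "\<exists>b\<in>carrier (completion K w). a \<otimes>\<^bsub>completion K w\<^esub> b = \<one>\<^bsub>completion K w\<^esub>"
      using s by (auto simp: carrier_completion)
  qed
qed

text \<open>The dimension theory behind \<open>local_degree\<close> applies over a subfield, so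
  closure under inverses has to be checked for the classes of sequences from \<open>k\<close>
  too.\<close>

lemma completion_base_subfield: "subfield (completion_base K w) (completion K w)"
proof -
  interpret E: field "completion K w" by (rule completion_field)
  interpret R: cring "cauchy_ring K w" by (rule cauchy_cring)
  have base: "add_subgroup base_field"
    unfolding add_subgroup_def
    by (auto simp flip: to_ac_diff intro: image_eqI[of _ _ 0])
  have "subring (cauchy_seqs base_field w) (cauchy_ring K w)"
  proof (rule R.subringI)
    show "cauchy_seqs base_field w \<subseteq> carrier (cauchy_ring K w)"
      using base_cauchy by (auto simp: cauchy_ring_def)
    show "\<one>\<^bsub>cauchy_ring K w\<^esub> \<in> cauchy_seqs base_field w"
      using cauchy_seqs_const[OF base_subset, of 1] by (auto simp: cauchy_ring_def intro: image_eqI[of _ _ 1])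
    fix s assume s: "s \<in> cauchy_seqs base_field w"
    have "(\<lambda>_. 0) \<in> cauchy_seqs base_field w"
      by (rule cauchy_seqs_const[OF base_subset add_subgroup_0[OF base]])
    from cauchy_seqs_diff[OF base_subset base this s]
    have m: "(\<lambda>n. - s n) \<in> cauchy_seqs base_field w" by simp
    moreover have "\<ominus>\<^bsub>cauchy_ring K w\<^esub> s = (\<lambda>n. - s n)"
      using base_cauchy[OF m] base_cauchy[OF s]
      by (intro R.minus_equality) (auto simp: cauchy_ring_def)
    ultimately show "\<ominus>\<^bsub>cauchy_ring K w\<^esub> s \<in> cauchy_seqs base_field w" by simp
    fix t assume t: "t \<in> cauchy_seqs base_field w"
    show "s \<oplus>\<^bsub>cauchy_ring K w\<^esub> t \<in> cauchy_seqs base_field w"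
      using cauchy_seqs_add[OF base_subset base s t] by (simp add: cauchy_ring_def)
    have "x * y \<in> base_field" if "x \<in> base_field" "y \<in> base_field" for x y :: "'a kbar"
      using that by (auto simp flip: to_ac_mult)
    from cauchy_seqs_mult[OF base_subset this s t]
    show "s \<otimes>\<^bsub>cauchy_ring K w\<^esub> t \<in> cauchy_seqs base_field w" by (simp add: cauchy_ring_def)
  qed
  then have sr: "subring (completion_base K w) (completion K w)"
    unfolding completion_base_def by (rule ring_hom_ring.img_is_subring[OF completion_hom])
  show ?thesis
  proof (rule E.subfieldI'[OF sr])
    fix k assume k: "k \<in> completion_base K w - {\<zero>\<^bsub>completion K w\<^esub>}"
    then obtain s where s: "s \<in> cauchy_seqs base_field w" "k = residue_class s"
      unfolding completion_base_def by blast
    have inv: "inverse x \<in> base_field" if "x \<in> base_field" for x :: "'a kbar"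
      using that by (auto simp flip: to_ac_inverse)
    obtain t where t: "t \<in> cauchy_seqs base_field w"
      "residue_class s \<otimes>\<^bsub>completion K w\<^esub> residue_class t = \<one>\<^bsub>completion K w\<^esub>"
      by (rule residue_class_inverse[OF base_subset add_subgroup_0[OF base] inv s(1)])
         (use k s base_cauchy in auto)
    have "inv\<^bsub>completion K w\<^esub> k = residue_class t"
      using t s base_cauchy by (intro E.comm_inv_char) (auto simp: carrier_completion)
    then show "inv\<^bsub>completion K w\<^esub> k \<in> completion_base K w"
      using t by (auto simp: completion_base_def)
  qed
qed

lemma combine_residue_class:
  assumes "\<And>i. i \<in> set l \<Longrightarrow> c i \<in> cauchy_seqs K w" "\<And>i. i \<in> set l \<Longrightarrow> y i \<in> K"
  shows "ring.combine (completion K w) (map (\<lambda>i. residue_class (c i)) l)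
     (map (\<lambda>i. residue_class (\<lambda>_. y i)) l) = residue_class (\<lambda>n. \<Sum>i\<leftarrow>l. c i n * y i) \<and>
     (\<lambda>n. \<Sum>i\<leftarrow>l. c i n * y i) \<in> cauchy_seqs K w"
  using assms
proof (induction l)
  case Nil
  interpret E: field "completion K w" by (rule completion_field)
  show ?case
    using residue_class_zero_iff[of "\<lambda>_. 0"] null_seqs_0 cauchy_seqs_const[of K 0] by simp
next
  case (Cons a l)
  interpret E: field "completion K w" by (rule completion_field)
  have 1: "c a \<in> cauchy_seqs K w" "(\<lambda>_. y a) \<in> cauchy_seqs K w"
    using Cons.prems by (auto intro: cauchy_seqs_const)
  have 2: "(\<lambda>n. c a n * y a) \<in> cauchy_seqs K w"
    using 1 by (intro cauchy_seqs_mult[of K "c a" "\<lambda>_. y a"]) auto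
  have IH: "E.combine (map (\<lambda>i. residue_class (c i)) l) (map (\<lambda>i. residue_class (\<lambda>_. y i)) l) =
      residue_class (\<lambda>n. \<Sum>i\<leftarrow>l. c i n * y i)" "(\<lambda>n. \<Sum>i\<leftarrow>l. c i n * y i) \<in> cauchy_seqs K w"
    using Cons.IH Cons.prems by auto
  show ?case
    using residue_class_mult[OF 1] residue_class_add[OF 2 IH(2)] IH(1)
      cauchy_seqs_add[OF order_refl K_subgroup 2 IH(2)] by simp
qed

end

text \<open>Here \<open>\<pi>\<close> is a uniformizer of the place of \<open>k\<close> below
  \<open>w\<close>, not of \<open>w\<close>. In the normalization by degrees its value
  \<open>\<delta>\<close> is the degree of that place (1 at infinity), so \<open>residues\<close>
  bounds the residue field of \<open>k\<close> by q to the power \<open>\<delta>\<close>. The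
  finiteness of K over \<open>k\<close> enters as \<open>dependent\<close>.\<close>

locale uniformized_place = valued_field K w
  for K :: "'a::{field,finite} kbar set" and w :: "'a kbar \<Rightarrow> real" +
  fixes \<pi> :: "'a poly fract" and \<delta> n :: nat
  assumes pi: "\<pi> \<noteq> 0" "w (to_ac \<pi>) = real \<delta>" and \<delta>_pos: "\<delta> > 0"
    and multiples: "\<And>c. c \<noteq> 0 \<Longrightarrow> \<exists>a::int. w (to_ac c) = real \<delta> * of_int a"
    and residues: "index_le (to_ac ` {c. to_ac c \<in> val_ge K w 0}) (to_ac ` {c. to_ac c \<in> val_ge K w (real \<delta>)})
       (real (CARD('a) ^ \<delta>))"
    and dependent: "\<And>r (y :: nat \<Rightarrow> 'a kbar). (\<And>i. i < r \<Longrightarrow> y i \<in> K) \<Longrightarrow> n < r \<Longrightarrow>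
       \<exists>c. (\<exists>i<r. c i \<noteq> 0) \<and> (\<Sum>i<r. to_ac (c i) * y i) = 0"
begin

lemma w_pi_power: "w (to_ac \<pi> ^ k) = real \<delta> * real k"
  using w_power[of "to_ac \<pi>" k] pi by (simp add: mult.commute)

text \<open>Independence over the residue field of \<open>k\<close> of the classes of the
  \<open>y i\<close> in the valuation ring of \<open>w\<close> modulo \<open>\<pi>\<close>;
  \<open>val_ge K w \<delta>\<close> is the ideal generated by \<open>\<pi>\<close>.\<close>

definition residue_indep :: "nat \<Rightarrow> (nat \<Rightarrow> 'a kbar) \<Rightarrow> bool" where
  "residue_indep r y \<longleftrightarrow> (\<forall>i<r. y i \<in> val_ge K w 0) \<and>
     (\<forall>c. (\<forall>i<r. to_ac (c i) \<in> val_ge K w 0) \<longrightarrow>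
        (\<Sum>i<r. to_ac (c i) * y i) \<in> val_ge K w \<delta> \<longrightarrow> (\<forall>i<r. to_ac (c i) \<in> val_ge K w \<delta>))"

lemma residue_indepD:
  assumes "residue_indep r y" "\<And>i. i < r \<Longrightarrow> to_ac (c i) \<in> val_ge K w 0"
    "(\<Sum>i<r. to_ac (c i) * y i) \<in> val_ge K w \<delta>" "i < r"
  shows "to_ac (c i) \<in> val_ge K w \<delta>"
  using assms by (simp add: residue_indep_def)

text \<open>Divide by a coefficient of least value: it becomes 1, so the sum cannot lie in the ideal
  of the uniformizer. The loss \<open>\<delta>\<close> does not depend on \<open>B\<close>, and
  therefore smallness of sums passes to the coefficients in limits.\<close>

lemma residue_indep_scale:
  assumes y: "residue_indep r y" and B: "(\<Sum>i<r. to_ac (c i) * y i) \<in> val_ge K w B" and i: "i < r"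
  shows "to_ac (c i) \<in> val_ge K w (B - \<delta>)"
proof (cases "\<exists>i<r. c i \<noteq> 0")
  case False
  then show ?thesis using i by (auto simp: val_ge_def)
next
  case True
  define I where "I = {i. i < r \<and> c i \<noteq> 0}"
  have I: "finite I" "I \<noteq> {}" using True by (auto simp: I_def)
  then obtain j where j: "j \<in> I" "\<And>i. i \<in> I \<Longrightarrow> w (to_ac (c j)) \<le> w (to_ac (c i))"
    using finite_imp_Sup_less arg_min_if_finite[of I "\<lambda>i. w (to_ac (c i))"] by (meson not_le)
  let ?v = "w (to_ac (c j))"
  have cj: "j < r" "c j \<noteq> 0" using j(1) by (auto simp: I_def)
  have ge: "to_ac (c i) \<in> val_ge K w ?v" if "i < r" for i
    using j(2)[of i] that by (auto simp: I_def val_ge_def)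
  have "B - \<delta> \<le> ?v"
  proof (rule ccontr)
    assume *: "\<not> B - \<delta> \<le> ?v"
    have inv: "inverse (to_ac (c j)) \<in> val_ge K w (- ?v)"
      using cj by (simp add: val_ge_def w_inverse K_inverse)
    have "to_ac (c i / c j) \<in> val_ge K w 0" if "i < r" for i
      using val_ge_mult[OF ge[OF that] inv] by (simp add: divide_inverse)
    moreover have "(\<Sum>i<r. to_ac (c i / c j) * y i) \<in> val_ge K w \<delta>"
    proof -
      have "(\<Sum>i<r. to_ac (c i / c j) * y i) = (\<Sum>i<r. to_ac (c i) * y i) * inverse (to_ac (c j))"
        unfolding sum_distrib_right by (rule sum.cong) (simp_all add: divide_inverse)
      then show ?thesis using val_ge_mono[OF val_ge_mult[OF B inv], of \<delta>] * by simp
    qed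
    ultimately have "to_ac (c j / c j) \<in> val_ge K w \<delta>"
      by (rule residue_indepD[OF y _ _ cj(1), of "\<lambda>i. c i / c j"])
    then show False using cj \<delta>_pos by (simp add: val_ge_def)
  qed
  then show ?thesis using val_ge_mono[OF ge[OF i]] by simp
qed

lemma exists_residue_basis:
  obtains r :: nat and y where "residue_indep r y"
    "\<And>u. u \<in> val_ge K w 0 \<Longrightarrow> \<exists>c. (\<forall>i<r. to_ac (c i) \<in> val_ge K w 0) \<and>
       u - (\<Sum>i<r. to_ac (c i) * y i) \<in> val_ge K w \<delta>"
proof -
  let ?C = "to_ac ` {c. to_ac c \<in> val_ge K w 0}" and ?P = "to_ac ` {c. to_ac c \<in> val_ge K w (real \<delta>)}"
  have lift: "\<exists>d. \<forall>i<r. c i = to_ac (d i) \<and> to_ac (d i) \<in> val_ge K w 0" if "\<forall>i<r. c i \<in> ?C" for r :: nat and c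
    using that by (intro exI[of _ "\<lambda>i. of_ac (c i)"]) force
  obtain r :: nat and y where "\<And>i. i < r \<Longrightarrow> y i \<in> val_ge K w 0"
    and 1: "\<And>c. (\<forall>i<r. c i \<in> ?C) \<Longrightarrow> (\<Sum>i<r. c i * y i) \<in> val_ge K w \<delta> \<Longrightarrow> (\<forall>i<r. c i \<in> ?P)"
    and 2: "\<And>u. u \<in> val_ge K w 0 \<Longrightarrow> \<exists>c. (\<forall>i<r. c i \<in> ?C) \<and> u - (\<Sum>i<r. c i * y i) \<in> val_ge K w \<delta>"
  proof (rule residue_basis[of ?C "val_ge K w \<delta>" ?P "val_ge K w 0" n])
    show "c * c' \<in> ?C" if cc: "c \<in> ?C" "c' \<in> ?C" for c c'
    proof -
      obtain a b where "c = to_ac a" "c' = to_ac b" "to_ac a \<in> val_ge K w 0" "to_ac b \<in> val_ge K w 0"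
        using cc by blast
      then show ?thesis using val_ge_mult[of "to_ac a" 0 "to_ac b" 0]
        by (intro image_eqI[of _ _ "a * b"]) auto
    qed
    show "- c \<in> ?C" if cc: "c \<in> ?C" for c
    proof -
      obtain a where "c = to_ac a" "to_ac a \<in> val_ge K w 0"
        using cc by blast
      then show ?thesis using val_ge_uminus[of "to_ac a" 0]
        by (intro image_eqI[of _ _ "- a"]) auto
    qed
    show "add_subgroup (val_ge K w \<delta>)" by (rule val_ge_subgroup)
    show "c * v \<in> val_ge K w \<delta>" if "c \<in> ?C" "v \<in> val_ge K w \<delta>" for c v
      using that val_ge_mult[of c 0 v \<delta>] by auto
    show "p * u \<in> val_ge K w \<delta>" if "p \<in> ?P" "u \<in> val_ge K w 0" for p u
      using that val_ge_mult[of p \<delta> u 0] by auto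
    \<comment> \<open>Values on \<open>k\<close> are multiples of \<open>\<delta>\<close>, so an
      integral element outside the ideal has value 0 and its inverse in \<open>k\<close> is
      integral.\<close>
    show "\<exists>c'\<in>?C. c' * c - 1 \<in> ?P" if c: "c \<in> ?C" "c \<notin> ?P" for c
    proof -
      obtain a where a: "c = to_ac a" "to_ac a \<in> val_ge K w 0" "to_ac a \<notin> val_ge K w \<delta>"
        using c by blast
      then have a0: "a \<noteq> 0" by (auto simp: val_ge_def)
      obtain k :: int where k: "w (to_ac a) = real \<delta> * real_of_int k" using multiples[OF a0] by blast
      have "0 \<le> real_of_int k" "real_of_int k < 1"
        using a a0 k \<delta>_pos by (auto simp: val_ge_def zero_le_mult_iff)
      then have "w (to_ac a) = 0" using k by auto
      then have "to_ac (inverse a) \<in> val_ge K w 0" using a0 w_inverse[of "to_ac a"] by (simp add: val_ge_def K_inverse)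
      moreover have "to_ac (inverse a) * c - 1 = to_ac 0" using a a0 by simp
      moreover have "to_ac 0 \<in> ?P" by (rule imageI) (simp add: val_ge_0)
      ultimately show ?thesis by (metis (no_types, lifting) imageI mem_Collect_eq)
    qed
    fix r and y :: "nat \<Rightarrow> 'a kbar"
    assume y: "\<And>i. i < r \<Longrightarrow> y i \<in> val_ge K w 0"
      and ind: "\<And>c. (\<forall>i<r. c i \<in> ?C) \<Longrightarrow> (\<Sum>i<r. c i * y i) \<in> val_ge K w \<delta> \<Longrightarrow> (\<forall>i<r. c i \<in> ?P)"
    have indep: "residue_indep r y"
      unfolding residue_indep_def
    proof (intro conjI allI impI)
      fix c i assume "\<forall>i<r. to_ac (c i) \<in> val_ge K w 0" "(\<Sum>i<r. to_ac (c i) * y i) \<in> val_ge K w \<delta>" "i < r"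
      then have "to_ac (c i) \<in> ?P" using ind[of "\<lambda>i. to_ac (c i)"] by auto
      then show "to_ac (c i) \<in> val_ge K w \<delta>" by auto
    qed (rule y)
    show "r \<le> n"
    proof (rule ccontr)
      assume "\<not> r \<le> n"
      then obtain c i where c: "i < r" "c i \<noteq> 0" "(\<Sum>i<r. to_ac (c i) * y i) = 0"
        using dependent[of r y] y val_ge_K by (metis not_le)
      \<comment> \<open>A vanishing sum lies in \<open>val_ge K w B\<close> for every
        \<open>B\<close>. The \<open>B\<close> taken here exceeds the value of \<open>c i\<close> by
        \<open>\<delta> + 1\<close>, one more than the loss in the estimate.\<close>
      have "to_ac (c i) \<in> val_ge K w ((w (to_ac (c i)) + 1 + \<delta>) - \<delta>)"
        by (rule residue_indep_scale[OF indep _ c(1)]) (simp add: c(3) val_ge_0)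
      then show False using c(2) by (simp add: val_ge_def)
    qed
  next
    fix r :: nat and y assume a: "\<And>i. i < r \<Longrightarrow> y i \<in> val_ge K w 0"
      and b: "\<And>c. (\<forall>i<r. c i \<in> ?C) \<Longrightarrow> (\<Sum>i<r. c i * y i) \<in> val_ge K w \<delta> \<Longrightarrow> (\<forall>i<r. c i \<in> ?P)"
      and u: "\<And>u. u \<in> val_ge K w 0 \<Longrightarrow> \<exists>c. (\<forall>i<r. c i \<in> ?C) \<and> u - (\<Sum>i<r. c i * y i) \<in> val_ge K w \<delta>"
    show thesis by (rule that[of r y]; (rule a b u; assumption))
  qed
  moreover have "residue_indep r y"
    unfolding residue_indep_def
  proof (intro conjI allI impI)
    fix c i assume "\<forall>i<r. to_ac (c i) \<in> val_ge K w 0" "(\<Sum>i<r. to_ac (c i) * y i) \<in> val_ge K w \<delta>" "i < r"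
    then have "to_ac (c i) \<in> ?P" using 1[of "\<lambda>i. to_ac (c i)"] by auto
    then show "to_ac (c i) \<in> val_ge K w \<delta>" by auto
  qed fact
  moreover have "\<exists>c. (\<forall>i<r. to_ac (c i) \<in> val_ge K w 0) \<and>
       u - (\<Sum>i<r. to_ac (c i) * y i) \<in> val_ge K w \<delta>" if u: "u \<in> val_ge K w 0" for u
  proof -
    obtain c where c: "\<forall>i<r. c i \<in> ?C" "u - (\<Sum>i<r. c i * y i) \<in> val_ge K w \<delta>" using 2[OF u] by blast
    obtain d where d: "\<forall>i<r. c i = to_ac (d i) \<and> to_ac (d i) \<in> val_ge K w 0" using lift[OF c(1)] by blast
    then have "(\<Sum>i<r. c i * y i) = (\<Sum>i<r. to_ac (d i) * y i)" by simp
    then show ?thesis using c d by auto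
  qed
  ultimately show ?thesis using that by blast
qed

text \<open>As in a power series expansion, each use of \<open>span\<close> gains one factor
  \<open>\<pi>\<close>. An arbitrary \<open>z\<close> is first made integral by
  \<open>\<pi> ^ M\<close>; undoing this lowers the precision by \<open>\<delta> * M\<close>, which
  the choice of \<open>N\<close> anticipates.\<close>

lemma approximation:
  assumes y: "residue_indep r y"
    and span: "\<And>u. u \<in> val_ge K w 0 \<Longrightarrow> \<exists>c. (\<forall>i<r. to_ac (c i) \<in> val_ge K w 0) \<and>
       u - (\<Sum>i<r. to_ac (c i) * y i) \<in> val_ge K w \<delta>"
    and z: "z \<in> K"
  shows "\<exists>c. z - (\<Sum>i<r. to_ac (c i) * y i) \<in> val_ge K w B"
proof -
  have unit: "\<exists>c. u - (\<Sum>i<r. to_ac (c i) * y i) \<in> val_ge K w (\<delta> * real N)" if u: "u \<in> val_ge K w 0" for u N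
  proof (induction N)
    case 0
    then show ?case using u by (intro exI[of _ "\<lambda>_. 0"]) simp
  next
    case (Suc N)
    then obtain c where c: "u - (\<Sum>i<r. to_ac (c i) * y i) \<in> val_ge K w (0 + w (to_ac \<pi> ^ N))"
      by (auto simp: w_pi_power)
    then obtain u' where u': "u' \<in> val_ge K w 0" "u - (\<Sum>i<r. to_ac (c i) * y i) = to_ac \<pi> ^ N * u'"
      using val_ge_eq_mult[of "to_ac \<pi> ^ N" 0] pi by auto
    then obtain c' where c': "u' - (\<Sum>i<r. to_ac (c' i) * y i) \<in> val_ge K w \<delta>" using span by blast
    have "to_ac \<pi> ^ N * (u' - (\<Sum>i<r. to_ac (c' i) * y i)) \<in> val_ge K w (\<delta> * real N + \<delta>)"
      using val_ge_mult[OF val_ge_w c', of "to_ac \<pi> ^ N"] by (simp add: w_pi_power)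
    moreover have "to_ac \<pi> ^ N * (u' - (\<Sum>i<r. to_ac (c' i) * y i)) =
        u - (\<Sum>i<r. to_ac (c i + \<pi> ^ N * c' i) * y i)"
      using u'(2) by (simp add: algebra_simps sum.distrib sum_distrib_left)
    moreover have "\<delta> * real N + \<delta> = \<delta> * real (Suc N)" by (simp add: algebra_simps)
    ultimately have "u - (\<Sum>i<r. to_ac (c i + \<pi> ^ N * c' i) * y i) \<in> val_ge K w (\<delta> * real (Suc N))"
      by (simp only:)
    then show ?case by (rule exI[of _ "\<lambda>i. c i + \<pi> ^ N * c' i"])
  qed
  obtain M :: nat where M: "- w z \<le> \<delta> * real M"
  proof -
    obtain M :: nat where "- w z \<le> M" using real_arch_simple by blast
    moreover have "real M \<le> \<delta> * real M" using \<delta>_pos by (simp add: mult_le_cancel_right1)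
    ultimately show ?thesis by (intro that[of M]) linarith
  qed
  obtain N :: nat where N: "B + \<delta> * real M \<le> \<delta> * real N"
  proof -
    obtain N :: nat where "B + \<delta> * real M \<le> N" using real_arch_simple by blast
    moreover have "real N \<le> \<delta> * real N" using \<delta>_pos by (simp add: mult_le_cancel_right1)
    ultimately show ?thesis by (intro that[of N]) linarith
  qed
  have "to_ac \<pi> ^ M * z \<in> val_ge K w 0"
    using val_ge_mono[OF val_ge_mult[OF val_ge_w[of "to_ac \<pi> ^ M"] val_ge_w[OF z]], of 0] M
    by (simp add: w_pi_power)
  from unit[OF this, of N] obtain c where
    c: "to_ac \<pi> ^ M * z - (\<Sum>i<r. to_ac (c i) * y i) \<in> val_ge K w (\<delta> * real N)" by blast
  have inv: "inverse (to_ac \<pi> ^ M) \<in> val_ge K w (- (\<delta> * real M))"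
    using pi w_inverse[of "to_ac \<pi> ^ M"] by (simp add: val_ge_def w_pi_power K_inverse)
  have "inverse (to_ac \<pi> ^ M) * (to_ac \<pi> ^ M * z - (\<Sum>i<r. to_ac (c i) * y i)) \<in> val_ge K w B"
    using val_ge_mono[OF val_ge_mult[OF inv c], of B] N by simp
  moreover have "inverse (to_ac \<pi> ^ M) * (to_ac \<pi> ^ M * z - (\<Sum>i<r. to_ac (c i) * y i))
     = z - (\<Sum>i<r. to_ac (inverse (\<pi> ^ M) * c i) * y i)"
    using pi by (simp add: algebra_simps sum_distrib_left)
  ultimately show ?thesis by (intro exI[of _ "\<lambda>i. inverse (\<pi> ^ M) * c i"]) simp
qed

text \<open>A family that is a basis modulo the uniformizer is, by successive approximation, a basis of the
  completion over \<open>k\<^sub>v\<close>; this also shows that \<open>local_degree\<close> is not a junk value.\<close>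

lemma local_degree_eq:
  assumes y: "residue_indep r y"
    and span: "\<And>u. u \<in> val_ge K w 0 \<Longrightarrow> \<exists>c. (\<forall>i<r. to_ac (c i) \<in> val_ge K w 0) \<and>
       u - (\<Sum>i<r. to_ac (c i) * y i) \<in> val_ge K w \<delta>"
  shows "local_degree K w = r"
proof -
  interpret E: field "completion K w" by (rule completion_field)
  let ?Kb = "completion_base K w"
  have sf: "subfield ?Kb (completion K w)" by (rule completion_base_subfield)
  define Us where "Us = map (\<lambda>i. residue_class (\<lambda>_. y i)) [0..<r]"
  have yK: "y i \<in> K" if "i < r" for i using y that val_ge_K by (auto simp: residue_indep_def)
  have len: "length Us = r" by (simp add: Us_def)
  have Us: "set Us \<subseteq> carrier (completion K w)"
    using yK cauchy_seqs_const[OF order_refl] by (auto simp: Us_def carrier_completion)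
  have comb: "E.combine (map (\<lambda>i. residue_class (\<lambda>n. to_ac (c i n))) [0..<r]) Us =
      residue_class (\<lambda>n. \<Sum>i<r. to_ac (c i n) * y i)"
    and comb_cauchy: "(\<lambda>n. \<Sum>i<r. to_ac (c i n) * y i) \<in> cauchy_seqs K w"
    if "\<And>i. i < r \<Longrightarrow> (\<lambda>n. to_ac (c i n)) \<in> cauchy_seqs base_field w" for c
  proof -
    have "(\<Sum>i\<leftarrow>[0..<r]. f i) = (\<Sum>i<r. f i)" for f :: "nat \<Rightarrow> 'a kbar"
      by (simp add: interv_sum_list_conv_sum_set_nat atLeast0LessThan)
    then show "E.combine (map (\<lambda>i. residue_class (\<lambda>n. to_ac (c i n))) [0..<r]) Us =
        residue_class (\<lambda>n. \<Sum>i<r. to_ac (c i n) * y i)"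
      "(\<lambda>n. \<Sum>i<r. to_ac (c i n) * y i) \<in> cauchy_seqs K w"
      using combine_residue_class[of "[0..<r]" "\<lambda>i n. to_ac (c i n)" y] that yK base_cauchy
      by (simp_all add: Us_def)
  qed
  have indep: "E.independent ?Kb Us"
  proof (rule ccontr)
    assume "\<not> E.independent ?Kb Us"
    then obtain Ks where Ks: "length Ks = length Us" "E.combine Ks Us = \<zero>\<^bsub>completion K w\<^esub>"
      "set Ks \<subseteq> ?Kb" "set Ks \<noteq> {\<zero>\<^bsub>completion K w\<^esub>}"
      using E.dependent_imp_non_trivial_combine[OF sf Us] by blast
    have "\<exists>s. (\<lambda>n. to_ac (s n)) \<in> cauchy_seqs base_field w \<and> Ks ! i = residue_class (\<lambda>n. to_ac (s n))"
      if "i < r" for i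
    proof -
      have "Ks ! i \<in> ?Kb" using Ks(1,3) that len nth_mem[of i Ks] by auto
      then obtain s where s: "s \<in> cauchy_seqs base_field w" "Ks ! i = residue_class s"
        unfolding completion_base_def by blast
      have "s = (\<lambda>n. to_ac (of_ac (s n)))"
        using cauchy_range[OF s(1)] by (intro ext) (metis to_ac_of_ac)
      then show ?thesis using s by metis
    qed
    then obtain c where c: "\<And>i. i < r \<Longrightarrow> (\<lambda>n. to_ac (c i n)) \<in> cauchy_seqs base_field w"
      "\<And>i. i < r \<Longrightarrow> Ks ! i = residue_class (\<lambda>n. to_ac (c i n))" by metis
    have "Ks = map (\<lambda>i. residue_class (\<lambda>n. to_ac (c i n))) [0..<r]"
      using Ks(1) len c(2) by (intro nth_equalityI) auto
    then have null: "(\<lambda>n. \<Sum>i<r. to_ac (c i n) * y i) \<in> null_seqs K w"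
      using comb[of c] c(1) Ks(2) residue_class_zero_iff[OF comb_cauchy[of c]] by simp
    \<comment> \<open>If the combination is a null sequence, \<open>residue_indep_scale\<close>
      makes every coefficient sequence null.\<close>
    have "Ks ! i = \<zero>\<^bsub>completion K w\<^esub>" if i: "i < r" for i
    proof -
      have "(\<lambda>n. to_ac (c i n)) \<in> null_seqs K w"
      proof (rule nullI)
        fix B :: real
        obtain M where M: "\<And>n. n \<ge> M \<Longrightarrow> (\<Sum>i<r. to_ac (c i n) * y i) \<in> val_ge K w (B + \<delta>)"
          using nullE[OF null, of "B + \<delta>"] by blast
        have "to_ac (c i n) \<in> val_ge K w B" if "n \<ge> M" for n
          using residue_indep_scale[OF y M[OF that] i] by simp
        then show "\<exists>M. \<forall>n\<ge>M. to_ac (c i n) \<in> val_ge K w B" by blast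
      qed auto
      then show ?thesis using residue_class_zero_iff[OF null_seqs_cauchy] c(2)[OF i] by simp
    qed
    then have "set Ks \<subseteq> {\<zero>\<^bsub>completion K w\<^esub>}" using Ks(1) len by (auto simp: in_set_conv_nth)
    \<comment> \<open>Nontriviality of \<open>Ks\<close> was only stated as \<open>set Ks\<close>
      differing from the singleton of zero, which leaves the empty list; then \<open>Us\<close> is
      empty and independent anyway.\<close>
    then have "set Ks = {}" using Ks(4) by (simp add: subset_singleton_iff)
    then have "Us = []" using Ks(1) by simp
    then show False using \<open>\<not> E.independent ?Kb Us\<close> E.li_Nil by simp
  qed
  have "carrier (completion K w) \<subseteq> E.Span ?Kb Us"
  proof
    fix a assume "a \<in> carrier (completion K w)"
    then obtain s where s: "s \<in> cauchy_seqs K w" "a = residue_class s" by (auto simp: carrier_completion)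
    have "\<forall>n. \<exists>c. s n - (\<Sum>i<r. to_ac (c i) * y i) \<in> val_ge K w (real n)"
      using approximation[OF y span cauchy_range[OF s(1)]] by blast
    then obtain c where c: "\<And>n. s n - (\<Sum>i<r. to_ac (c n i) * y i) \<in> val_ge K w (real n)" by metis
    \<comment> \<open>The approximations converge, so their differences are small, and by
      independence so are the differences of coefficients; each coefficient sequence therefore
      defines an element of the completion of \<open>k\<close>.\<close>
    have base: "(\<lambda>n. to_ac (c n i)) \<in> cauchy_seqs base_field w" if i: "i < r" for i
    proof (rule cauchyI[OF base_subset])
      fix B :: real
      obtain M1 where M1: "\<And>m n. m \<ge> M1 \<Longrightarrow> n \<ge> M1 \<Longrightarrow> s m - s n \<in> val_ge K w (B + \<delta>)"
        using cauchyE[OF order_refl s(1), of "B + \<delta>"] by blast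
      obtain M2 :: nat where M2: "B + \<delta> \<le> M2" using real_arch_simple by blast
      have "to_ac (c m i) - to_ac (c n i) \<in> val_ge K w B" if "m \<ge> max M1 M2" "n \<ge> max M1 M2" for m n
      proof -
        have "(s m - s n) - ((s m - (\<Sum>i<r. to_ac (c m i) * y i)) - (s n - (\<Sum>i<r. to_ac (c n i) * y i)))
            \<in> val_ge K w (B + \<delta>)"
          by (rule val_ge_diff[OF M1 val_ge_diff[OF val_ge_mono[OF c] val_ge_mono[OF c]]])
             (use that M2 in auto)
        moreover have "(s m - s n) - ((s m - (\<Sum>i<r. to_ac (c m i) * y i)) - (s n - (\<Sum>i<r. to_ac (c n i) * y i)))
          = (\<Sum>i<r. to_ac (c m i - c n i) * y i)"
          by (simp add: algebra_simps sum_subtractf)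
        ultimately show ?thesis using residue_indep_scale[OF y _ i, of "\<lambda>i. c m i - c n i" "B + \<delta>"] by simp
      qed
      then show "\<exists>M. \<forall>m\<ge>M. \<forall>n\<ge>M. to_ac (c m i) - to_ac (c n i) \<in> val_ge K w B" by blast
    qed auto
    let ?s = "\<lambda>n. \<Sum>i<r. to_ac (c n i) * y i"
    have "(\<lambda>n. s n - ?s n) \<in> null_seqs K w"
    proof (rule nullI)
      show "s n - ?s n \<in> K" for n using c[of n] by (rule val_ge_K)
      fix B :: real
      obtain M :: nat where M: "B \<le> M" using real_arch_simple by blast
      have "s n - ?s n \<in> val_ge K w B" if "n \<ge> M" for n
        using M that by (intro val_ge_mono[OF c]) simp
      then show "\<exists>M. \<forall>n\<ge>M. s n - ?s n \<in> val_ge K w B" by blast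
    qed
    then have "a = residue_class ?s"
      using s comb_cauchy[of "\<lambda>i n. c n i"] base by (simp add: residue_class_eq)
    also have "\<dots> = E.combine (map (\<lambda>i. residue_class (\<lambda>n. to_ac (c n i))) [0..<r]) Us"
      using comb[of "\<lambda>i n. c n i"] base by simp
    finally show "a \<in> E.Span ?Kb Us"
      unfolding E.Span_mem_iff_length_version[OF sf Us]
      by (intro exI[of _ "map (\<lambda>i. residue_class (\<lambda>n. to_ac (c n i))) [0..<r]"])
         (use base len in \<open>auto simp: completion_base_def\<close>)
  qed
  then have "E.Span ?Kb Us = carrier (completion K w)"
    using E.Span_subgroup_props(1)[OF sf Us] by blast
  then have "E.dimension r ?Kb (carrier (completion K w))"
    using E.dimension_independent[OF indep] len by simp
  then show ?thesis
    using E.dimI[OF sf] by (simp add: local_degree_def over_def)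
qed

text \<open>A basis modulo \<open>\<pi>\<close> has \<open>local_degree K w\<close> members, and
  each coefficient has at most q to the power \<open>\<delta>\<close> residues.\<close>

lemma uniformizer_index:
  "index_le (val_ge K w 0) (val_ge K w \<delta>) (real CARD('a) powr (\<delta> * local_degree K w))"
proof -
  obtain r y where y: "residue_indep r y" and span: "\<And>u. u \<in> val_ge K w 0 \<Longrightarrow>
     \<exists>c. (\<forall>i<r. to_ac (c i) \<in> val_ge K w 0) \<and> u - (\<Sum>i<r. to_ac (c i) * y i) \<in> val_ge K w \<delta>"
    using exists_residue_basis by blast
  let ?C = "to_ac ` {c. to_ac c \<in> val_ge K w 0}" and ?P = "to_ac ` {c. to_ac c \<in> val_ge K w (real \<delta>)}"
  have "index_le (val_ge K w 0) (val_ge K w \<delta>) (real (CARD('a) ^ \<delta>) ^ r)"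
  proof (rule residue_index[OF _ _ _ _ _ residues])
    show "add_subgroup ?C" by (rule val_ge_base_subgroup)
    show "add_subgroup (val_ge K w \<delta>)" by (rule val_ge_subgroup)
    show "p * u \<in> val_ge K w \<delta>" if "p \<in> ?P" "u \<in> val_ge K w 0" for p u
      using that val_ge_mult[of p \<delta> u 0] by auto
    show "y i \<in> val_ge K w 0" if "i < r" for i using y that by (simp add: residue_indep_def)
    show "\<exists>c. (\<forall>i<r. c i \<in> ?C) \<and> u - (\<Sum>i<r. c i * y i) \<in> val_ge K w \<delta>" if u: "u \<in> val_ge K w 0" for u
    proof -
      obtain c where "(\<forall>i<r. to_ac (c i) \<in> val_ge K w 0)" "u - (\<Sum>i<r. to_ac (c i) * y i) \<in> val_ge K w \<delta>"
        using span[OF u] by blast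
      then show ?thesis by (intro exI[of _ "\<lambda>i. to_ac (c i)"]) auto
    qed
  qed
  moreover have "real CARD('a) powr (\<delta> * local_degree K w) = real (CARD('a) ^ \<delta>) ^ r"
    using local_degree_eq[OF y span] powr_realpow[of "real CARD('a)" "\<delta> * r"]
    by (simp add: power_mult)
  ultimately show ?thesis by simp
qed

lemma uniformizer_power_index:
  "index_le (val_ge K w (- (\<delta> * real a))) (val_ge K w 0) (real CARD('a) powr (\<delta> * local_degree K w * a))"
proof (induction a)
  case 0
  then show ?case using index_le_INT[of "{}" "val_ge K w 0" "\<lambda>_. {}" "\<lambda>_. 0"] val_ge_subgroup by simp
next
  case (Suc a)
  let ?p = "inverse (to_ac \<pi> ^ Suc a)"
  have p: "?p \<in> K" "?p \<noteq> 0" "w ?p = - (\<delta> * real (Suc a))"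
    using pi w_inverse[of "to_ac \<pi> ^ Suc a"] w_pi_power[of "Suc a"] by (auto simp del: power_Suc)
  have "index_le ((*) ?p ` val_ge K w 0) ((*) ?p ` val_ge K w \<delta>) (real CARD('a) powr (\<delta> * local_degree K w))"
    by (rule index_le_mult[OF uniformizer_index p(2)])
  then have "index_le (val_ge K w (- (\<delta> * real (Suc a)))) (val_ge K w (- (\<delta> * real a)))
      (real CARD('a) powr (\<delta> * local_degree K w))"
    unfolding val_ge_eq_mult[OF p(1,2), symmetric] p(3) by (simp add: algebra_simps)
  from index_le_trans[OF this Suc.IH val_ge_subgroup]
  show ?case by (simp add: powr_add[symmetric] algebra_simps)
qed

text \<open>Since \<open>e f = local_degree K w\<close> is not available separately, the index is computed through
  a power of \<open>y\<close> whose valuation is a multiple of the one of the uniformizer.\<close>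

lemma element_index:
  assumes y: "y \<in> K" "y \<noteq> 0" "w y < 0" and k: "k > 0" "w y * real k = - (\<delta> * real a)"
  shows "index_le (val_ge K w (w y)) (val_ge K w 0) (real CARD('a) powr (local_degree K w * (- w y)))"
proof (rule index_leI)
  fix S assume S: "finite S" "S \<subseteq> val_ge K w (w y)"
    "\<And>s s'. s \<in> S \<Longrightarrow> s' \<in> S \<Longrightarrow> s - s' \<in> val_ge K w 0 \<Longrightarrow> s = s'"
  \<comment> \<open>Expansions in powers of \<open>y\<close> with \<open>j\<close> digits from
    \<open>S\<close> remain incongruent: the top digit is determined first. For \<open>j = k\<close>
    their number is compared with the index of a power of \<open>\<pi>\<close>, and a
    \<open>k\<close>-th root gives the claim.\<close>
  have powers: "\<exists>S'. finite S' \<and> card S' = card S ^ j \<and> S' \<subseteq> val_ge K w (j * w y) \<and>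
      (\<forall>s\<in>S'. \<forall>s'\<in>S'. s - s' \<in> val_ge K w 0 \<longrightarrow> s = s')" for j
  proof (induction j)
    case 0
    then show ?case by (intro exI[of _ "{0}"]) (auto simp: val_ge_0)
  next
    case (Suc j)
    then obtain S' where S': "finite S'" "card S' = card S ^ j" "S' \<subseteq> val_ge K w (j * w y)"
      "\<And>s s'. s \<in> S' \<Longrightarrow> s' \<in> S' \<Longrightarrow> s - s' \<in> val_ge K w 0 \<Longrightarrow> s = s'" by blast
    let ?f = "\<lambda>(s, s'). y ^ j * s + s'"
    have wy: "y ^ j \<in> val_ge K w (j * w y)" "inverse (y ^ j) \<in> val_ge K w (- (j * w y))"
      using y w_power[of y j] w_inverse[of "y ^ j"] by (auto simp: val_ge_def)
    have key: "p = p'" if p: "p \<in> S \<times> S'" "p' \<in> S \<times> S'" "?f p - ?f p' \<in> val_ge K w 0" for p p'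
    proof -
      obtain s u s' u' where pp: "p = (s, u)" "p' = (s', u')" "s \<in> S" "s' \<in> S" "u \<in> S'" "u' \<in> S'"
        using p by auto
      have d: "(y ^ j * s + u) - (y ^ j * s' + u') \<in> val_ge K w 0" using p pp by simp
      have le: "j * w y \<le> 0" using y(3) by (simp add: mult_le_0_iff)
      have "((y ^ j * s + u) - (y ^ j * s' + u')) - (u - u') \<in> val_ge K w (j * w y)"
        using S'(3) pp by (intro val_ge_diff[OF val_ge_mono[OF d le] val_ge_diff]) auto
      moreover have "((y ^ j * s + u) - (y ^ j * s' + u')) - (u - u') = y ^ j * (s - s')"
        by (simp add: algebra_simps)
      ultimately have "y ^ j * (s - s') \<in> val_ge K w (j * w y)" by simp
      then have "inverse (y ^ j) * (y ^ j * (s - s')) \<in> val_ge K w (- (j * w y) + j * w y)"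
        by (rule val_ge_mult[OF wy(2)])
      moreover have "inverse (y ^ j) * (y ^ j * (s - s')) = s - s'" using y by simp
      ultimately have "s - s' \<in> val_ge K w 0" by simp
      then have "s = s'" using S(3) pp by blast
      then have "u = u'" using d S'(4) pp by simp
      then show ?thesis using \<open>s = s'\<close> pp by simp
    qed
    have inj: "inj_on ?f (S \<times> S')"
      by (rule inj_onI, rule key) (auto simp: val_ge_0)
    show ?case
    proof (intro exI[of _ "?f ` (S \<times> S')"] conjI ballI impI)
      show "card (?f ` (S \<times> S')) = card S ^ Suc j"
        by (simp add: card_image[OF inj] card_cartesian_product S'(2))
      show "?f ` (S \<times> S') \<subseteq> val_ge K w (real (Suc j) * w y)"
      proof clarify
        fix s u assume su: "s \<in> S" "u \<in> S'"
        have "y ^ j * s \<in> val_ge K w (j * w y + w y)" using wy S su by (intro val_ge_mult) auto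
        moreover have "u \<in> val_ge K w (j * w y + w y)" 
          by (rule val_ge_mono[of u "real j * w y"]) (use S'(3) su y(3) in auto)
        ultimately have "y ^ j * s + u \<in> val_ge K w (j * w y + w y)" by (rule val_ge_add)
        then show "y ^ j * s + u \<in> val_ge K w (real (Suc j) * w y)" by (simp add: algebra_simps)
      qed
      fix v v' assume "v \<in> ?f ` (S \<times> S')" "v' \<in> ?f ` (S \<times> S')" "v - v' \<in> val_ge K w 0"
      then show "v = v'" using key by blast
    qed (use S(1) S'(1) in simp)
  qed
  obtain S' where S': "finite S'" "card S' = card S ^ k" "S' \<subseteq> val_ge K w (k * w y)"
    "\<And>s s'. s \<in> S' \<Longrightarrow> s' \<in> S' \<Longrightarrow> s - s' \<in> val_ge K w 0 \<Longrightarrow> s = s'" using powers[of k] by auto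
  have "real (card S) ^ k \<le> real CARD('a) powr (\<delta> * local_degree K w * a)"
    using index_leD[OF uniformizer_power_index[of a] S'(1)] S'(2,3,4) k(2) by (auto simp: mult.commute)
  also have "real (\<delta> * local_degree K w * a) = (local_degree K w * (- w y)) * k"
  proof -
    have "(local_degree K w * (- w y)) * k = local_degree K w * (- (w y * real k))" by simp
    also have "\<dots> = real (\<delta> * local_degree K w * a)" unfolding k(2) by simp
    finally show ?thesis by simp
  qed
  also have "real CARD('a) powr ((local_degree K w * (- w y)) * k) =
      (real CARD('a) powr (local_degree K w * (- w y))) ^ k"
    using powr_powr[of "real CARD('a)" "local_degree K w * (- w y)" "real k"]
    by (simp add: powr_realpow)
  finally show "real (card S) \<le> real CARD('a) powr (local_degree K w * (- w y))"
    using k(1) by (auto simp: power_mono_iff)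
qed

end

section \<open>Places of the rational function field\<close>

lemma card_poly_degree_less: "card {p :: 'a::{field,finite} poly. degree p < Suc n} = CARD('a) ^ Suc n"
  and finite_poly_degree_less: "finite {p :: 'a poly. degree p < Suc n}"
proof -
  let ?L = "{xs :: 'a list. set xs \<subseteq> UNIV \<and> length xs = Suc n}"
  have coeff: "coeff (Poly xs) i = (if i < Suc n then xs ! i else 0)" if "xs \<in> ?L" for xs :: "'a list" and i
    using that by (simp add: nth_default_def)
  have inj: "inj_on Poly ?L"
  proof (rule inj_onI)
    fix xs ys :: "'a list" assume xy: "xs \<in> ?L" "ys \<in> ?L" "Poly xs = Poly ys"
    have "xs ! i = ys ! i" if "i < Suc n" for i
      using coeff[OF xy(1), of i] coeff[OF xy(2), of i] xy(3) that by simp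
    then show "xs = ys" using xy by (intro nth_equalityI) auto
  qed
  have img: "Poly ` ?L = {p :: 'a poly. degree p < Suc n}"
  proof (intro equalityI subsetI)
    fix p assume "p \<in> Poly ` ?L"
    then obtain xs where "xs \<in> ?L" "p = Poly xs" by blast
    then show "p \<in> {p :: 'a poly. degree p < Suc n}"
      using coeff[of xs] by (auto simp: less_Suc_eq_le intro!: degree_le)
  next
    fix p :: "'a poly" assume p: "p \<in> {p. degree p < Suc n}"
    have l: "map (coeff p) [0..<Suc n] \<in> ?L" by simp
    have "p = Poly (map (coeff p) [0..<Suc n])"
    proof (rule poly_eqI)
      fix i show "coeff p i = coeff (Poly (map (coeff p) [0..<Suc n])) i"
        using p coeff[OF l, of i] by (auto simp del: upt_Suc intro: coeff_eq_0)
    qed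
    then show "p \<in> Poly ` ?L" using l by blast
  qed
  have fin: "finite ?L" by (rule finite_lists_length_eq) simp
  show "finite {p :: 'a poly. degree p < Suc n}" using fin unfolding img[symmetric] by simp
  show "card {p :: 'a poly. degree p < Suc n} = CARD('a) ^ Suc n"
    unfolding img[symmetric] card_image[OF inj] by (rule card_lists_length_eq) simp
qed

lemma index_le_representatives:
  assumes R: "finite R" and Y: "add_subgroup Y" and rep: "\<And>x. x \<in> A \<Longrightarrow> \<exists>r\<in>R. x - r \<in> Y"
  shows "index_le A Y (real (card R))"
proof (rule index_leI)
  fix S assume S: "finite S" "S \<subseteq> A" "\<And>s s'. s \<in> S \<Longrightarrow> s' \<in> S \<Longrightarrow> s - s' \<in> Y \<Longrightarrow> s = s'"
  obtain f where f: "\<And>x. x \<in> A \<Longrightarrow> f x \<in> R \<and> x - f x \<in> Y" using rep by metis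
  have "inj_on f S"
  proof (rule inj_onI)
    fix s s' assume s: "s \<in> S" "s' \<in> S" "f s = f s'"
    have "(s - f s) - (s' - f s') \<in> Y"
      using f S(2) s by (intro add_subgroup_diff[OF Y, of "s - f s"]) blast+
    then show "s = s'" using S(3) s by simp
  qed
  then have "card S \<le> card R" using f S(2) R by (intro card_inj_on_le) auto
  then show "real (card S) \<le> real (card R)" by simp
qed

lemma of_A_0 [simp]: "of_A 0 = 0" and of_A_1 [simp]: "of_A 1 = 1"
  by (simp_all add: of_A_def Zero_fract_def[symmetric] One_fract_def[symmetric])

lemma of_A_add [simp]: "of_A (a + b) = of_A a + of_A b"
  and of_A_diff [simp]: "of_A (a - b) = of_A a - of_A b"
  and of_A_uminus [simp]: "of_A (- a) = - of_A a"
  and of_A_mult [simp]: "of_A (a * b) = of_A a * of_A b"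
  by (simp_all add: of_A_def flip: to_ac_add to_ac_diff to_ac_minus to_ac_mult)

lemma of_A_power [simp]: "of_A (a ^ n) = of_A a ^ n"
  by (induction n) simp_all

lemma of_A_sum: "of_A (sum f I) = (\<Sum>i\<in>I. of_A (f i))"
  by (induction I rule: infinite_finite_induct) auto

lemma of_A_eq_iff [simp]: "of_A a = of_A b \<longleftrightarrow> a = b"
  by (simp add: of_A_def eq_fract)

lemma of_A_eq_0_iff [simp]: "of_A a = 0 \<longleftrightarrow> a = 0"
  using of_A_eq_iff[of a 0] by simp

lemma to_ac_Fract: "b \<noteq> 0 \<Longrightarrow> to_ac (Fract a b) = of_A a / of_A b"
  by (simp add: of_A_def divide_fract flip: to_ac_divide)

lemma irreducible_degree_pos: "irreducible (l :: 'a::field poly) \<Longrightarrow> degree l > 0"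
  by (rule ccontr) (auto simp: irreducible_def is_unit_iff_degree)

text \<open>Degrees bound the exponents of powers of \<open>l\<close> dividing \<open>a\<close>, so
  the \<open>Max\<close> in \<open>ord_at\<close> is attained.\<close>

lemma ord_at_decompose:
  fixes a l :: "'a::field poly"
  assumes l: "degree l > 0" and a: "a \<noteq> 0"
  obtains a' where "a = l ^ ord_at l a * a'" "\<not> l dvd a'"
proof -
  have "{n. l ^ n dvd a} \<subseteq> {..degree a}"
  proof clarify
    fix n assume "l ^ n dvd a"
    moreover have "l \<noteq> 0" using l by auto
    ultimately have "n * degree l \<le> degree a"
      using dvd_imp_degree_le[of "l ^ n" a] a by (simp add: degree_power_eq)
    moreover have "n \<le> n * degree l" using l by simp
    ultimately show "n \<le> degree a" by linarith
  qed
  then have fin: "finite {n. l ^ n dvd a}" using finite_subset by blast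
  have "0 \<in> {n. l ^ n dvd a}" by simp
  then have "ord_at l a \<in> {n. l ^ n dvd a}" unfolding ord_at_def using fin Max_in by blast
  then obtain a' where a': "a = l ^ ord_at l a * a'" by (auto elim: dvdE)
  have "\<not> l dvd a'"
  proof
    assume "l dvd a'"
    then have "l ^ ord_at l a * l dvd l ^ ord_at l a * a'" by (rule mult_dvd_mono[OF dvd_refl])
    then have "l ^ Suc (ord_at l a) dvd a" using a' by (metis power_Suc2)
    then have "Suc (ord_at l a) \<le> ord_at l a" unfolding ord_at_def[of l a] using fin by (intro Max_ge) auto
    then show False by simp
  qed
  with a' show ?thesis using that by blast
qed

lemma ord_at_eq_0: "\<not> l dvd a \<Longrightarrow> ord_at l a = 0"
proof -
  assume "\<not> l dvd a"
  then have "{n. l ^ n dvd a} = {0}"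
    by (auto simp: power_0) (metis dvd_power dvd_trans not_gr_zero)
  then show ?thesis by (simp add: ord_at_def)
qed

text \<open>Multiplication by \<open>a\<close> is injective on the finitely many remainders modulo
  \<open>l\<close>, because \<open>l\<close> is prime; so it is surjective and reaches 1.\<close>

lemma inverse_mod_irreducible:
  fixes l a :: "'a::{field,finite} poly"
  assumes l: "irreducible l" and a: "\<not> l dvd a"
  obtains u z where "u * a = 1 + l * z"
proof -
  have prime: "prime_elem l" by (rule field_poly_irreducible_imp_prime[OF l])
  obtain n where n: "degree l = Suc n" using irreducible_degree_pos[OF l] gr0_implies_Suc by blast
  let ?D = "{p :: 'a poly. degree p < Suc n}"
  have mod_D: "p mod l \<in> ?D" for p :: "'a poly"
    using degree_mod_less[of l p] n l by (auto simp: irreducible_def)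
  have "inj_on (\<lambda>p. (a * p) mod l) ?D"
  proof (rule inj_onI)
    fix p p' assume p: "p \<in> ?D" "p' \<in> ?D" "(a * p) mod l = (a * p') mod l"
    then have "l dvd a * (p - p')" by (simp add: mod_eq_dvd_iff right_diff_distrib)
    then have dvd: "l dvd p - p'" using prime a prime_elem_dvd_multD by blast
    have "degree (p - p') < Suc n" using p by (intro le_less_trans[OF degree_diff_le_max]) auto
    then show "p = p'" using dvd_imp_degree_le[OF dvd] n by (cases "p - p' = 0") auto
  qed
  moreover have "(\<lambda>p. (a * p) mod l) ` ?D \<subseteq> ?D" using mod_D by blast
  ultimately have "(\<lambda>p. (a * p) mod l) ` ?D = ?D"
    using finite_poly_degree_less by (intro endo_inj_surj) auto
  then have "1 mod l \<in> (\<lambda>p. (a * p) mod l) ` ?D" using mod_D by blast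
  then obtain p where "(a * p) mod l = 1 mod l" by auto
  then have "l dvd a * p - 1" by (simp add: mod_eq_dvd_iff)
  then obtain z where "a * p - 1 = l * z" by (rule dvdE)
  then show ?thesis using that[of p z] by (simp add: algebra_simps)
qed

section \<open>Places of K and the uniformizers of the places below them\<close>

lemma (in valued_field) K_of_A [simp, intro]: "of_A a \<in> K"
  by (simp add: of_A_def)

lemma places_valued_field: "intermediate_field K \<Longrightarrow> w \<in> places K \<Longrightarrow> valued_field K w"
  by (simp add: places_def valued_field_def)

lemma places_formula:
  assumes "w \<in> places K"
  shows "(\<forall>a b. a \<noteq> 0 \<longrightarrow> b \<noteq> 0 \<longrightarrow> w (to_ac (Fract a b)) = real (degree b) - real (degree a)) \<or>
      (\<exists>l. lead_coeff l = 1 \<and> irreducible l \<and> (\<forall>a b. a \<noteq> 0 \<longrightarrow> b \<noteq> 0 \<longrightarrow>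
         w (to_ac (Fract a b)) = real (degree l) * (real (ord_at l a) - real (ord_at l b))))"
proof -
  obtain v where v: "v \<in> base_places" "\<And>y. w (to_ac y) = v y"
    using assms by (auto simp: places_def)
  then show ?thesis unfolding base_places_def v(2) by blast
qed

text \<open>Consequently the sign of the value of T tells the places above infinity from the others;
  the later sections use this test in place of the restriction to \<open>k\<close>.\<close>

lemma places_cases:
  assumes "w \<in> places K"
  shows "(\<forall>p. p \<noteq> 0 \<longrightarrow> w (of_A p) = - real (degree p)) \<or> (\<forall>p. p \<noteq> 0 \<longrightarrow> 0 \<le> w (of_A p))"
  using places_formula[OF assms]
proof (elim disjE exE conjE)
  assume "\<forall>a b. a \<noteq> 0 \<longrightarrow> b \<noteq> 0 \<longrightarrow> w (to_ac (Fract a b)) = real (degree b) - real (degree a)"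
  then show ?thesis by (simp add: of_A_def)
next
  fix l :: "'a poly"
  assume l: "irreducible l" and f: "\<forall>a b. a \<noteq> 0 \<longrightarrow> b \<noteq> 0 \<longrightarrow>
       w (to_ac (Fract a b)) = real (degree l) * (real (ord_at l a) - real (ord_at l b))"
  have "ord_at l 1 = 0" using l by (intro ord_at_eq_0) (auto simp: irreducible_def)
  then show ?thesis using f by (simp add: of_A_def)
qed

lemma places_const:
  assumes "w \<in> places K" "c \<noteq> 0"
  shows "w (of_A [:c:]) = 0"
  using places_formula[OF assms(1)]
proof (elim disjE exE conjE)
  fix l :: "'a poly"
  assume l: "irreducible l" and f: "\<forall>a b. a \<noteq> 0 \<longrightarrow> b \<noteq> 0 \<longrightarrow>
       w (to_ac (Fract a b)) = real (degree l) * (real (ord_at l a) - real (ord_at l b))"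
  have "\<not> l dvd [:c:]" using assms(2) irreducible_degree_pos[OF l] dvd_imp_degree_le[of l "[:c:]"] by auto
  moreover have "\<not> l dvd 1" using l by (auto simp: irreducible_def)
  ultimately show "w (of_A [:c:]) = 0" using f assms(2) by (simp add: of_A_def ord_at_eq_0)
qed (use assms(2) in \<open>simp add: of_A_def\<close>)

text \<open>The uniformizer is 1/T. A fraction of value 0 is congruent to the quotient of its
  leading coefficients, so the constants represent all residues.\<close>

lemma infinite_place_uniformized:
  fixes K :: "'a::{field,finite} kbar set"
  assumes vf: "valued_field K w"
    and formula: "\<And>a b. a \<noteq> 0 \<Longrightarrow> b \<noteq> 0 \<Longrightarrow> w (to_ac (Fract a b)) = real (degree b) - real (degree a)"
    and dep: "\<And>r (y :: nat \<Rightarrow> 'a kbar). (\<And>i. i < r \<Longrightarrow> y i \<in> K) \<Longrightarrow> n < r \<Longrightarrow>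
       \<exists>c. (\<exists>i<r. c i \<noteq> 0) \<and> (\<Sum>i<r. to_ac (c i) * y i) = 0"
  shows "uniformized_place K w (Fract 1 [:0, 1:]) 1 n"
proof -
  interpret valued_field K w by (rule vf)
  show ?thesis
  proof unfold_locales
    show "Fract 1 [:0, 1:] \<noteq> (0 :: 'a poly fract)" by (simp add: Zero_fract_def eq_fract)
    show "w (to_ac (Fract 1 [:0, 1:])) = real 1" using formula[of 1 "[:0, 1:]"] by simp
    show "\<exists>a::int. w (to_ac c) = real 1 * real_of_int a" if c: "c \<noteq> 0" for c
    proof -
      obtain a b where ab: "c = Fract a b" "b \<noteq> 0" by (cases c)
      then have "a \<noteq> 0" using c by (auto simp: fract_collapse)
      then have "w (to_ac c) = real 1 * real_of_int (int (degree b) - int (degree a))"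
        using ab formula by simp
      then show ?thesis ..
    qed
    let ?R = "of_A ` {p :: 'a poly. degree p < Suc 0}"
    let ?P = "to_ac ` {c. to_ac c \<in> val_ge K w (real 1)}"
    have sg: "add_subgroup ?P" by (rule val_ge_base_subgroup)
    have "index_le (to_ac ` {c. to_ac c \<in> val_ge K w 0}) ?P (card ?R)"
    proof (rule index_le_representatives[OF _ sg])
      show "finite ?R" using finite_poly_degree_less by blast
      fix x assume "x \<in> to_ac ` {c. to_ac c \<in> val_ge K w 0}"
      then obtain c where c: "x = to_ac c" "to_ac c \<in> val_ge K w 0" by blast
      obtain a b where ab: "c = Fract a b" "b \<noteq> 0" by (cases c)
      show "\<exists>r\<in>?R. x - r \<in> ?P"
      proof (cases "a = 0 \<or> degree a < degree b")
        case True
        then have "to_ac (Fract a b) \<in> val_ge K w 1"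
          using ab formula[of a b] by (cases "a = 0") (auto simp: fract_collapse val_ge_def)
        then have "x \<in> ?P" using c ab by auto
        then show ?thesis by (intro bexI[of _ "of_A 0"]) auto
      next
        case False
        then have deg: "degree a = degree b"
          using c ab formula[of a b] by (auto simp: val_ge_def Zero_fract_def eq_fract)
        define k where "k = lead_coeff a / lead_coeff b"
        have eq: "x - of_A [:k:] = to_ac (Fract (a - [:k:] * b) b)"
        proof -
          have "of_A (a - [:k:] * b) = of_A a - of_A [:k:] * of_A b" by (simp only: of_A_diff of_A_mult)
          then show ?thesis
            unfolding c(1) ab(1) to_ac_Fract[OF ab(2)] using ab(2) by (simp add: diff_divide_distrib)
        qed
        have k: "k * lead_coeff b = lead_coeff a" using ab by (simp add: k_def)
        have "coeff (a - smult k b) (degree b) = 0" using k deg by simp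
        moreover have "degree (a - smult k b) \<le> degree b"
          using deg by (intro degree_diff_le) auto
        ultimately have "a - smult k b = 0 \<or> degree (a - smult k b) < degree b"
          by (metis le_neq_implies_less leading_coeff_0_iff)
        then have "to_ac (Fract (a - [:k:] * b) b) \<in> val_ge K w 1"
        proof (cases "a - smult k b = 0")
          case True
          then show ?thesis by (simp add: fract_collapse val_ge_0)
        next
          case False
          assume "a - smult k b = 0 \<or> degree (a - smult k b) < degree b"
          with False have "1 \<le> real (degree b) - real (degree (a - smult k b))" by linarith
          then show ?thesis using formula[OF False ab(2)] by (simp add: val_ge_def)
        qed
        then have "x - of_A [:k:] \<in> ?P" unfolding eq by auto
        then show ?thesis by (intro bexI[of _ "of_A [:k:]"]) auto
      qed
    qed
    moreover have "card ?R = CARD('a) ^ 1"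
      using card_poly_degree_less[where 'a = 'a, of 0] by (subst card_image) (auto simp: inj_on_def)
    ultimately show "index_le (to_ac ` {c. to_ac c \<in> val_ge K w 0}) ?P (real (CARD('a) ^ 1))" by simp
  qed (use dep in auto)
qed

text \<open>After cancelling powers of \<open>l\<close>, an integral fraction has a denominator
  invertible modulo \<open>l\<close>. It is thus congruent to a polynomial, and then to the
  remainder of that polynomial modulo \<open>l\<close>.\<close>

lemma finite_place_uniformized:
  fixes K :: "'a::{field,finite} kbar set"
  assumes vf: "valued_field K w" and l: "irreducible l"
    and formula: "\<And>a b. a \<noteq> 0 \<Longrightarrow> b \<noteq> 0 \<Longrightarrow>
      w (to_ac (Fract a b)) = real (degree l) * (real (ord_at l a) - real (ord_at l b))"
    and dep: "\<And>r (y :: nat \<Rightarrow> 'a kbar). (\<And>i. i < r \<Longrightarrow> y i \<in> K) \<Longrightarrow> n < r \<Longrightarrow>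
       \<exists>c. (\<exists>i<r. c i \<noteq> 0) \<and> (\<Sum>i<r. to_ac (c i) * y i) = 0"
  shows "uniformized_place K w (Fract l 1) (degree l) n"
proof -
  interpret valued_field K w by (rule vf)
  have l0: "l \<noteq> 0" "\<not> l dvd 1" using l by (auto simp: irreducible_def)
  have degl: "degree l > 0" by (rule irreducible_degree_pos[OF l])
  have ord1: "ord_at l 1 = 0" using l0 by (simp add: ord_at_eq_0)
  have wA: "w (of_A a) = real (degree l) * real (ord_at l a)" if "a \<noteq> 0" for a
    using formula[of a 1] that ord1 by (simp add: of_A_def)
  have A: "of_A a \<in> val_ge K w 0" for a
    using wA[of a] by (cases "a = 0") (auto simp: val_ge_def)
  have wl: "w (of_A l) = real (degree l)"
  proof -
    obtain a' where a': "l = l ^ ord_at l l * a'" "\<not> l dvd a'"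
      using ord_at_decompose[OF degl l0(1)] by blast
    have "1 \<le> ord_at l l" using a' by (cases "ord_at l l") auto
    moreover have "ord_at l l \<le> 1"
    proof (rule ccontr)
      assume "\<not> ord_at l l \<le> 1"
      then obtain m where m: "ord_at l l = Suc (Suc m)"
        by (metis One_nat_def not_less_eq_eq old.nat.exhaust zero_le)
      have "a' \<noteq> 0" using a' by auto
      then have "degree l = ord_at l l * degree l + degree a'"
        using a'(1) l0 by (metis degree_mult_eq degree_power_eq power_not_zero)
      then show False using m degl by simp
    qed
    ultimately have "ord_at l l = 1" by simp
    then show ?thesis using wA[of l] l0 by simp
  qed
  have L: "of_A l \<in> val_ge K w (degree l)" using wl by (simp add: val_ge_def)
  show ?thesis
  proof unfold_locales
    show "Fract l 1 \<noteq> 0" using l0 by (simp add: Zero_fract_def eq_fract)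
    show "w (to_ac (Fract l 1)) = real (degree l)" using wl by (simp add: of_A_def)
    show "degree l > 0" by (rule degl)
    show "\<exists>a::int. w (to_ac c) = real (degree l) * real_of_int a" if c: "c \<noteq> 0" for c
    proof -
      obtain a b where ab: "c = Fract a b" "b \<noteq> 0" by (cases c)
      then have "a \<noteq> 0" using c by (auto simp: fract_collapse)
      then have "w (to_ac c) = real (degree l) * real_of_int (int (ord_at l a) - int (ord_at l b))"
        using ab formula by simp
      then show ?thesis ..
    qed
    let ?R = "of_A ` {p :: 'a poly. degree p < degree l}"
    let ?P = "to_ac ` {c. to_ac c \<in> val_ge K w (real (degree l))}"
    obtain n' where n': "degree l = Suc n'" using degl gr0_implies_Suc by blast
    have sg: "add_subgroup ?P" by (rule val_ge_base_subgroup)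
    have "index_le (to_ac ` {c. to_ac c \<in> val_ge K w 0}) ?P (card ?R)"
    proof (rule index_le_representatives[OF _ sg])
      show "finite ?R" unfolding n' using finite_poly_degree_less by blast
      fix x assume "x \<in> to_ac ` {c. to_ac c \<in> val_ge K w 0}"
      then obtain c where c: "x = to_ac c" "to_ac c \<in> val_ge K w 0" by blast
      obtain a b where ab: "c = Fract a b" "b \<noteq> 0" by (cases c)
      have "\<exists>p. x - of_A p \<in> val_ge K w (degree l)"
      proof (cases "a = 0")
        case True
        then show ?thesis using c ab by (intro exI[of _ 0]) (simp add: fract_collapse val_ge_0)
      next
        case False
        obtain a' where a': "a = l ^ ord_at l a * a'" "\<not> l dvd a'"
          using ord_at_decompose[OF degl False] by blast
        obtain b' where b': "b = l ^ ord_at l b * b'" "\<not> l dvd b'"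
          using ord_at_decompose[OF degl ab(2)] by blast
        have "ord_at l b \<le> ord_at l a"
          using c ab False formula[of a b] degl by (auto simp: val_ge_def zero_le_mult_iff Zero_fract_def eq_fract)
        then obtain m where m: "ord_at l a = m + ord_at l b" by (metis add.commute le_Suc_ex)
        \<comment> \<open>From this, 1/b' = u - l z/b', so replacing 1/b' by \<open>u\<close>
          changes \<open>x\<close> by \<open>l\<close> times an integral element.\<close>
        obtain u z where u: "u * b' = 1 + l * z" using inverse_mod_irreducible[OF l b'(2)] by blast
        have b'0: "b' \<noteq> 0" using b' by auto
        have x: "x = of_A (l ^ m * a') / of_A b'"
        proof -
          have "a * b' = l ^ m * a' * b"
            by (subst a'(1), subst b'(1)) (simp add: m power_add mult_ac)
          then have "of_A a * of_A b' = of_A (l ^ m * a') * of_A b" by (metis of_A_mult)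
          then show ?thesis using c ab b'0 by (simp add: to_ac_Fract frac_eq_eq)
        qed
        have "inverse (of_A b') \<in> val_ge K w 0"
          using wA[OF b'0] b'0 w_inverse[of "of_A b'"] ord_at_eq_0[OF b'(2)]
          by (simp add: val_ge_def K_inverse)
        then have "of_A l * (of_A (- z * (l ^ m * a')) * inverse (of_A b')) \<in> val_ge K w (real (degree l) + (0 + 0))"
          by (intro val_ge_mult L A)
        moreover have "of_A l * (of_A (- z * (l ^ m * a')) * inverse (of_A b')) = x - of_A (u * (l ^ m * a'))"
        proof -
          have "of_A (- z * (l ^ m * a')) * of_A l = of_A (l ^ m * a') - of_A (u * (l ^ m * a')) * of_A b'"
          proof -
            have "- z * (l ^ m * a') * l = l ^ m * a' - (u * b') * (l ^ m * a')"
              unfolding u by (simp add: algebra_simps)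
            then have "- z * (l ^ m * a') * l = l ^ m * a' - u * (l ^ m * a') * b'"
              by (simp add: mult_ac)
            then show ?thesis by (metis of_A_mult of_A_diff)
          qed
          then show ?thesis using b'0 unfolding x by (simp add: field_simps)
        qed
        ultimately have "x - of_A (u * (l ^ m * a')) \<in> val_ge K w (real (degree l) + (0 + 0))"
          by (simp only:)
        then show ?thesis by (intro exI[of _ "u * (l ^ m * a')"]) (simp only: add_0_right)
      qed
      then obtain p where p: "x - of_A p \<in> val_ge K w (degree l)" by blast
      have "of_A p - of_A (p mod l) = of_A l * of_A (p div l)"
        by (metis of_A_diff of_A_mult minus_mod_eq_mult_div)
      moreover have "of_A l * of_A (p div l) \<in> val_ge K w (real (degree l) + 0)" by (intro val_ge_mult L A)
      ultimately have "(x - of_A p) + (of_A p - of_A (p mod l)) \<in> val_ge K w (degree l)"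
        using p by (intro val_ge_add) auto
      then have "to_ac (c - Fract (p mod l) 1) \<in> val_ge K w (degree l)"
        using c by (simp add: of_A_def)
      then have "x - of_A (p mod l) \<in> ?P"
        using c by (intro image_eqI[of _ _ "c - Fract (p mod l) 1"]) (auto simp: of_A_def)
      moreover have "of_A (p mod l) \<in> ?R" using degree_mod_less[of l p] l0 degl by auto
      ultimately show "\<exists>r\<in>?R. x - r \<in> ?P" by blast
    qed
    moreover have "card ?R = CARD('a) ^ degree l"
      using card_poly_degree_less[where 'a = 'a, of n'] unfolding n' by (subst card_image) (auto simp: inj_on_def)
    ultimately show "index_le (to_ac ` {c. to_ac c \<in> val_ge K w 0}) ?P (real (CARD('a) ^ degree l))" by simp
  qed (use dep in auto)
qed

lemma place_uniformized:
  fixes K :: "'a::{field,finite} kbar set"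
  assumes "intermediate_field K" "w \<in> places K"
    and "\<And>r (y :: nat \<Rightarrow> 'a kbar). (\<And>i. i < r \<Longrightarrow> y i \<in> K) \<Longrightarrow> n < r \<Longrightarrow>
       \<exists>c. (\<exists>i<r. c i \<noteq> 0) \<and> (\<Sum>i<r. to_ac (c i) * y i) = 0"
  obtains \<pi> \<delta> where "uniformized_place K w \<pi> \<delta> n"
  using places_formula[OF assms(2)]
proof (elim disjE exE conjE)
  assume "\<forall>a b. a \<noteq> 0 \<longrightarrow> b \<noteq> 0 \<longrightarrow> w (to_ac (Fract a b)) = real (degree b) - real (degree a)"
  then show ?thesis
    by (intro that[OF infinite_place_uniformized[OF places_valued_field[OF assms(1,2)] _ assms(3)]]) auto
next
  fix l :: "'a poly"
  assume "irreducible l" "\<forall>a b. a \<noteq> 0 \<longrightarrow> b \<noteq> 0 \<longrightarrow>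
         w (to_ac (Fract a b)) = real (degree l) * (real (ord_at l a) - real (ord_at l b))"
  then show ?thesis
    by (intro that[OF finite_place_uniformized[OF places_valued_field[OF assms(1,2)] _ _ assms(3)]]) auto
qed

section \<open>Finiteness of the set of poles\<close>

text \<open>A bound on the dimension of K over \<open>k\<close> in terms of families and explicit
  coefficients, which keeps the arguments about valuations apart from the dimension theory of
  subfields; \<open>adjoin_rank_le\<close> connects the two.\<close>

definition rank_le :: "'a::field kbar set \<Rightarrow> nat \<Rightarrow> bool" where
  "rank_le K n \<longleftrightarrow> (\<forall>r (y :: nat \<Rightarrow> 'a kbar). (\<forall>i<r. y i \<in> K) \<longrightarrow> n < r \<longrightarrow>
     (\<exists>c. (\<exists>i<r. c i \<noteq> 0) \<and> (\<Sum>i<r. to_ac (c i) * y i) = 0))"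

section \<open>Dominant terms and vanishing sums\<close>

context valued_field
begin

lemma w_add_eq:
  assumes "x \<in> K" "y \<in> K" "x \<noteq> 0" "y = 0 \<or> w x < w y"
  shows "x + y \<noteq> 0" "w (x + y) = w x"
proof -
  have ne: "x + y \<noteq> 0"
  proof
    assume "x + y = 0"
    then have "y = - x" by (simp add: eq_neg_iff_add_eq_0 add.commute)
    then show False using assms w_uminus[of x] by auto
  qed
  moreover have "w (x + y) = w x"
  proof (cases "y = 0")
    case False
    have "w x \<le> w (x + y)" using w_add[of x y] assms False ne by auto
    moreover have "w (x + y) \<le> w x"
      using w_add[of "x + y" "- y"] assms False ne w_uminus[of y] by auto
    ultimately show ?thesis by simp
  qed simp
  ultimately show "x + y \<noteq> 0" "w (x + y) = w x" by auto
qed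

text \<open>A term of strictly smallest value cannot be cancelled. Mostly used in reverse: in a
  vanishing sum the least value is attained twice.\<close>

lemma sum_dominant_nonzero:
  assumes I: "finite I" "j \<in> I" and f: "\<And>i. i \<in> I \<Longrightarrow> f i \<in> K" "f j \<noteq> 0"
    and less: "\<And>i. i \<in> I \<Longrightarrow> i \<noteq> j \<Longrightarrow> f i = 0 \<or> w (f j) < w (f i)"
  shows "sum f I \<noteq> 0"
proof -
  define J where "J = {i \<in> I. i \<noteq> j \<and> f i \<noteq> 0}"
  \<comment> \<open>The inserted value keeps the minimum defined when \<open>f j\<close> is the only
    nonzero term.\<close>
  define r where "r = Min (insert (w (f j) + 1) ((\<lambda>i. w (f i)) ` J))"
  have fin: "finite J" using I by (simp add: J_def)
  have r: "w (f j) < r" unfolding r_def using fin less by (subst Min_gr_iff) (auto simp: J_def)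
  have "f i \<in> val_ge K w r" if "i \<in> I - {j}" for i
  proof (cases "f i = 0")
    case False
    then have "r \<le> w (f i)" unfolding r_def using fin that by (intro Min_le) (auto simp: J_def)
    then show ?thesis using f that by (simp add: val_ge_def)
  qed (simp add: val_ge_0)
  then have "sum f (I - {j}) \<in> val_ge K w r" by (rule val_ge_sum)
  then have "sum f (I - {j}) = 0 \<or> w (f j) < w (sum f (I - {j}))" "sum f (I - {j}) \<in> K"
    using r by (auto simp: val_ge_def)
  then have "f j + sum f (I - {j}) \<noteq> 0" using w_add_eq(1)[of "f j" "sum f (I - {j})"] f I by auto
  then show ?thesis using I by (simp add: sum.remove)
qed

end

context uniformized_place
begin

text \<open>The powers of \<open>y\<close> up to the exponent \<open>n\<close> are dependent over
  \<open>k\<close>. Two terms of the relation share the least value, and comparing them exhibits a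
  nonzero multiple of \<open>w y\<close> as a value of \<open>k\<close>.\<close>

lemma rational_multiple:
  assumes y: "y \<in> K" "y \<noteq> 0"
  obtains k :: nat and a :: int where "k > 0" "w y * real k = \<delta> * real_of_int a"
proof -
  obtain c i0 where c: "i0 < Suc n" "c i0 \<noteq> 0" "(\<Sum>i<Suc n. to_ac (c i) * y ^ i) = 0"
    using dependent[of "Suc n" "\<lambda>i. y ^ i"] y by auto
  define I where "I = {i. i < Suc n \<and> c i \<noteq> 0}"
  let ?f = "\<lambda>i. to_ac (c i) * y ^ i"
  have I: "finite I" "I \<noteq> {}" using c by (auto simp: I_def)
  obtain j where j: "j \<in> I" "\<And>i. i \<in> I \<Longrightarrow> w (?f j) \<le> w (?f i)"
    using arg_min_if_finite[OF I, of "\<lambda>i. w (?f i)"] by (meson not_le)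
  have "\<exists>i\<in>I. i \<noteq> j \<and> w (?f i) = w (?f j)"
  proof (rule ccontr)
    assume *: "\<not> ?thesis"
    have "sum ?f {..<Suc n} \<noteq> 0"
    proof (rule sum_dominant_nonzero[of _ j])
      show "?f j \<noteq> 0" using j(1) y by (simp add: I_def)
      show "?f i = 0 \<or> w (?f j) < w (?f i)" if "i \<in> {..<Suc n}" "i \<noteq> j" for i
      proof (cases "i \<in> I")
        case True
        then show ?thesis using j(2)[OF True] * that by force
      next
        case False
        then show ?thesis using that by (simp add: I_def)
      qed
    qed (use j y in \<open>auto simp: I_def\<close>)
    then show False using c(3) by simp
  qed
  then obtain i where i: "i \<in> I" "i \<noteq> j" "w (?f i) = w (?f j)" by blast
  have wf: "w (?f i) = w (to_ac (c i)) + real i * w y" if "i \<in> I" for i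
    using w_mult[of "to_ac (c i)" "y ^ i"] y that by (simp add: I_def w_power)
  obtain a where a: "w (to_ac (c i)) = real \<delta> * real_of_int a" using multiples[of "c i"] i by (auto simp: I_def)
  obtain b where b: "w (to_ac (c j)) = real \<delta> * real_of_int b" using multiples[of "c j"] j by (auto simp: I_def)
  have eq: "w y * (real i - real j) = \<delta> * (real_of_int b - real_of_int a)"
    using i(3) wf[OF i(1)] wf[OF j(1)] a b by (simp add: algebra_simps)
  show ?thesis
  proof (cases "j < i")
    case True
    then show ?thesis using eq by (intro that[of "i - j" "b - a"]) (auto simp: of_nat_diff)
  next
    case False
    then show ?thesis using eq i(2) by (intro that[of "j - i" "a - b"]) (auto simp: of_nat_diff algebra_simps)
  qed
qed

lemma pole_index:
  assumes "y \<in> K" "w y < 0"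
  shows "index_le (val_ge K w (w y)) (val_ge K w 0) (real CARD('a) powr (local_degree K w * (- w y)))"
proof -
  have y: "y \<noteq> 0" using assms by auto
  obtain k a where ka: "k > 0" "w y * real k = \<delta> * real_of_int a"
    using rational_multiple[OF assms(1) y] by blast
  have "w y * real k < 0" using ka(1) assms(2) by (simp add: mult_neg_pos)
  then have "a < 0" using ka(2) by (simp add: mult_less_0_iff)
  then have "w y * real k = - (\<delta> * real (nat (- a)))" using ka(2) by simp
  from element_index[OF assms(1) y assms(2) ka(1) this] show ?thesis .
qed

lemma exists_base_value:
  obtains c where "c \<noteq> 0" "w (to_ac c) = real \<delta> * real_of_int m"
proof (cases "0 \<le> m")
  case True
  then have "w (to_ac (\<pi> ^ nat m)) = real \<delta> * real_of_int m" by (simp add: w_pi_power)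
  then show ?thesis using that[of "\<pi> ^ nat m"] pi by simp
next
  case False
  then have "w (to_ac (inverse (\<pi> ^ nat (- m)))) = real \<delta> * real_of_int m"
    using pi w_inverse[of "to_ac \<pi> ^ nat (- m)"] by (simp add: w_pi_power)
  then show ?thesis using that[of "inverse (\<pi> ^ nat (- m))"] pi by simp
qed

end

section \<open>Independence of places and finiteness of the set of poles\<close>

locale finite_extension_field =
  fixes K :: "'a::{field,finite} kbar set" and n :: nat
  assumes field: "intermediate_field K" and rank: "rank_le K n"
begin

lemma valued: "w \<in> places K \<Longrightarrow> valued_field K w"
  using field by (rule places_valued_field)

lemma uniformized:
  assumes "w \<in> places K"
  obtains \<pi> \<delta> where "uniformized_place K w \<pi> \<delta> n"
  using place_uniformized[OF field assms, of n] rank unfolding rank_le_def by blast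

text \<open>Take \<open>y\<close> with smaller value at \<open>w\<close> than at \<open>w'\<close>
  (or invert it). A power of \<open>y\<close> widens the gap beyond \<open>\<delta>\<close>; then
  division by an element of \<open>k\<close>, which has the same value at both places, moves the two
  values to opposite sides of 0.\<close>

lemma separate_two_places:
  assumes w: "w \<in> places K" "w' \<in> places K" "\<And>c. w (to_ac c) = w' (to_ac c)" "w \<noteq> w'"
  obtains z where "z \<in> K" "z \<noteq> 0" "w z < 0" "0 < w' z"
proof -
  obtain \<pi> \<delta> where "uniformized_place K w \<pi> \<delta> n" using uniformized[OF w(1)] .
  then interpret W: uniformized_place K w \<pi> \<delta> n .
  interpret W': valued_field K w' by (rule valued[OF w(2)])
  obtain y0 where "w y0 \<noteq> w' y0" using w(4) by blast
  then have y0: "y0 \<in> K" "y0 \<noteq> 0" "w y0 \<noteq> w' y0"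
    using W.w_outside[of y0] W'.w_outside[of y0] W.w_0 W'.w_0 by (metis, metis, metis)
  obtain y where y: "y \<in> K" "y \<noteq> 0" "w y < w' y"
  proof (cases "w y0 < w' y0")
    case True
    then show ?thesis using that y0 by blast
  next
    case False
    then show ?thesis
      using that[of "inverse y0"] y0 W.w_inverse[of y0] W'.w_inverse[of y0] by auto
  qed
  obtain N :: nat where N: "real \<delta> < real N * (w' y - w y)"
    using y ex_less_of_nat_mult[of "w' y - w y" "real \<delta>"] by auto
  \<comment> \<open>The least multiple of \<open>\<delta>\<close> strictly above
    \<open>N * w y\<close>; it exceeds this by at most \<open>\<delta>\<close> and so stays below
    \<open>N * w' y\<close>.\<close>
  define M where "M = \<lfloor>real N * w y / \<delta>\<rfloor> + 1"
  have M: "real N * w y < \<delta> * real_of_int M" "\<delta> * real_of_int M \<le> real N * w y + \<delta>"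
  proof -
    have "real N * w y / \<delta> < real_of_int M" "real_of_int M \<le> real N * w y / \<delta> + 1"
      by (auto simp: M_def)
    then show "real N * w y < \<delta> * real_of_int M" "\<delta> * real_of_int M \<le> real N * w y + \<delta>"
      using W.\<delta>_pos by (auto simp: field_simps)
  qed
  obtain c where c: "c \<noteq> 0" "w (to_ac c) = real \<delta> * real_of_int M" using W.exists_base_value .
  have "w (y ^ N / to_ac c) = real N * w y - \<delta> * real_of_int M"
    using y c W.w_divide[of "y ^ N" "to_ac c"] W.w_power[of y N] by simp
  moreover have "w' (y ^ N / to_ac c) = real N * w' y - \<delta> * real_of_int M"
    using y c W'.w_divide[of "y ^ N" "to_ac c"] W'.w_power[of y N] w(3)[of c] by simp
  ultimately show ?thesis
    using that[of "y ^ N / to_ac c"] y c M N by (auto simp: algebra_simps)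
qed

text \<open>In the induction \<open>z\<close> serves the places of \<open>F\<close> and
  \<open>y\<close> the new place \<open>w'\<close>. A high power of \<open>z\<close> outweighs
  \<open>y\<close> on \<open>F\<close>, and the value of \<open>z\<close> at \<open>w'\<close>
  decides how the two are combined.\<close>

lemma separate_places:
  assumes F: "finite F" "F \<subseteq> places K" and w0: "w0 \<in> places K" "w0 \<notin> F"
    and same: "\<And>w c. w \<in> F \<Longrightarrow> w (to_ac c) = w0 (to_ac c)"
  shows "\<exists>z\<in>K. z \<noteq> 0 \<and> w0 z < 0 \<and> (\<forall>w\<in>F. 0 < w z)"
  using F w0 same
proof (induction F rule: finite_induct)
  case empty
  obtain \<pi> \<delta> where "uniformized_place K w0 \<pi> \<delta> n" using uniformized[OF w0(1)] .
  then interpret W: uniformized_place K w0 \<pi> \<delta> n .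
  have "w0 (inverse (to_ac \<pi>)) < 0" using W.pi W.\<delta>_pos W.w_inverse[of "to_ac \<pi>"] by simp
  then show ?case using W.pi by (intro bexI[of _ "inverse (to_ac \<pi>)"]) auto
next
  case (insert w' F)
  interpret W0: valued_field K w0 by (rule valued[OF insert.prems(2)])
  interpret W': valued_field K w' using insert.prems by (intro valued) auto
  have vf: "valued_field K w" if "w \<in> F" for w using insert.prems that by (intro valued) auto
  obtain z where z: "z \<in> K" "z \<noteq> 0" "w0 z < 0" "\<And>w. w \<in> F \<Longrightarrow> 0 < w z"
    using insert by auto
  obtain y where y: "y \<in> K" "y \<noteq> 0" "w0 y < 0" "0 < w' y"
  proof (rule separate_two_places[of w0 w'])
    show "w0 (to_ac c) = w' (to_ac c)" for c using insert.prems(4)[of w' c] by simp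
  qed (use insert.prems in auto)
  obtain m :: nat where m: "\<And>w. w \<in> F \<Longrightarrow> 0 < real (Suc m) * w z + w y"
  proof -
    have "\<exists>m. \<forall>m'\<ge>m. 0 < real (Suc m') * w z + w y" if wF: "w \<in> F" for w
    proof -
      obtain m :: nat where m: "- w y < real m * w z"
        using ex_less_of_nat_mult[OF z(4)[OF wF], of "- w y"] by auto
      have "0 < real (Suc m') * w z + w y" if "m' \<ge> m" for m'
      proof -
        have "real m * w z \<le> real (Suc m') * w z"
          using that z(4)[OF wF] by (intro mult_right_mono) auto
        then show ?thesis using m by linarith
      qed
      then show ?thesis by blast
    qed
    then obtain M where M: "\<And>w m'. w \<in> F \<Longrightarrow> m' \<ge> M w \<Longrightarrow> 0 < real (Suc m') * w z + w y" by metis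
    have "M w \<le> Max (insert 0 (M ` F))" if "w \<in> F" for w
      using insert.hyps(1) that by (intro Max_ge) auto
    then show ?thesis using that[of "Max (insert 0 (M ` F))"] M by blast
  qed
  let ?x = "z ^ Suc m"
  have x: "?x \<in> K" "?x \<noteq> 0" using z by (auto simp del: power_Suc)
  have w0x: "w0 ?x < 0" using z W0.w_power[of z "Suc m"] by (simp add: mult_pos_neg del: power_Suc)
  have wx: "w ?x = real (Suc m) * w z" if "w \<in> F" for w
    using valued_field.w_power[OF vf[OF that] z(1,2)] .
  consider "0 < w' z" | "w' z = 0" | "w' z < 0" by linarith
  then show ?case
  proof cases
    case 1
    then show ?thesis using z by (intro bexI[of _ z]) auto
  next
    case 2
    have "w0 (?x * y) < 0" using W0.w_mult[of ?x y] x y w0x by (simp del: power_Suc)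
    moreover have "0 < w' (?x * y)"
      using W'.w_mult[of ?x y] x y W'.w_power[of z "Suc m"] z 2 by (simp del: power_Suc)
    moreover have "0 < w (?x * y)" if "w \<in> F" for w
      using valued_field.w_mult[OF vf[OF that], of ?x y] x y m[OF that] wx[OF that] by (simp del: power_Suc)
    ultimately show ?thesis using x y by (intro bexI[of _ "?x * y"]) (auto simp del: power_Suc)
  next
    case 3
    have w'x: "w' ?x < 0" using z W'.w_power[of z "Suc m"] 3 by (simp add: mult_pos_neg del: power_Suc)
    have a: "?x + 1 \<noteq> 0" "w0 (?x + 1) = w0 ?x"
      using W0.w_add_eq[of ?x 1] x w0x by (auto simp del: power_Suc)
    have a': "w' (?x + 1) = w' ?x" using W'.w_add_eq[of ?x 1] x w'x by (auto simp del: power_Suc)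
    have aF: "w (?x + 1) = 0" if "w \<in> F" for w
    proof -
      interpret W: valued_field K w by (rule vf[OF that])
      have "0 < w ?x" using wx[OF that] z(4)[OF that] by (simp del: power_Suc)
      then show ?thesis using W.w_add_eq(2)[of 1 ?x] x by (simp add: add.commute del: power_Suc)
    qed
    \<comment> \<open>Where \<open>?x\<close> has a pole, at \<open>w0\<close> and
      \<open>w'\<close>, the quotient has value 0 and \<open>y\<close> decides; on \<open>F\<close>
      the quotient keeps the positive value of \<open>?x\<close>.\<close>
    let ?u = "?x / (?x + 1) * y"
    have K1: "?x + 1 \<in> K" using x by (intro W0.K_add) auto
    have u: "?u \<in> K" "?u \<noteq> 0" using x y a K1 by (auto simp del: power_Suc)
    have wu: "w ?u = w ?x - w (?x + 1) + w y" if "valued_field K w" for w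
    proof -
      interpret W: valued_field K w by (rule that)
      show ?thesis using W.w_mult[of "?x / (?x + 1)" y] W.w_divide[of ?x "?x + 1"] x y a K1
        by (simp del: power_Suc)
    qed
    have "w0 ?u < 0" using wu[OF W0.valued_field_axioms] a y by (simp del: power_Suc)
    moreover have "0 < w' ?u" using wu[OF W'.valued_field_axioms] a' y by (simp del: power_Suc)
    moreover have "0 < w ?u" if "w \<in> F" for w
      using wu[OF vf[OF that]] aF[OF that] wx[OF that] m[OF that] by (simp del: power_Suc)
    ultimately show ?thesis using u by (intro bexI[of _ ?u]) (auto simp del: power_Suc)
  qed
qed

text \<open>Given n + 1 places above v, separation provides z with a pole at one of them and zeros
  at the others; z/(z + 1) then has value 0 there and positive values elsewhere. The n + 1 elements
  so obtained are independent over \<open>k\<close>: in a relation, the term whose coefficient is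
  least at v dominates at its own place.\<close>

lemma finite_places_above:
  assumes v: "v \<in> base_places"
  shows "finite {w \<in> places K. \<forall>c. w (to_ac c) = v c}"
proof (rule ccontr)
  let ?W = "{w \<in> places K. \<forall>c. w (to_ac c) = v c}"
  assume "infinite ?W"
  then obtain F where F: "finite F" "card F = Suc n" "F \<subseteq> ?W"
    using infinite_arbitrarily_large[of ?W "Suc n"] by blast
  have Fv: "w (to_ac c) = v c" if "w \<in> F" for w c using F(3) that by blast
  obtain e where e: "bij_betw e {0..<Suc n} F" using ex_bij_betw_nat_finite[OF F(1)] F(2) by auto
  have eF: "e i \<in> F" if "i < Suc n" for i using e that by (auto simp: bij_betw_def)
  have vf: "valued_field K (e i)" if "i < Suc n" for i using eF[OF that] F(3) by (intro valued) auto
  have "\<exists>u\<in>K. u \<noteq> 0 \<and> e i u = 0 \<and> (\<forall>j<Suc n. j \<noteq> i \<longrightarrow> 0 < e j u)" if i: "i < Suc n" for i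
  proof -
    interpret Wi: valued_field K "e i" by (rule vf[OF i])
    have "\<exists>z\<in>K. z \<noteq> 0 \<and> e i z < 0 \<and> (\<forall>w\<in>F - {e i}. 0 < w z)"
    proof (rule separate_places)
      show "w (to_ac c) = e i (to_ac c)" if "w \<in> F - {e i}" for w c
        using that eF[OF i] Fv[of w c] Fv[of "e i" c] by simp
    qed (use F eF[OF i] in auto)
    then obtain z where z: "z \<in> K" "z \<noteq> 0" "e i z < 0" "\<And>w. w \<in> F - {e i} \<Longrightarrow> 0 < w z" by blast
    have a: "z + 1 \<noteq> 0" "e i (z + 1) = e i z" using Wi.w_add_eq[of z 1] z by auto
    have K1: "z + 1 \<in> K" using z by (intro Wi.K_add) auto
    have "e i (z / (z + 1)) = 0" using Wi.w_divide[of z "z + 1"] z a K1 by simp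
    moreover have "0 < e j (z / (z + 1))" if j: "j < Suc n" "j \<noteq> i" for j
    proof -
      interpret Wj: valued_field K "e j" by (rule vf[OF j(1)])
      have "e j \<noteq> e i" using e i j by (auto simp: bij_betw_def inj_on_def)
      then have pos: "0 < e j z" using z(4) eF[OF j(1)] by blast
      then have "e j (z + 1) = 0" using Wj.w_add_eq(2)[of 1 z] z by (simp add: add.commute)
      then show ?thesis using Wj.w_divide[of z "z + 1"] z a K1 pos by simp
    qed
    ultimately show ?thesis using z a K1 by (intro bexI[of _ "z / (z + 1)"]) auto
  qed
  then obtain u where u: "\<And>i. i < Suc n \<Longrightarrow> u i \<in> K \<and> u i \<noteq> 0 \<and> e i (u i) = 0"
    "\<And>i j. i < Suc n \<Longrightarrow> j < Suc n \<Longrightarrow> j \<noteq> i \<Longrightarrow> 0 < e j (u i)" by metis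
  obtain c i0 where c: "i0 < Suc n" "c i0 \<noteq> 0" "(\<Sum>i<Suc n. to_ac (c i) * u i) = 0"
    using rank u(1) unfolding rank_le_def by (metis lessI)
  define I where "I = {i. i < Suc n \<and> c i \<noteq> 0}"
  have I: "finite I" "I \<noteq> {}" using c by (auto simp: I_def)
  obtain j where j: "j \<in> I" "\<And>i. i \<in> I \<Longrightarrow> v (c j) \<le> v (c i)"
    using arg_min_if_finite[OF I, of "\<lambda>i. v (c i)"] by (meson not_le)
  have jn: "j < Suc n" "c j \<noteq> 0" using j(1) by (auto simp: I_def)
  interpret Wj: valued_field K "e j" by (rule vf[OF jn(1)])
  have ev: "e j (to_ac c) = v c" for c using eF[OF jn(1)] F(3) by blast
  have w: "e j (to_ac (c i) * u i) = v (c i) + e j (u i)" if "i < Suc n" "c i \<noteq> 0" for i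
    using Wj.w_mult[of "to_ac (c i)" "u i"] u(1)[OF that(1)] that ev by simp
  have "(\<Sum>i\<in>{..<Suc n}. to_ac (c i) * u i) \<noteq> 0"
  proof (rule Wj.sum_dominant_nonzero[of _ j])
    show "to_ac (c j) * u j \<noteq> 0" using jn u(1) by simp
    show "to_ac (c i) * u i = 0 \<or> e j (to_ac (c j) * u j) < e j (to_ac (c i) * u i)"
      if i: "i \<in> {..<Suc n}" "i \<noteq> j" for i
    proof (cases "c i = 0")
      case False
      then have "v (c j) \<le> v (c i)" using j(2)[of i] i by (simp add: I_def)
      then show ?thesis using w[of i] w[OF jn] False i u(1)[OF jn(1)] u(2)[of i j] jn by auto
    qed simp
  qed (use jn u(1) in auto)
  then show False using c(3) by simp
qed

text \<open>A pole at a finite place forces its irreducible polynomial to divide the denominator,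
  and over a finite field only finitely many polynomials have degree at most that of the
  denominator. The dummy \<open>v 0 = 0\<close> makes a place unique given its formula on
  fractions.\<close>

lemma finite_base_places_pole:
  fixes c :: "'a poly fract"
  shows "finite {v \<in> base_places. v c < 0}"
proof -
  obtain a b where ab: "c = Fract a b" "b \<noteq> 0" by (cases c)
  let ?P = "\<lambda>v :: 'a poly fract \<Rightarrow> real. \<forall>a b. a \<noteq> 0 \<longrightarrow> b \<noteq> 0 \<longrightarrow> v (Fract a b) = real (degree b) - real (degree a)"
  let ?Q = "\<lambda>l v :: 'a poly fract \<Rightarrow> real. \<forall>a b. a \<noteq> 0 \<longrightarrow> b \<noteq> 0 \<longrightarrow>
       v (Fract a b) = real (degree l) * (real (ord_at l a) - real (ord_at l b))"
  have eqI: "v = v'" if "v 0 = 0" "v' 0 = 0" "\<And>a b. a \<noteq> 0 \<Longrightarrow> b \<noteq> 0 \<Longrightarrow> v (Fract a b) = v' (Fract a b)"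
    for v v' :: "'a poly fract \<Rightarrow> real"
  proof
    fix x show "v x = v' x"
    proof (cases x)
      case (Fract a b)
      then show ?thesis using that by (cases "a = 0") (auto simp: fract_collapse)
    qed
  qed
  have sub: "finite S" if "\<And>v v'. v \<in> S \<Longrightarrow> v' \<in> S \<Longrightarrow> v = v'" for S :: "('a poly fract \<Rightarrow> real) set"
  proof (cases "S = {}")
    case False
    then obtain v where "v \<in> S" by blast
    then have "S \<subseteq> {v}" using that by blast
    then show ?thesis using finite_subset by blast
  qed simp
  have 1: "finite {v. v 0 = 0 \<and> ?P v}" by (rule sub) (auto intro!: eqI)
  have 2: "finite {v. v 0 = 0 \<and> ?Q l v}" for l by (rule sub) (auto intro!: eqI)
  have "{v \<in> base_places. v c < 0} \<subseteq> {v. v 0 = 0 \<and> ?P v} \<union>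
      (\<Union>l\<in>{l. degree l < Suc (degree b)}. {v. v 0 = 0 \<and> ?Q l v})"
  proof
    fix v assume "v \<in> {v \<in> base_places. v c < 0}"
    then have v: "v \<in> base_places" "v c < 0" by auto
    then consider "v 0 = 0" "?P v" | l where "v 0 = 0" "irreducible l" "?Q l v"
      unfolding base_places_def by blast
    then show "v \<in> {v. v 0 = 0 \<and> ?P v} \<union> (\<Union>l\<in>{l. degree l < Suc (degree b)}. {v. v 0 = 0 \<and> ?Q l v})"
    proof cases
      case (2 l)
      have "a \<noteq> 0" using ab v 2(1) by (auto simp: fract_collapse)
      have "l dvd b"
      proof (rule ccontr)
        assume "\<not> l dvd b"
        then have "0 \<le> v c" using 2(3) ab \<open>a \<noteq> 0\<close> by (simp add: ord_at_eq_0)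
        then show False using v by simp
      qed
      then have "degree l < Suc (degree b)" using dvd_imp_degree_le ab by (simp add: less_Suc_eq_le)
      then show ?thesis using 2 by blast
    qed blast
  qed
  moreover have "finite ({v. v 0 = 0 \<and> ?P v} \<union>
      (\<Union>l\<in>{l. degree l < Suc (degree b)}. {v. v 0 = 0 \<and> ?Q l v}))"
    using 1 2 finite_poly_degree_less by blast
  ultimately show ?thesis by (rule finite_subset)
qed

lemma finite_places_base_pole: "finite {w \<in> places K. w (to_ac c) < 0}"
proof -
  have "{w \<in> places K. w (to_ac c) < 0} \<subseteq>
      (\<Union>v\<in>{v \<in> base_places. v c < 0}. {w \<in> places K. \<forall>c. w (to_ac c) = v c})"
  proof
    fix w assume "w \<in> {w \<in> places K. w (to_ac c) < 0}"
    then have w: "w \<in> places K" "w (to_ac c) < 0" by auto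
    then obtain v where "v \<in> base_places" "\<forall>c. w (to_ac c) = v c" unfolding places_def by blast
    then show "w \<in> (\<Union>v\<in>{v \<in> base_places. v c < 0}. {w \<in> places K. \<forall>c. w (to_ac c) = v c})"
      using w by auto
  qed
  moreover have "finite (\<Union>v\<in>{v \<in> base_places. v c < 0}. {w \<in> places K. \<forall>c. w (to_ac c) = v c})"
    using finite_base_places_pole finite_places_above by blast
  ultimately show ?thesis by (rule finite_subset)
qed

text \<open>At a pole of \<open>y\<close> where all coefficients of an equation of \<open>y\<close>,
  divided by the leading one, were integral, the leading term would dominate. So the poles of
  \<open>y\<close> are among those of finitely many elements of \<open>k\<close>.\<close>

lemma finite_poles:
  assumes "y \<in> K"
  shows "finite {w \<in> places K. w y < 0}"
proof -
  obtain p :: "'a poly fract poly" where p: "p \<noteq> 0" "poly (map_poly to_ac p) y = 0"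
    by (rule alg_closure_algebraic)
  let ?m = "degree p"
  have sum: "(\<Sum>i\<le>?m. to_ac (coeff p i) * y ^ i) = 0"
    using p(2) by (simp add: poly_altdef coeff_map_poly degree_map_poly)
  have "{w \<in> places K. w y < 0} \<subseteq> (\<Union>i\<in>{..?m}. {w \<in> places K. w (to_ac (coeff p i / lead_coeff p)) < 0})"
  proof
    fix w assume "w \<in> {w \<in> places K. w y < 0}"
    then have wp: "w \<in> places K" "w y < 0" by auto
    interpret valued_field K w by (rule valued[OF wp(1)])
    have y0: "y \<noteq> 0" using wp(2) w_0 by fastforce
    show "w \<in> (\<Union>i\<in>{..?m}. {w \<in> places K. w (to_ac (coeff p i / lead_coeff p)) < 0})"
    proof (rule ccontr)
      assume *: "\<not> ?thesis"
      have "(\<Sum>i\<in>{..?m}. to_ac (coeff p i) * y ^ i) \<noteq> 0"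
      proof (rule sum_dominant_nonzero[of _ ?m])
        show "to_ac (lead_coeff p) * y ^ ?m \<noteq> 0" using p y0 by simp
        show "to_ac (coeff p i) * y ^ i \<in> K" for i using assms by auto
        show "to_ac (coeff p i) * y ^ i = 0 \<or> w (to_ac (lead_coeff p) * y ^ ?m) < w (to_ac (coeff p i) * y ^ i)"
          if i: "i \<in> {..?m}" "i \<noteq> ?m" for i
        proof (cases "coeff p i = 0")
          case False
          have "0 \<le> w (to_ac (coeff p i / lead_coeff p))" using * wp(1) i by force
          then have "w (to_ac (lead_coeff p)) \<le> w (to_ac (coeff p i))"
            using w_divide[of "to_ac (coeff p i)" "to_ac (lead_coeff p)"] False p by simp
          moreover have "real ?m * w y < real i * w y" using i wp(2) by (intro mult_strict_right_mono_neg) auto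
          ultimately show ?thesis
            using w_mult[of "to_ac (coeff p i)" "y ^ i"] w_mult[of "to_ac (lead_coeff p)" "y ^ ?m"]
              w_power[OF assms y0] False p y0 assms by simp
        qed simp
      qed auto
      then show False using sum by simp
    qed
  qed
  then show ?thesis by (rule finite_subset) (use finite_places_base_pole in blast)
qed

end

section \<open>Existence of poles\<close>

abbreviation ac_const :: "'a::field \<Rightarrow> 'a kbar" where
  "ac_const c \<equiv> of_A [:c:]"

text \<open>Subalgebras over the constant field. Containing A is not demanded, so that valuation
  rings above infinity are covered.\<close>

definition const_subring :: "'a::field kbar set \<Rightarrow> bool" where
  "const_subring R \<longleftrightarrow> range ac_const \<subseteq> R \<and> (\<forall>x\<in>R. \<forall>y\<in>R. x - y \<in> R \<and> x * y \<in> R)"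

definition ring_adjoin :: "'a::field kbar set \<Rightarrow> 'a kbar \<Rightarrow> 'a kbar set" where
  "ring_adjoin R x = {poly p x |p. \<forall>i. coeff p i \<in> R}"

lemma const_subring_subgroup: "const_subring R \<Longrightarrow> add_subgroup R"
  unfolding const_subring_def add_subgroup_def by (auto dest!: subsetD[of _ _ "ac_const 0"])

lemma
  assumes "const_subring R"
  shows const_subring_const: "ac_const c \<in> R"
    and const_subring_1: "1 \<in> R" and const_subring_0: "0 \<in> R"
    and const_subring_diff: "x \<in> R \<Longrightarrow> y \<in> R \<Longrightarrow> x - y \<in> R"
    and const_subring_mult: "x \<in> R \<Longrightarrow> y \<in> R \<Longrightarrow> x * y \<in> R"
    and const_subring_add: "x \<in> R \<Longrightarrow> y \<in> R \<Longrightarrow> x + y \<in> R"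
    and const_subring_uminus: "x \<in> R \<Longrightarrow> - x \<in> R"
    and const_subring_sum: "(\<And>i. i \<in> I \<Longrightarrow> f i \<in> R) \<Longrightarrow> sum f I \<in> R"
    and const_subring_power: "x \<in> R \<Longrightarrow> x ^ n \<in> R"
proof -
  note sg = const_subring_subgroup[OF assms]
  show c: "ac_const c \<in> R" for c using assms by (auto simp: const_subring_def)
  show 1: "1 \<in> R" using c[of 1] by (simp flip: one_pCons)
  show "0 \<in> R" using sg by (rule add_subgroup_0)
  show "x \<in> R \<Longrightarrow> y \<in> R \<Longrightarrow> x - y \<in> R" using sg by (rule add_subgroup_diff)
  show m: "x \<in> R \<Longrightarrow> y \<in> R \<Longrightarrow> x * y \<in> R" for x y using assms by (auto simp: const_subring_def)
  show "x \<in> R \<Longrightarrow> y \<in> R \<Longrightarrow> x + y \<in> R" using sg by (rule add_subgroup_add)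
  show "x \<in> R \<Longrightarrow> - x \<in> R" using sg by (rule add_subgroup_uminus)
  show "(\<And>i. i \<in> I \<Longrightarrow> f i \<in> R) \<Longrightarrow> sum f I \<in> R" using sg by (rule add_subgroup_sum)
  show "x \<in> R \<Longrightarrow> x ^ n \<in> R" using 1 m by (induction n) auto
qed

lemma const_subring_coeffs:
  assumes R: "const_subring R" and p: "\<forall>i. coeff p i \<in> R" and q: "\<forall>i. coeff q i \<in> R"
  shows "\<forall>i. coeff (p - q) i \<in> R" "\<forall>i. coeff (p + q) i \<in> R" "\<forall>i. coeff (p * q) i \<in> R"
  using p q
  by (auto simp: coeff_mult const_subring_diff[OF R] const_subring_add[OF R]
      intro!: const_subring_sum[OF R] const_subring_mult[OF R])

lemma ring_adjoin_subring:
  assumes R: "const_subring R"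
  shows "const_subring (ring_adjoin R x)" "R \<subseteq> ring_adjoin R x" "x \<in> ring_adjoin R x"
proof -
  have c: "poly [:r:] x \<in> ring_adjoin R x" if "r \<in> R" for r
    unfolding ring_adjoin_def using that const_subring_0[OF R]
    by (intro CollectI exI[of _ "[:r:]"]) (auto simp: coeff_pCons split: nat.split)
  then show sub: "R \<subseteq> ring_adjoin R x" by auto
  have "poly [:0, 1:] x \<in> ring_adjoin R x"
    unfolding ring_adjoin_def using const_subring_0[OF R] const_subring_1[OF R]
    by (intro CollectI exI[of _ "[:0, 1:]"]) (auto simp: coeff_pCons split: nat.split)
  then show "x \<in> ring_adjoin R x" by simp
  show "const_subring (ring_adjoin R x)"
    unfolding const_subring_def
  proof (intro conjI ballI)
    show "range ac_const \<subseteq> ring_adjoin R x" using R sub by (auto simp: const_subring_def)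
    fix y z assume "y \<in> ring_adjoin R x" "z \<in> ring_adjoin R x"
    then obtain p q where p: "y = poly p x" "\<forall>i. coeff p i \<in> R" and q: "z = poly q x" "\<forall>i. coeff q i \<in> R"
      unfolding ring_adjoin_def by blast
    note co = const_subring_coeffs[OF R p(2) q(2)]
    show "y - z \<in> ring_adjoin R x" unfolding ring_adjoin_def
      using co(1) p q by (intro CollectI exI[of _ "p - q"]) auto
    show "y * z \<in> ring_adjoin R x" unfolding ring_adjoin_def
      using co(3) p q by (intro CollectI exI[of _ "p * q"]) auto
  qed
qed

lemma const_subring_consts: "const_subring (range (ac_const :: 'a::field \<Rightarrow> 'a kbar))"
  unfolding const_subring_def
proof (intro conjI ballI order_refl)
  fix x y :: "'a kbar" assume "x \<in> range ac_const" "y \<in> range ac_const"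
  then obtain c d :: 'a where "x = ac_const c" "y = ac_const d" by blast
  then have "x - y = ac_const (c - d)" "x * y = ac_const (c * d)"
    by (simp_all flip: of_A_diff of_A_mult)
  then show "x - y \<in> range ac_const" "x * y \<in> range ac_const" by auto
qed

text \<open>A valuation ring of the whole algebraic closure in which nonzero constants are units.
  Membership stands for a non-negative value until a real valuation has been built.\<close>

locale const_valuation_ring =
  fixes R :: "'a::{field,finite} kbar set"
  assumes subring: "const_subring R"
    and total: "\<And>x. x \<noteq> 0 \<Longrightarrow> x \<in> R \<or> inverse x \<in> R"
begin

lemmas const_mem [simp, intro] = const_subring_const[OF subring]
  and zero_mem [simp, intro] = const_subring_0[OF subring]
  and one_mem [simp, intro] = const_subring_1[OF subring]
  and mult_mem = const_subring_mult[OF subring]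
  and add_mem = const_subring_add[OF subring]
  and uminus_mem = const_subring_uminus[OF subring]
  and sum_mem = const_subring_sum[OF subring]
  and power_mem = const_subring_power[OF subring]

definition unit :: "'a kbar \<Rightarrow> bool" where
  "unit x \<longleftrightarrow> x \<noteq> 0 \<and> x \<in> R \<and> inverse x \<in> R"

lemma unit_1 [simp]: "unit 1"
  by (simp add: unit_def)

lemma unit_mult: "unit x \<Longrightarrow> unit y \<Longrightarrow> unit (x * y)"
  by (auto simp: unit_def intro: mult_mem)

lemma unit_inverse: "unit x \<Longrightarrow> unit (inverse x)"
  by (simp add: unit_def)

lemma unit_divide: "unit x \<Longrightarrow> unit y \<Longrightarrow> unit (x / y)"
  by (simp add: divide_inverse unit_mult unit_inverse)

lemma unit_power: "unit x \<Longrightarrow> unit (x ^ n)"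
  by (induction n) (auto intro: unit_mult)

lemma unit_const: "c \<noteq> 0 \<Longrightarrow> unit (ac_const c)"
proof -
  assume c: "c \<noteq> 0"
  have "ac_const c * ac_const (inverse c) = 1" using c by (simp flip: of_A_mult one_pCons)
  then have "inverse (ac_const c) = ac_const (inverse c)" by (rule inverse_unique)
  then show ?thesis using c by (simp add: unit_def)
qed

lemma unit_factor: "x \<in> R \<Longrightarrow> y \<in> R \<Longrightarrow> unit (x * y) \<Longrightarrow> unit x"
proof -
  assume x: "x \<in> R" and y: "y \<in> R" and u: "unit (x * y)"
  have "inverse x = inverse (x * y) * y" using u by (auto simp: unit_def)
  then show ?thesis using x y u by (auto simp: unit_def simp del: inverse_mult_distrib intro: mult_mem)
qed

text \<open>Valuation rings are local: one of \<open>a\<close>, \<open>b\<close> divides the other,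
  hence also divides the sum.\<close>

lemma unit_add: "a \<in> R \<Longrightarrow> b \<in> R \<Longrightarrow> unit (a + b) \<Longrightarrow> unit a \<or> unit b"
proof (cases "a = 0 \<or> b = 0")
  case False
  assume a: "a \<in> R" "b \<in> R" "unit (a + b)"
  from False total[of "a / b"] consider "a / b \<in> R" | "b / a \<in> R" by auto
  then show ?thesis
  proof cases
    case 1
    have "unit (b * (a / b + 1))" using a False by (simp add: algebra_simps)
    then show ?thesis using unit_factor[of b "a / b + 1"] a 1 by (auto intro: add_mem)
  next
    case 2
    have "unit (a * (1 + b / a))" using a False by (simp add: algebra_simps)
    then show ?thesis using unit_factor[of a "1 + b / a"] a 2 by (auto intro: add_mem)
  qed
qed auto

lemma unit_sum:
  "finite I \<Longrightarrow> (\<And>i. i \<in> I \<Longrightarrow> f i \<in> R) \<Longrightarrow> unit (sum f I) \<Longrightarrow> \<exists>i\<in>I. unit (f i)"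
proof (induction I rule: finite_induct)
  case empty
  then show ?case by (simp add: unit_def)
next
  case (insert i I)
  then show ?case using unit_add[of "f i" "sum f I"] sum_mem[of I f] by auto
qed

lemma power_memD:
  assumes "z ^ m \<in> R" "m > 0"
  shows "z \<in> R"
proof (rule ccontr)
  assume z: "z \<notin> R"
  then have "z \<noteq> 0" by auto
  then have "inverse z \<in> R" using total z by blast
  then have "z ^ m * inverse z ^ (m - 1) \<in> R" by (rule mult_mem[OF assms(1) power_mem])
  moreover have "z ^ m * inverse z ^ (m - 1) = z"
    using assms(2) \<open>z \<noteq> 0\<close> by (cases m) (auto simp: power_inverse)
  ultimately show False using z by simp
qed

text \<open>If \<open>k\<close> lay in \<open>R\<close>, an equation of \<open>s\<close> over
  \<open>k\<close>, divided by its leading coefficient and the last but one power of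
  \<open>s\<close>, would express \<open>s\<close> through powers of 1/s, which is in
  \<open>R\<close>.\<close>

lemma exists_base_nonmember:
  assumes "s \<notin> R"
  shows "\<exists>c. to_ac c \<notin> R"
proof (rule ccontr)
  assume all: "\<not> ?thesis"
  have s: "s \<noteq> 0" "inverse s \<in> R" using assms total[of s] by auto
  obtain p :: "'a poly fract poly" where p: "p \<noteq> 0" "poly (map_poly to_ac p) s = 0"
    by (rule alg_closure_algebraic)
  let ?m = "degree p"
  have sum: "(\<Sum>i\<le>?m. to_ac (coeff p i) * s ^ i) = 0"
    using p(2) by (simp add: poly_altdef coeff_map_poly degree_map_poly)
  have m: "?m > 0"
  proof (rule ccontr)
    assume "\<not> ?m > 0"
    then show False using sum p(1) leading_coeff_0_iff[of p] by simp
  qed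
  have "- s = (\<Sum>i<?m. to_ac (coeff p i / lead_coeff p) * inverse s ^ (?m - 1 - i))"
  proof -
    have "(\<Sum>i\<le>?m. to_ac (coeff p i) * s ^ i) = (\<Sum>i<?m. to_ac (coeff p i) * s ^ i) + to_ac (lead_coeff p) * s ^ ?m"
      by (simp add: lessThan_Suc_atMost[symmetric])
    then have eq: "- (to_ac (lead_coeff p) * s ^ ?m) = (\<Sum>i<?m. to_ac (coeff p i) * s ^ i)"
      using sum by (simp add: add_eq_0_iff2)
    have "- s = - (to_ac (lead_coeff p) * s ^ ?m) / (to_ac (lead_coeff p) * s ^ (?m - 1))"
    proof -
      have "lead_coeff p \<noteq> 0" using p(1) by simp
      moreover have "s ^ ?m = s * s ^ (?m - 1)" using m by (cases ?m) auto
      ultimately show ?thesis using s(1) by simp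
    qed
    also have "\<dots> = (\<Sum>i<?m. to_ac (coeff p i) * s ^ i / (to_ac (lead_coeff p) * s ^ (?m - 1)))"
      unfolding eq by (rule sum_divide_distrib)
    also have "\<dots> = (\<Sum>i<?m. to_ac (coeff p i / lead_coeff p) * inverse s ^ (?m - 1 - i))"
    proof (rule sum.cong[OF refl])
      fix i assume "i \<in> {..<?m}"
      then have "s ^ (?m - 1) = s ^ i * s ^ (?m - 1 - i)" by (simp flip: power_add)
      then show "to_ac (coeff p i) * s ^ i / (to_ac (lead_coeff p) * s ^ (?m - 1)) =
          to_ac (coeff p i / lead_coeff p) * inverse s ^ (?m - 1 - i)"
        using s(1) by (simp add: power_inverse divide_inverse)
    qed
    finally show ?thesis .
  qed
  also have "\<dots> \<in> R" using all s(2) by (intro sum_mem mult_mem power_mem) blast+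
  finally show False using assms uminus_mem[of "- s"] by simp
qed

end

section \<open>The place of k determined by a valuation ring\<close>

lemma fract_valuation:
  fixes f :: "'a::field poly \<Rightarrow> real"
  assumes f: "\<And>a b. a \<noteq> 0 \<Longrightarrow> b \<noteq> 0 \<Longrightarrow> f (a * b) = f a + f b"
  shows "\<exists>v. v 0 = 0 \<and> (\<forall>a b. a \<noteq> 0 \<longrightarrow> b \<noteq> 0 \<longrightarrow> v (Fract a b) = f a - f b) \<and>
    (\<forall>c d. c \<noteq> 0 \<longrightarrow> d \<noteq> 0 \<longrightarrow> v (c * d) = v c + v d)"
proof -
  \<comment> \<open>Each fraction is assigned some value of a representing pair; additivity of
    \<open>f\<close> then shows that every representing pair gives the same value.\<close>
  define Q where "Q c r \<longleftrightarrow> c = 0 \<and> r = 0 \<or>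
      c \<noteq> 0 \<and> (\<exists>a b. c = Fract a b \<and> a \<noteq> 0 \<and> b \<noteq> 0 \<and> r = f a - f b)" for c r
  have "\<exists>r. Q c r" for c
  proof (cases c)
    case (Fract a b)
    show ?thesis
    proof (cases "a = 0")
      case True
      then show ?thesis using Fract by (auto simp: Q_def fract_collapse)
    next
      case False
      moreover have "Fract a b \<noteq> 0" using False Fract by (simp add: Zero_fract_def eq_fract)
      ultimately show ?thesis using Fract unfolding Q_def by blast
    qed
  qed
  then obtain v where Q: "\<And>c. Q c (v c)" by metis
  note v = Q[unfolded Q_def]
  have F: "v (Fract a b) = f a - f b" if "a \<noteq> 0" "b \<noteq> 0" for a b
  proof -
    have "Fract a b \<noteq> 0" using that by (simp add: Zero_fract_def eq_fract)
    then obtain a' b' where "Fract a b = Fract a' b'" "a' \<noteq> 0" "b' \<noteq> 0" "v (Fract a b) = f a' - f b'"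
      using v[of "Fract a b"] by auto
    moreover from this have "a * b' = a' * b" using that by (simp add: eq_fract)
    ultimately show ?thesis using f[of a b'] f[of a' b] that by simp
  qed
  moreover have "v (c * d) = v c + v d" if cd: "c \<noteq> 0" "d \<noteq> 0" for c d
  proof -
    obtain a b where ab: "c = Fract a b" "a \<noteq> 0" "b \<noteq> 0" using v[of c] cd by auto
    obtain a' b' where ab': "d = Fract a' b'" "a' \<noteq> 0" "b' \<noteq> 0" using v[of d] cd by auto
    show ?thesis using ab ab' f by (simp add: F)
  qed
  moreover have "v 0 = 0" using v[of 0] by simp
  ultimately show ?thesis by blast
qed

lemma ord_at_mult_power:
  fixes l :: "'a::field poly"
  assumes "degree l > 0" "\<not> l dvd a'"
  shows "ord_at l (l ^ i * a') = i"
proof -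
  have l: "l \<noteq> 0" using assms by auto
  have "l ^ n dvd l ^ i * a' \<longleftrightarrow> n \<le> i" for n
  proof
    assume d: "l ^ n dvd l ^ i * a'"
    show "n \<le> i"
    proof (rule ccontr)
      assume "\<not> n \<le> i"
      then have "l ^ i * l dvd l ^ n" by (metis le_imp_power_dvd not_less_eq_eq power_Suc2)
      then have "l ^ i * l dvd l ^ i * a'" using d dvd_trans by blast
      then show False using assms(2) l by simp
    qed
  next
    assume "n \<le> i"
    then show "l ^ n dvd l ^ i * a'" by (intro dvd_mult2 le_imp_power_dvd)
  qed
  then have "{n. l ^ n dvd l ^ i * a'} = {..i}" by auto
  then show ?thesis by (simp add: ord_at_def Max_eq_iff)
qed

lemma ord_at_mult:
  fixes l :: "'a::{field,finite} poly"
  assumes l: "irreducible l" and ab: "a \<noteq> 0" "b \<noteq> 0"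
  shows "ord_at l (a * b) = ord_at l a + ord_at l b"
proof -
  note d = irreducible_degree_pos[OF l]
  obtain a' where a': "a = l ^ ord_at l a * a'" "\<not> l dvd a'" using ord_at_decompose[OF d ab(1)] .
  obtain b' where b': "b = l ^ ord_at l b * b'" "\<not> l dvd b'" using ord_at_decompose[OF d ab(2)] .
  have "\<not> l dvd a' * b'"
    using a' b' field_poly_irreducible_imp_prime[OF l] prime_elem_dvd_multD by blast
  moreover have "a * b = l ^ (ord_at l a + ord_at l b) * (a' * b')"
    by (subst a'(1), subst b'(1)) (simp add: power_add mult_ac)
  ultimately show ?thesis using ord_at_mult_power[OF d] by simp
qed

context const_valuation_ring
begin

text \<open>Here 1/T is a non-unit of \<open>R\<close>, and a polynomial divided by T to its degree
  is its leading coefficient plus a non-unit, hence a unit. Membership is therefore decided by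
  degrees alone.\<close>

lemma base_valuation_infinite:
  assumes T: "of_A [:0, 1:] \<notin> R"
  obtains v where "v \<in> base_places" "\<And>c d. c \<noteq> 0 \<Longrightarrow> d \<noteq> 0 \<Longrightarrow> v (c * d) = v c + v d"
    "\<And>c. c \<noteq> 0 \<Longrightarrow> 0 \<le> v c \<longleftrightarrow> to_ac c \<in> R"
proof -
  have add: "- real (degree (a * b)) = - real (degree a) + - real (degree b)" if "a \<noteq> 0" "b \<noteq> 0"
    for a b :: "'a poly" using that by (simp add: degree_mult_eq)
  obtain v :: "'a poly fract \<Rightarrow> real" where v: "v 0 = 0"
    "\<forall>a b. a \<noteq> 0 \<longrightarrow> b \<noteq> 0 \<longrightarrow> v (Fract a b) = - real (degree a) - - real (degree b)"
    "\<forall>c d. c \<noteq> 0 \<longrightarrow> d \<noteq> 0 \<longrightarrow> v (c * d) = v c + v d"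
    using fract_valuation[of "\<lambda>a. - real (degree a)", OF add] by blast
  let ?T = "of_A [:0, 1:] :: 'a kbar"
  have T0: "?T \<noteq> 0" by simp
  have iT: "inverse ?T \<in> R" "\<not> unit (inverse ?T)" using T total[OF T0] by (auto simp: unit_def)
  have unit: "unit (of_A a / ?T ^ degree a)" if a: "a \<noteq> 0" for a
  proof -
    let ?n = "degree a"
    have eval: "of_A a = (\<Sum>i\<le>?n. ac_const (coeff a i) * ?T ^ i)"
    proof -
      have "a = (\<Sum>i\<le>?n. [:coeff a i:] * [:0, 1:] ^ i)"
        by (subst poly_as_sum_of_monoms[of a, symmetric]) (simp add: monom_altdef)
      then have "of_A a = of_A (\<Sum>i\<le>?n. [:coeff a i:] * [:0, 1:] ^ i)" by simp
      then show ?thesis by (simp only: of_A_sum of_A_mult of_A_power)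
    qed
    have "of_A a / ?T ^ ?n = (\<Sum>i\<le>?n. ac_const (coeff a i) * inverse ?T ^ (?n - i))"
      unfolding eval sum_divide_distrib
    proof (rule sum.cong[OF refl])
      fix i assume "i \<in> {..?n}"
      then have "?T ^ ?n = ?T ^ i * ?T ^ (?n - i)" by (simp flip: power_add)
      then show "ac_const (coeff a i) * ?T ^ i / ?T ^ ?n = ac_const (coeff a i) * inverse ?T ^ (?n - i)"
        using T0 by (simp add: power_inverse divide_inverse)
    qed
    also have "\<dots> = (\<Sum>i<?n. ac_const (coeff a i) * inverse ?T ^ (?n - i)) + ac_const (lead_coeff a)"
      by (simp add: lessThan_Suc_atMost[symmetric])
    finally have eq: "of_A a / ?T ^ ?n + - (\<Sum>i<?n. ac_const (coeff a i) * inverse ?T ^ (?n - i)) = ac_const (lead_coeff a)"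
      by simp
    have sR: "(\<Sum>i<?n. ac_const (coeff a i) * inverse ?T ^ (?n - i)) \<in> R"
      using iT by (intro sum_mem mult_mem power_mem) auto
    have aR: "of_A a / ?T ^ ?n \<in> R"
      using add_mem[OF const_mem[of "lead_coeff a"] sR] eq by (simp add: algebra_simps)
    have "\<not> unit (- (\<Sum>i<?n. ac_const (coeff a i) * inverse ?T ^ (?n - i)))"
    proof
      assume "unit (- (\<Sum>i<?n. ac_const (coeff a i) * inverse ?T ^ (?n - i)))"
      then have "unit (\<Sum>i<?n. - (ac_const (coeff a i) * inverse ?T ^ (?n - i)))" by (simp add: sum_negf)
      then obtain i where i: "i < ?n" "unit (- (ac_const (coeff a i) * inverse ?T ^ (?n - i)))"
        using unit_sum[of "{..<?n}" "\<lambda>i. - (ac_const (coeff a i) * inverse ?T ^ (?n - i))"] iT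
        by (auto intro: uminus_mem mult_mem power_mem)
      let ?r = "- ac_const (coeff a i) * inverse ?T ^ (?n - i - 1)"
      have "- (ac_const (coeff a i) * inverse ?T ^ (?n - i)) = inverse ?T * ?r"
        using i(1) by (cases "?n - i") auto
      with i(2) have "unit (inverse ?T * ?r)" by (simp only:)
      moreover have "?r \<in> R" using iT(1) by (intro mult_mem uminus_mem power_mem const_mem)
      ultimately have "unit (inverse ?T)" using unit_factor[OF iT(1)] by blast
      then show False using iT by simp
    qed
    then show ?thesis
      using unit_add[OF aR uminus_mem[OF sR]] unit_const[of "lead_coeff a"] a unfolding eq by simp
  qed
  show ?thesis
  proof (rule that[of v])
    show "v \<in> base_places" unfolding base_places_def using v by auto
    show "v (c * d) = v c + v d" if "c \<noteq> 0" "d \<noteq> 0" for c d using v(3) that by blast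
    fix c :: "'a poly fract" assume c: "c \<noteq> 0"
    obtain a b where ab: "c = Fract a b" "b \<noteq> 0" by (cases c)
    then have a: "a \<noteq> 0" using c by (auto simp: fract_collapse)
    define u where "u = (of_A a / ?T ^ degree a) / (of_A b / ?T ^ degree b)"
    have u: "unit u" unfolding u_def by (rule unit_divide[OF unit[OF a] unit[OF ab(2)]])
    have c_eq: "to_ac c = u * (?T ^ degree a / ?T ^ degree b)"
      using ab T0 by (simp add: to_ac_Fract u_def)
    show "0 \<le> v c \<longleftrightarrow> to_ac c \<in> R"
    proof
      assume "0 \<le> v c"
      then have "degree a \<le> degree b" using v(2) a ab by simp
      then have "?T ^ degree b = ?T ^ degree a * ?T ^ (degree b - degree a)" by (simp flip: power_add)
      then have "?T ^ degree a / ?T ^ degree b = inverse ?T ^ (degree b - degree a)"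
        using T0 by (simp add: power_inverse divide_inverse)
      then show "to_ac c \<in> R" using c_eq u iT mult_mem[of u, OF _ power_mem[OF iT(1)]] by (simp add: unit_def)
    next
      assume cR: "to_ac c \<in> R"
      show "0 \<le> v c"
      proof (rule ccontr)
        assume "\<not> 0 \<le> v c"
        then have d: "degree b < degree a" using v(2) a ab by simp
        then have "?T ^ degree a = ?T ^ degree b * ?T ^ (degree a - degree b)" by (simp flip: power_add)
        then have "?T ^ degree a / ?T ^ degree b = ?T ^ (degree a - degree b)" using T0 by simp
        moreover have "inverse u * to_ac c = ?T ^ degree a / ?T ^ degree b"
          using c_eq u by (simp add: unit_def)
        ultimately have "?T ^ (degree a - degree b) \<in> R"
          using mult_mem[of "inverse u" "to_ac c"] u cR by (simp add: unit_def)
        then show False using power_memD[of ?T "degree a - degree b"] d T by simp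
      qed
    qed
  qed
qed

text \<open>Now A lies in \<open>R\<close>. Some polynomial is not invertible in \<open>R\<close>;
  one of least degree, made monic, is irreducible because its proper factors are invertible. A
  polynomial prime to it is a unit, by inversion modulo \<open>l\<close> and locality of
  \<open>R\<close>.\<close>

lemma base_valuation_finite:
  assumes T: "of_A [:0, 1:] \<in> R" and proper: "s \<notin> R"
  obtains v where "v \<in> base_places" "\<And>c d. c \<noteq> 0 \<Longrightarrow> d \<noteq> 0 \<Longrightarrow> v (c * d) = v c + v d"
    "\<And>c. c \<noteq> 0 \<Longrightarrow> 0 \<le> v c \<longleftrightarrow> to_ac c \<in> R"
proof -
  have A: "of_A a \<in> R" for a
  proof -
    have "a = (\<Sum>i\<le>degree a. [:coeff a i:] * [:0, 1:] ^ i)"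
      by (subst poly_as_sum_of_monoms[of a, symmetric]) (simp add: monom_altdef)
    then have "of_A a = of_A (\<Sum>i\<le>degree a. [:coeff a i:] * [:0, 1:] ^ i)" by simp
    then have "of_A a = (\<Sum>i\<le>degree a. ac_const (coeff a i) * of_A [:0, 1:] ^ i)"
      by (simp only: of_A_sum of_A_mult of_A_power)
    then show ?thesis using T by (auto intro!: sum_mem mult_mem power_mem)
  qed
  define N where "N p \<longleftrightarrow> p \<noteq> 0 \<and> inverse (of_A p) \<notin> R" for p :: "'a poly"
  have "\<exists>p. N p"
  proof -
    obtain c where c: "to_ac c \<notin> R" using exists_base_nonmember[OF proper] by blast
    obtain a b where ab: "c = Fract a b" "b \<noteq> 0" by (cases c)
    have "to_ac c = of_A a * inverse (of_A b)" using ab by (simp add: to_ac_Fract divide_inverse)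
    then have "N b" using c ab(2) A[of a] mult_mem by (auto simp: N_def)
    then show ?thesis ..
  qed
  then obtain l0 where l0: "N l0" "\<And>p. N p \<Longrightarrow> degree l0 \<le> degree p"
    using exists_least_iff[of "\<lambda>k. \<exists>p. N p \<and> degree p = k"] by (metis not_less)
  define l where "l = smult (inverse (lead_coeff l0)) l0"
  have lc: "lead_coeff l0 \<noteq> 0" using l0 by (simp add: N_def)
  have l_monic: "lead_coeff l = 1" and degl: "degree l = degree l0" using lc by (auto simp: l_def)
  have Nl: "N l"
  proof -
    have "of_A l = ac_const (inverse (lead_coeff l0)) * of_A l0" by (simp add: l_def flip: of_A_mult)
    then have "inverse (of_A l0) = ac_const (inverse (lead_coeff l0)) * inverse (of_A l)"
      using lc l0(1) by (simp add: N_def field_simps)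
    then show ?thesis using l0(1) lc mult_mem[of "ac_const (inverse (lead_coeff l0))" "inverse (of_A l)"]
      by (auto simp: N_def l_def)
  qed
  have least: "degree l \<le> degree p" if "N p" for p using l0(2)[OF that] degl by simp
  have irr: "irreducible l"
  proof (rule irreducibleI)
    show "l \<noteq> 0" using Nl by (simp add: N_def)
    show "\<not> l dvd 1"
    proof
      assume "l dvd 1"
      then obtain c where "l = [:c:]" by (auto simp: is_unit_iff_degree[OF \<open>l \<noteq> 0\<close>] elim: degree_eq_zeroE)
      then show False using Nl unit_const[of c] by (auto simp: N_def unit_def)
    qed
    fix a b assume ab: "l = a * b"
    show "a dvd 1 \<or> b dvd 1"
    proof (rule ccontr)
      assume *: "\<not> ?thesis"
      have ab0: "a \<noteq> 0" "b \<noteq> 0" using ab \<open>l \<noteq> 0\<close> by auto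
      then have "degree a > 0" "degree b > 0" using * by (auto simp: is_unit_iff_degree)
      then have "degree a < degree l" "degree b < degree l" using ab ab0 by (auto simp: degree_mult_eq)
      then have "\<not> N a" "\<not> N b" using least[of a] least[of b] by auto
      then have "inverse (of_A a) * inverse (of_A b) \<in> R" using ab0 by (auto simp: N_def intro: mult_mem)
      then show False using Nl ab by (simp add: N_def)
    qed
  qed
  note degpos = irreducible_degree_pos[OF irr]
  let ?l = "of_A l"
  have l: "?l \<noteq> 0" "?l \<in> R" "inverse ?l \<notin> R" using Nl A by (auto simp: N_def)
  have unit: "unit (of_A a)" if la: "\<not> l dvd a" for a
  proof -
    obtain u z where uz: "u * a = 1 + l * z" using inverse_mod_irreducible[OF irr la] .
    have "of_A (u * a) + of_A (l * - z) = of_A (u * a + l * - z)" by (simp only: of_A_add)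
    also have "u * a + l * - z = 1" using uz by simp
    finally have "unit (of_A (u * a)) \<or> unit (of_A (l * - z))"
      using unit_add[OF A A, of "u * a" "l * - z"] by simp
    moreover have "\<not> unit (of_A (l * - z))"
    proof
      assume "unit (of_A (l * - z))"
      then have "unit ?l" using unit_factor[OF l(2) A[of "- z"]] by (simp only: of_A_mult)
      then show False using l by (simp add: unit_def)
    qed
    ultimately show ?thesis using unit_factor[of "of_A a" "of_A u"] A by (simp add: mult.commute)
  qed
  have add: "real (degree l) * real (ord_at l (a * b)) = real (degree l) * real (ord_at l a) + real (degree l) * real (ord_at l b)"
    if "a \<noteq> 0" "b \<noteq> 0" for a b using that by (simp add: ord_at_mult[OF irr] algebra_simps)
  obtain v :: "'a poly fract \<Rightarrow> real" where v: "v 0 = 0"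
    "\<forall>a b. a \<noteq> 0 \<longrightarrow> b \<noteq> 0 \<longrightarrow>
       v (Fract a b) = real (degree l) * real (ord_at l a) - real (degree l) * real (ord_at l b)"
    "\<forall>c d. c \<noteq> 0 \<longrightarrow> d \<noteq> 0 \<longrightarrow> v (c * d) = v c + v d"
    using fract_valuation[of "\<lambda>a. real (degree l) * real (ord_at l a)", OF add] by blast
  show ?thesis
  proof (rule that[of v])
    show "v \<in> base_places" unfolding base_places_def using v l_monic irr by (auto simp: right_diff_distrib)
    show "v (c * d) = v c + v d" if "c \<noteq> 0" "d \<noteq> 0" for c d using v(3) that by blast
    fix c :: "'a poly fract" assume c: "c \<noteq> 0"
    obtain a b where ab: "c = Fract a b" "b \<noteq> 0" by (cases c)
    then have a: "a \<noteq> 0" using c by (auto simp: fract_collapse)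
    let ?i = "ord_at l a" and ?j = "ord_at l b"
    obtain a' where a': "a = l ^ ?i * a'" "\<not> l dvd a'" using ord_at_decompose[OF degpos a] .
    obtain b' where b': "b = l ^ ?j * b'" "\<not> l dvd b'" using ord_at_decompose[OF degpos ab(2)] .
    define u where "u = of_A a' / of_A b'"
    have u: "unit u" unfolding u_def by (rule unit_divide[OF unit[OF a'(2)] unit[OF b'(2)]])
    have c_eq: "to_ac c = u * (?l ^ ?i / ?l ^ ?j)"
    proof -
      have "of_A a = ?l ^ ?i * of_A a'" "of_A b = ?l ^ ?j * of_A b'"
        using a'(1) b'(1) by (metis of_A_mult of_A_power)+
      then show ?thesis using ab by (simp add: to_ac_Fract u_def mult.commute)
    qed
    have vc: "0 \<le> v c \<longleftrightarrow> ?j \<le> ?i"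
      using v(2) a ab degpos by simp
    show "0 \<le> v c \<longleftrightarrow> to_ac c \<in> R"
    proof
      assume "0 \<le> v c"
      then have "?l ^ ?i = ?l ^ ?j * ?l ^ (?i - ?j)" using vc by (simp flip: power_add)
      then have "?l ^ ?i / ?l ^ ?j = ?l ^ (?i - ?j)" using l by simp
      then show "to_ac c \<in> R" using c_eq u mult_mem[of u, OF _ power_mem[OF l(2)]] by (simp add: unit_def)
    next
      assume cR: "to_ac c \<in> R"
      show "0 \<le> v c"
      proof (rule ccontr)
        assume "\<not> 0 \<le> v c"
        then have d: "?i < ?j" using vc by simp
        then have "?l ^ ?j = ?l ^ ?i * ?l ^ (?j - ?i)" by (simp flip: power_add)
        then have "?l ^ ?i / ?l ^ ?j = inverse ?l ^ (?j - ?i)" using l by (simp add: power_inverse divide_inverse)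
        moreover have "inverse u * to_ac c = ?l ^ ?i / ?l ^ ?j"
          using c_eq u by (simp add: unit_def)
        ultimately have "inverse ?l ^ (?j - ?i) \<in> R"
          using mult_mem[of "inverse u" "to_ac c"] u cR by (simp add: unit_def)
        then show False using power_memD[of "inverse ?l" "?j - ?i"] d l by simp
      qed
    qed
  qed
qed

end

section \<open>Extension of the valuation to the algebraic closure\<close>

context const_valuation_ring
begin

lemma base_valuation:
  assumes "s \<notin> R"
  obtains v where "v \<in> base_places" "\<And>c d. c \<noteq> 0 \<Longrightarrow> d \<noteq> 0 \<Longrightarrow> v (c * d) = v c + v d"
    "\<And>c. c \<noteq> 0 \<Longrightarrow> 0 \<le> v c \<longleftrightarrow> to_ac c \<in> R"
  using base_valuation_finite[OF _ assms] base_valuation_infinite by metis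

lemma exists_maximal_quotient:
  assumes "finite I" "I \<noteq> {}" "\<And>i. i \<in> I \<Longrightarrow> f i \<noteq> 0"
  shows "\<exists>j\<in>I. \<forall>i\<in>I. f i / f j \<in> R"
  using assms
proof (induction I rule: finite_ne_induct)
  case (singleton i)
  then show ?case by simp
next
  case (insert k I)
  then obtain j where j: "j \<in> I" "\<And>i. i \<in> I \<Longrightarrow> f i / f j \<in> R" by blast
  have nz: "f k \<noteq> 0" "f j \<noteq> 0" using insert.prems j by auto
  from total[of "f k / f j"] nz consider "f k / f j \<in> R" | "f j / f k \<in> R" by auto
  then show ?case
  proof cases
    case 1
    then show ?thesis using j by (intro bexI[of _ j]) auto
  next
    case 2
    have "f i / f k \<in> R" if "i \<in> I" for i
      using mult_mem[OF j(2)[OF that] 2] nz by simp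
    then show ?thesis using nz by (intro bexI[of _ k]) auto
  qed
qed

text \<open>Divide an equation of \<open>z\<close> over \<open>k\<close> by a term that all others
  are multiples of in \<open>R\<close>. The remaining quotients add up to -1, so one of them is a
  unit, and it is a power of \<open>z\<close> or its inverse times an element of \<open>k\<close>.
  This makes every value a rational multiple of a value of \<open>k\<close>.\<close>

lemma commensurable:
  assumes z: "z \<noteq> 0"
  shows "\<exists>m c. 0 < m \<and> c \<noteq> 0 \<and> unit (z ^ m / to_ac c)"
proof -
  obtain p :: "'a poly fract poly" where p: "p \<noteq> 0" "poly (map_poly to_ac p) z = 0"
    by (rule alg_closure_algebraic)
  let ?f = "\<lambda>i. to_ac (coeff p i) * z ^ i"
  define I where "I = {i. i \<le> degree p \<and> coeff p i \<noteq> 0}"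
  have "(\<Sum>i\<le>degree p. ?f i) = 0"
    using p(2) by (simp add: poly_altdef coeff_map_poly degree_map_poly)
  moreover have "(\<Sum>i\<le>degree p. ?f i) = (\<Sum>i\<in>I. ?f i)"
    by (rule sum.mono_neutral_right) (auto simp: I_def)
  ultimately have sum: "(\<Sum>i\<in>I. ?f i) = 0" by simp
  have I: "finite I" "I \<noteq> {}" using p(1) by (auto simp: I_def intro!: exI[of _ "degree p"])
  have nz: "?f i \<noteq> 0" if "i \<in> I" for i using that z by (simp add: I_def)
  obtain j where j: "j \<in> I" "\<And>i. i \<in> I \<Longrightarrow> ?f i / ?f j \<in> R"
    using exists_maximal_quotient[of I ?f] I nz by blast
  have "(\<Sum>i\<in>I. ?f i / ?f j) = 0" using sum by (simp flip: sum_divide_distrib)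
  then have "1 + (\<Sum>i\<in>I - {j}. ?f i / ?f j) = 0"
    using I j nz[OF j(1)] z by (simp add: sum.remove)
  then have "(\<Sum>i\<in>I - {j}. ?f i / ?f j) = - 1" by (simp only: add_eq_0_iff)
  then have "(\<Sum>i\<in>I - {j}. - (?f i / ?f j)) = 1" unfolding sum_negf by simp
  then have "\<exists>i\<in>I - {j}. unit (- (?f i / ?f j))"
    using I j(2) by (intro unit_sum) (auto intro: uminus_mem)
  then obtain i where i: "i \<in> I" "i \<noteq> j" "unit (- (?f i / ?f j))" by blast
  have u: "unit (?f i / ?f j)"
    using unit_factor[of "?f i / ?f j" "- 1"] i j(2)[OF i(1)] uminus_mem[of 1] by simp
  have c: "coeff p i \<noteq> 0" "coeff p j \<noteq> 0" using i j by (auto simp: I_def)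
  show ?thesis
  proof (cases "j < i")
    case True
    then have "z ^ i = z ^ j * z ^ (i - j)" by (simp flip: power_add)
    then have "?f i / ?f j = z ^ (i - j) / to_ac (coeff p j / coeff p i)" using z c by simp
    then show ?thesis using u True c by (intro exI[of _ "i - j"] exI[of _ "coeff p j / coeff p i"]) simp
  next
    case False
    then have "z ^ j = z ^ i * z ^ (j - i)" by (simp flip: power_add)
    then have "inverse (?f i / ?f j) = z ^ (j - i) / to_ac (coeff p i / coeff p j)" using z c by simp
    then show ?thesis using unit_inverse[OF u] False i(2) c
      by (intro exI[of _ "j - i"] exI[of _ "coeff p i / coeff p j"]) simp
  qed
qed

lemma exists_valuation:
  assumes v: "\<And>c d. c \<noteq> 0 \<Longrightarrow> d \<noteq> 0 \<Longrightarrow> v (c * d) = v c + v d"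
    and nonneg: "\<And>c. c \<noteq> 0 \<Longrightarrow> 0 \<le> v c \<longleftrightarrow> to_ac c \<in> R"
  obtains w :: "'a kbar \<Rightarrow> real" where
    "\<And>x y. x \<noteq> 0 \<Longrightarrow> y \<noteq> 0 \<Longrightarrow> w (x * y) = w x + w y"
    "\<And>x. x \<noteq> 0 \<Longrightarrow> 0 \<le> w x \<longleftrightarrow> x \<in> R" "\<And>c. c \<noteq> 0 \<Longrightarrow> w (to_ac c) = v c"
proof -
  have v1: "v 1 = 0" using v[of 1 1] by simp
  have v_inv: "v (inverse c) = - v c" if "c \<noteq> 0" for c using v[of c "inverse c"] that v1 by simp
  have v_pow: "v (c ^ n) = n * v c" if "c \<noteq> 0" for c n
    using that by (induction n) (auto simp: v v1 algebra_simps)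
  have v_unit: "v c = 0" if "c \<noteq> 0" "unit (to_ac c)" for c
    using nonneg[of c] nonneg[of "inverse c"] v_inv that by (auto simp: unit_def)
  \<comment> \<open>The only possible value of \<open>z\<close>, provided it does not depend on
    \<open>m\<close> and \<open>c\<close>; this is shown in \<open>w_eq\<close> by comparing common
    powers.\<close>
  define w where "w z = (SOME r. \<exists>m c. 0 < m \<and> c \<noteq> 0 \<and> unit (z ^ m / to_ac c) \<and> r = v c / real m)" for z
  have w_eq: "w z = v c / real m" if "z \<noteq> 0" "0 < m" "c \<noteq> 0" "unit (z ^ m / to_ac c)" for z m c
  proof -
    have "\<exists>m c. 0 < m \<and> c \<noteq> 0 \<and> unit (z ^ m / to_ac c) \<and> w z = v c / real m"
      unfolding w_def by (rule someI_ex) (use that in blast)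
    then obtain m' c' where w: "0 < m'" "c' \<noteq> 0" "unit (z ^ m' / to_ac c')" "w z = v c' / real m'" by blast
    have "unit ((z ^ m / to_ac c) ^ m' / (z ^ m' / to_ac c') ^ m)"
      using that w by (intro unit_divide[of "_ ^ _" "_ ^ _"] unit_power) auto
    moreover have "(z ^ m / to_ac c) ^ m' / (z ^ m' / to_ac c') ^ m = to_ac (c' ^ m * inverse (c ^ m'))"
    proof -
      have "(z ^ m / to_ac c) ^ m' = z ^ (m * m') / to_ac c ^ m'" by (simp add: power_divide power_mult)
      moreover have "(z ^ m' / to_ac c') ^ m = z ^ (m * m') / to_ac c' ^ m"
        by (simp add: power_divide flip: power_mult) (simp add: mult.commute)
      ultimately show ?thesis using that by (simp add: divide_inverse)
    qed
    ultimately have "v (c' ^ m * inverse (c ^ m')) = 0" using that w by (intro v_unit) auto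
    then have "real m * v c' = real m' * v c" using that w by (simp add: v v_inv v_pow)
    then have "v c' / real m' = v c / real m" using w(1) that(2) by (simp add: frac_eq_eq mult.commute)
    then show ?thesis using w(4) by simp
  qed
  have mult: "w (x * y) = w x + w y" if xy: "x \<noteq> 0" "y \<noteq> 0" for x y
  proof -
    obtain m c where x: "0 < m" "c \<noteq> 0" "unit (x ^ m / to_ac c)" using commensurable[OF xy(1)] by blast
    obtain m' c' where y: "0 < m'" "c' \<noteq> 0" "unit (y ^ m' / to_ac c')" using commensurable[OF xy(2)] by blast
    have "unit ((x ^ m / to_ac c) ^ m' * (y ^ m' / to_ac c') ^ m)"
      by (rule unit_mult[OF unit_power[OF x(3)] unit_power[OF y(3)]])
    also have "(x ^ m / to_ac c) ^ m' * (y ^ m' / to_ac c') ^ m = (x * y) ^ (m * m') / to_ac (c ^ m' * c' ^ m)"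
      by (simp add: power_divide power_mult[symmetric] power_mult_distrib mult.commute)
    finally have "w (x * y) = v (c ^ m' * c' ^ m) / real (m * m')" using xy x y by (intro w_eq) auto
    also have "v (c ^ m' * c' ^ m) = real m' * v c + real m * v c'" using x y by (simp add: v v_pow)
    also have "(real m' * v c + real m * v c') / real (m * m') = v c / real m + v c' / real m'"
      using x(1) y(1) by (simp add: add_divide_distrib)
    also have "\<dots> = w x + w y" using w_eq[OF xy(1) x] w_eq[OF xy(2) y] by simp
    finally show ?thesis .
  qed
  have pos: "0 \<le> w x \<longleftrightarrow> x \<in> R" if x: "x \<noteq> 0" for x
  proof -
    obtain m c where c: "0 < m" "c \<noteq> 0" "unit (x ^ m / to_ac c)" using commensurable[OF x] by blast
    have "0 \<le> w x \<longleftrightarrow> to_ac c \<in> R" using w_eq[OF x c] c nonneg[OF c(2)] by (simp add: zero_le_divide_iff)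
    also have "\<dots> \<longleftrightarrow> x ^ m \<in> R"
    proof
      assume "to_ac c \<in> R"
      then have "(x ^ m / to_ac c) * to_ac c \<in> R" using c by (intro mult_mem) (auto simp: unit_def)
      then show "x ^ m \<in> R" using c by simp
    next
      assume "x ^ m \<in> R"
      then have "inverse (x ^ m / to_ac c) * x ^ m \<in> R" using c unfolding unit_def by (blast intro: mult_mem)
      then show "to_ac c \<in> R" using x c by simp
    qed
    also have "\<dots> \<longleftrightarrow> x \<in> R" using power_memD[of x m] power_mem[of x m] c by blast
    finally show ?thesis .
  qed
  have base: "w (to_ac c) = v c" if "c \<noteq> 0" for c
    using w_eq[of "to_ac c" 1 c] that by simp
  show ?thesis using that[of w] mult pos base by blast
qed

lemma exists_place:
  assumes K: "intermediate_field K" and s: "s \<in> K" "s \<notin> R"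
  shows "\<exists>w\<in>places K. w s < 0"
proof -
  obtain v where v: "v \<in> base_places" "\<And>c d. c \<noteq> 0 \<Longrightarrow> d \<noteq> 0 \<Longrightarrow> v (c * d) = v c + v d"
    "\<And>c. c \<noteq> 0 \<Longrightarrow> 0 \<le> v c \<longleftrightarrow> to_ac c \<in> R" using base_valuation[OF s(2)] by blast
  obtain w where w: "\<And>x y. x \<noteq> 0 \<Longrightarrow> y \<noteq> 0 \<Longrightarrow> w (x * y) = w x + w y"
    "\<And>x. x \<noteq> 0 \<Longrightarrow> 0 \<le> w x \<longleftrightarrow> x \<in> R" "\<And>c. c \<noteq> 0 \<Longrightarrow> w (to_ac c) = v c"
    by (rule exists_valuation[OF v(2,3)]) blast+
  have add: "min (w x) (w y) \<le> w (x + y)" if xy: "x \<noteq> 0" "y \<noteq> 0" "x + y \<noteq> 0" for x y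
  proof -
    have *: "w x \<le> w (x + y)" if "x \<noteq> 0" "y \<noteq> 0" "x + y \<noteq> 0" "w x \<le> w y" for x y
    proof -
      have "w y = w x + w (y / x)" using w(1)[of x "y / x"] that by simp
      then have "y / x \<in> R" using w(2)[of "y / x"] that by simp
      then have "1 + y / x \<in> R" by (intro add_mem) auto
      moreover have eq: "x + y = x * (1 + y / x)" using that by (simp add: field_simps)
      ultimately have "0 \<le> w (1 + y / x)" using w(2)[of "1 + y / x"] that by auto
      moreover have "w (x + y) = w x + w (1 + y / x)" using w(1)[of x "1 + y / x"] that eq by auto
      ultimately show ?thesis by simp
    qed
    show ?thesis using *[of x y] *[of y x] xy by (cases "w x \<le> w y") (auto simp: add.commute)
  qed
  \<comment> \<open>Restriction to K with the dummy 0 elsewhere, the form that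
    \<open>valuation_on\<close> prescribes.\<close>
  define u where "u x = (if x \<in> K - {0} then w x else 0)" for x
  have K': "x * y \<in> K" "x + y \<in> K" if "x \<in> K" "y \<in> K" for x y
  proof -
    have "0 \<in> K" using K unfolding intermediate_field_def by (metis range_subsetD to_ac_0)
    then have sg: "add_subgroup K" using K by (auto simp: intermediate_field_def add_subgroup_def)
    show "x + y \<in> K" using add_subgroup_add[OF sg] that by blast
    show "x * y \<in> K" using K that by (auto simp: intermediate_field_def)
  qed
  have "valuation_on K u"
    unfolding valuation_on_def u_def using w(1) add K' by auto
  moreover have "u (to_ac c) = v c" for c
  proof (cases "c = 0")
    case True
    then show ?thesis using v(1) by (simp add: u_def base_places_def)
  next
    case False
    then show ?thesis using K w(3) by (auto simp: u_def intermediate_field_def)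
  qed
  ultimately have "u \<in> places K" using v(1) by (auto simp: places_def)
  moreover have "u s < 0"
  proof -
    have "s \<noteq> 0" using s by auto
    then show ?thesis using w(2)[of s] s by (simp add: u_def)
  qed
  ultimately show ?thesis by blast
qed

end

section \<open>Subrings maximal without a given element\<close>

lemma exists_maximal_subring:
  assumes "const_subring R0" "s \<notin> R0"
  obtains R where "const_subring R" "R0 \<subseteq> R" "s \<notin> R"
    "\<And>R'. const_subring R' \<Longrightarrow> R \<subseteq> R' \<Longrightarrow> s \<notin> R' \<Longrightarrow> R' = R"
proof -
  define F where "F = {R. const_subring R \<and> R0 \<subseteq> R \<and> s \<notin> R}"
  have "\<exists>M\<in>F. \<forall>X'\<in>F. M \<subseteq> X' \<longrightarrow> X' = M"
  proof (rule subset_Zorn_nonempty)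
    show "F \<noteq> {}" using assms by (auto simp: F_def)
    fix C assume C: "C \<noteq> {}" "subset.chain F C"
    have CF: "R \<in> F" if "R \<in> C" for R using C(2) that by (auto simp: subset_chain_def)
    have lin: "R \<subseteq> R' \<or> R' \<subseteq> R" if "R \<in> C" "R' \<in> C" for R R'
      using C(2) that by (auto simp: subset_chain_def)
    obtain R1 where R1: "R1 \<in> C" using C(1) by blast
    have "const_subring (\<Union>C)"
      unfolding const_subring_def
    proof (intro conjI ballI)
      have "range ac_const \<subseteq> R1" using CF[OF R1] by (simp add: F_def const_subring_def)
      then show "range ac_const \<subseteq> \<Union>C" using R1 by blast
      fix x y assume "x \<in> \<Union>C" "y \<in> \<Union>C"
      then obtain Rx Ry where "Rx \<in> C" "x \<in> Rx" "Ry \<in> C" "y \<in> Ry" by blast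
      then obtain R where R: "R \<in> C" "x \<in> R" "y \<in> R" using lin by blast
      then have "x - y \<in> R" "x * y \<in> R" using CF[OF R(1)] by (auto simp: F_def const_subring_def)
      then show "x - y \<in> \<Union>C" "x * y \<in> \<Union>C" using R by auto
    qed
    moreover have "R0 \<subseteq> \<Union>C" using CF[OF R1] R1 by (auto simp: F_def)
    moreover have "s \<notin> \<Union>C" using CF by (auto simp: F_def)
    ultimately show "\<Union>C \<in> F" by (simp add: F_def)
  qed
  then obtain R where "R \<in> F" "\<And>R'. R' \<in> F \<Longrightarrow> R \<subseteq> R' \<Longrightarrow> R' = R" by blast
  then show ?thesis using that[of R] unfolding F_def by blast
qed

text \<open>The argument of Chevalley's extension theorem. If neither \<open>x\<close> nor 1/x were
  in \<open>R\<close>, adjoining either one would by maximality produce \<open>s\<close>; two such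
  expressions of \<open>s\<close> can be played against each other to lower the degree of a shortest
  one.\<close>

lemma maximal_subring_valuation_ring:
  fixes R :: "'a::{field,finite} kbar set"
  assumes R: "const_subring R" and s: "s \<noteq> 0" "s \<notin> R" "inverse s \<in> R"
    and max: "\<And>R'. const_subring R' \<Longrightarrow> R \<subseteq> R' \<Longrightarrow> s \<notin> R' \<Longrightarrow> R' = R"
  shows "const_valuation_ring R"
proof -
  note const_subring_0[OF R, simp] const_subring_1[OF R, simp]
  have adjoin: "\<exists>p. (\<forall>i. coeff p i \<in> R) \<and> s = poly p x" if "x \<notin> R" for x
  proof -
    have "s \<in> ring_adjoin R x"
      using max[OF ring_adjoin_subring(1,2)[OF R], of x] ring_adjoin_subring(3)[OF R, of x] that by blast
    then show ?thesis unfolding ring_adjoin_def by blast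
  qed
  \<comment> \<open>That is, 1/s lies in the Jacobson radical. Were 1 - a/s not invertible in
    \<open>R\<close>, then \<open>s\<close> would be a polynomial in its inverse; clearing
    denominators puts \<open>s\<close> in \<open>R\<close>, since powers of 1 - a/s again have the
    form 1 - b/s.\<close>
  have unit: "inverse (1 - inverse s * a) \<in> R" "1 - inverse s * a \<noteq> 0" if a: "a \<in> R" for a
  proof -
    let ?u = "1 - inverse s * a"
    show u0: "?u \<noteq> 0"
    proof
      assume "?u = 0"
      then have "a = s" using s(1) by (simp add: field_simps)
      then show False using a s by simp
    qed
    show "inverse ?u \<in> R"
    proof (rule ccontr)
      assume "inverse ?u \<notin> R"
      then obtain p where p: "\<forall>i. coeff p i \<in> R" "s = poly p (inverse ?u)" using adjoin by blast
      let ?m = "degree p"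
      have uR: "?u \<in> R" using a s by (intro const_subring_diff[OF R] const_subring_mult[OF R]) auto
      have "\<exists>b\<in>R. ?u ^ k = 1 - inverse s * b" for k
      proof (induction k)
        case 0
        then show ?case by (intro bexI[of _ 0]) auto
      next
        case (Suc k)
        then obtain b where b: "b \<in> R" "?u ^ k = 1 - inverse s * b" by blast
        have "?u ^ Suc k = 1 - inverse s * (a + b - inverse s * a * b)"
        proof -
          have "?u ^ Suc k = ?u * (1 - inverse s * b)" using b by simp
          then show ?thesis by (simp add: algebra_simps)
        qed
        moreover have "a + b - inverse s * a * b \<in> R"
          using a b s by (intro const_subring_diff[OF R] const_subring_add[OF R] const_subring_mult[OF R])
        ultimately show ?case by blast
      qed
      then obtain b where b: "b \<in> R" "?u ^ ?m = 1 - inverse s * b" by blast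
      have "s * ?u ^ ?m = (\<Sum>i\<le>?m. coeff p i * ?u ^ (?m - i))"
        using poly_inverse_times_power[OF u0, of p] p(2) by simp
      also have "\<dots> \<in> R"
        using p(1) uR by (intro const_subring_sum[OF R] const_subring_mult[OF R] const_subring_power[OF R]) auto
      finally have "s * (1 - inverse s * b) \<in> R" using b by simp
      moreover have "s * (1 - inverse s * b) + b = s" using s(1) by (simp add: algebra_simps)
      ultimately show False using const_subring_add[OF R, of "s * (1 - inverse s * b)" b] b s by simp
    qed
  qed
  define repr where "repr x k \<longleftrightarrow> (\<exists>p. (\<forall>i. coeff p i \<in> R) \<and> s = poly p x \<and> degree p = k)" for x k
  \<comment> \<open>In s = q(1/x) move the constant term to the left, where it leaves
    \<open>s\<close> times a unit, and multiply by \<open>x ^ n\<close>: this writes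
    \<open>x ^ n\<close> as 1/s times a polynomial \<open>r\<close> in \<open>x\<close> of smaller
    degree, which replaces the leading term of a shortest expression of \<open>s\<close>.\<close>
  have descent: False
    if x: "x \<noteq> 0" and n: "repr x n" "\<And>k. repr x k \<Longrightarrow> n \<le> k" and m: "repr (inverse x) m" "m \<le> n" "n > 0" for x n m
  proof -
    obtain p where p: "\<forall>i. coeff p i \<in> R" "s = poly p x" "degree p = n" using n(1) unfolding repr_def by blast
    obtain q where q: "\<forall>i. coeff q i \<in> R" "s = poly q (inverse x)" "degree q = m" using m(1) unfolding repr_def by blast
    let ?u = "1 - inverse s * coeff q 0"
    note u = unit[of "coeff q 0"]
    have uR: "inverse ?u \<in> R" "?u \<noteq> 0" using u q(1) by auto
    define r where "r = (\<Sum>j=1..m. monom (inverse ?u * coeff q j) (n - j))"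
    have r_coeff: "\<forall>i. coeff r i \<in> R"
      using q(1) uR by (auto simp: r_def coeff_sum intro!: const_subring_sum[OF R] const_subring_mult[OF R])
    have r_deg: "degree r < n"
    proof -
      have "degree r \<le> n - 1" unfolding r_def
        by (intro degree_sum_le) (auto intro!: order_trans[OF degree_monom_le])
      then show ?thesis using m(3) by linarith
    qed
    have r_eval: "x ^ n = inverse s * poly r x"
    proof -
      have "s = coeff q 0 + (\<Sum>j=1..m. coeff q j * inverse x ^ j)"
      proof -
        have "{..m} = insert 0 {1..m}" by auto
        then show ?thesis using q(2,3) by (simp add: poly_altdef)
      qed
      then have "s - coeff q 0 = (\<Sum>j=1..m. coeff q j * inverse x ^ j)" by (metis add_diff_cancel_left')
      moreover have "s * ?u = s - coeff q 0" using s(1) by (simp add: right_diff_distrib)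
      ultimately have "s * ?u = (\<Sum>j=1..m. coeff q j * inverse x ^ j)" by simp
      then have "s * ?u * x ^ n = (\<Sum>j=1..m. coeff q j * x ^ (n - j))"
      proof -
        assume h: "s * ?u = (\<Sum>j=1..m. coeff q j * inverse x ^ j)"
        have "s * ?u * x ^ n = (\<Sum>j=1..m. coeff q j * inverse x ^ j * x ^ n)"
          unfolding h by (rule sum_distrib_right)
        also have "\<dots> = (\<Sum>j=1..m. coeff q j * x ^ (n - j))"
        proof (rule sum.cong[OF refl])
          fix j assume "j \<in> {1..m}"
          then have "x ^ n = x ^ j * x ^ (n - j)" using m(2) by (simp flip: power_add)
          then show "coeff q j * inverse x ^ j * x ^ n = coeff q j * x ^ (n - j)"
            using x by (simp add: power_inverse)
        qed
        finally show ?thesis .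
      qed
      moreover have "poly r x = inverse ?u * (\<Sum>j=1..m. coeff q j * x ^ (n - j))"
        by (simp add: r_def poly_sum poly_monom sum_distrib_left mult.assoc)
      ultimately have "poly r x = inverse ?u * (s * ?u * x ^ n)" by (simp only:)
      also have "\<dots> = s * x ^ n" using uR(2) by simp
      finally show ?thesis using s(1) by simp
    qed
    define p' where "p' = (p - monom (coeff p n) n) + smult (coeff p n * inverse s) r"
    have "poly p' x = s"
      using p(2) r_eval by (simp add: p'_def poly_monom algebra_simps)
    moreover have "\<forall>i. coeff p' i \<in> R"
      using p(1) r_coeff s(3)
      by (auto simp: p'_def intro!: const_subring_add[OF R] const_subring_diff[OF R] const_subring_mult[OF R])
    ultimately have "repr x (degree p')" unfolding repr_def by auto
    then have "n \<le> degree p'" by (rule n(2))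
    moreover have "degree p' < n"
    proof -
      have "degree (p - monom (coeff p n) n) < n"
      proof (rule degree_lessI)
        show "p - monom (coeff p n) n \<noteq> 0 \<or> 0 < n" using m(3) by simp
        show "\<forall>k\<ge>n. coeff (p - monom (coeff p n) n) k = 0"
          using p(3) by (auto simp: coeff_eq_0)
      qed
      moreover have "degree (smult (coeff p n * inverse s) r) < n"
        using r_deg by (intro le_less_trans[OF degree_smult_le])
      ultimately show ?thesis unfolding p'_def by (rule degree_add_less)
    qed
    ultimately show False by simp
  qed
  show ?thesis
  proof
    show "const_subring R" by (rule R)
    fix x :: "'a kbar" assume x: "x \<noteq> 0"
    show "x \<in> R \<or> inverse x \<in> R"
    proof (rule ccontr)
      assume *: "\<not> ?thesis"
      have pos: "k > 0" if "repr y k" for y k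
      proof (rule ccontr)
        assume "\<not> k > 0"
        with that obtain p where "\<forall>i. coeff p i \<in> R" "s = poly p y" "degree p = 0" unfolding repr_def by blast
        then have "s = coeff p 0" "coeff p 0 \<in> R" by (auto simp: poly_altdef)
        then show False using s by simp
      qed
      have least: "\<exists>n. repr y n \<and> (\<forall>k. repr y k \<longrightarrow> n \<le> k)" if "y \<notin> R" for y
      proof -
        have "\<exists>k. repr y k" using adjoin[OF that] unfolding repr_def by blast
        then have "repr y (LEAST k. repr y k)" by (rule LeastI_ex)
        then show ?thesis using Least_le[of "repr y"] by blast
      qed
      obtain n where n: "repr x n" "\<And>k. repr x k \<Longrightarrow> n \<le> k" using least[of x] * by blast
      obtain m where m: "repr (inverse x) m" "\<And>k. repr (inverse x) k \<Longrightarrow> m \<le> k"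
        using least[of "inverse x"] * by blast
      show False
      proof (cases "m \<le> n")
        case True
        then show ?thesis using descent[OF x n m(1)] pos[OF n(1)] by blast
      next
        case False
        then show ?thesis using descent[of "inverse x" m n] x n m pos[OF m(1)] by simp
      qed
    qed
  qed
qed

text \<open>The hypothesis is transcendence of \<open>s\<close> over the constants, in the form that
  starts Zorn's lemma: the algebra generated by 1/s avoids \<open>s\<close>.\<close>

lemma exists_pole:
  fixes K :: "'a::{field,finite} kbar set"
  assumes K: "intermediate_field K" and s: "s \<in> K" "s \<noteq> 0"
    and trans: "s \<notin> ring_adjoin (range ac_const) (inverse s)"
  shows "\<exists>w\<in>places K. w s < 0"
proof -
  let ?R0 = "ring_adjoin (range ac_const) (inverse s)"
  note R0 = ring_adjoin_subring[OF const_subring_consts, of "inverse s"]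
  obtain R where R: "const_subring R" "?R0 \<subseteq> R" "s \<notin> R"
    "\<And>R'. const_subring R' \<Longrightarrow> R \<subseteq> R' \<Longrightarrow> s \<notin> R' \<Longrightarrow> R' = R"
    by (rule exists_maximal_subring[OF R0(1) trans]) blast
  have "inverse s \<in> R" using R0(3) R(2) by blast
  then interpret const_valuation_ring R
    using maximal_subring_valuation_ring[OF R(1) s(2) R(3) _ R(4)] by blast
  show ?thesis by (rule exists_place[OF K s(1) R(3)])
qed

section \<open>Counting linear combinations\<close>

context finite_extension_field
begin

abbreviation T :: "'a kbar" where
  "T \<equiv> of_A [:0, 1:]"

lemma K_T [simp]: "T \<in> K" and K_of_A [simp]: "of_A a \<in> K"
  using field by (auto simp: intermediate_field_def of_A_def)

lemma K_0: "0 \<in> K"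
  using K_of_A[of 0] by (simp only: of_A_0)

lemma K_subgroup: "add_subgroup K"
proof -
  show ?thesis using field K_0 by (auto simp: add_subgroup_def intermediate_field_def)
qed

lemma infinite_place_w:
  assumes "w \<in> places K" "w T < 0"
    and p: "p \<noteq> 0"
  shows "w (of_A p) = - real (degree p)"
  using places_cases[OF assms(1)]
proof
  assume "\<forall>p. p \<noteq> 0 \<longrightarrow> 0 \<le> w (of_A p)"
  then have "0 \<le> w T" by simp
  then show ?thesis using assms(2) by simp
qed (use p in blast)

lemma finite_place_w:
  assumes "w \<in> places K" "0 \<le> w T" and p: "p \<noteq> 0"
  shows "0 \<le> w (of_A p)"
  using places_cases[OF assms(1)]
proof
  assume "\<forall>p. p \<noteq> 0 \<longrightarrow> w (of_A p) = - real (degree p)"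
  then have "w T = - 1" by simp
  then show ?thesis using assms(2) by simp
qed (use p in blast)

lemma exists_infinite_place: "\<exists>w\<in>places K. w T < 0"
proof (rule exists_pole[OF field K_T])
  show "T \<noteq> 0" by simp
  show "T \<notin> ring_adjoin (range ac_const) (inverse T)"
  proof
    assume "T \<in> ring_adjoin (range ac_const) (inverse T)"
    then obtain p where p: "\<forall>i. coeff p i \<in> range ac_const" "T = poly p (inverse T)"
      unfolding ring_adjoin_def by blast
    have "\<forall>i. \<exists>c. coeff p i = ac_const c" using p(1) by blast
  from choice[OF this] obtain c where c: "\<And>i. coeff p i = ac_const (c i)" by blast
    let ?n = "degree p"
    let ?t = "[:0, 1:] :: 'a poly"
    have "T * T ^ ?n = (\<Sum>i\<le>?n. ac_const (c i) * T ^ (?n - i))"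
      using poly_inverse_times_power[of T p] p(2) by (simp add: c)
    then have "of_A (?t ^ Suc ?n) = of_A (\<Sum>i\<le>?n. [:c i:] * ?t ^ (?n - i))"
      by (simp only: of_A_sum of_A_mult of_A_power power_Suc)
    then have eq: "?t ^ Suc ?n = (\<Sum>i\<le>?n. [:c i:] * ?t ^ (?n - i))" by (simp only: of_A_eq_iff)
    have "degree (\<Sum>i\<le>?n. [:c i:] * ?t ^ (?n - i)) \<le> ?n"
      by (intro degree_sum_le) (auto intro!: order_trans[OF degree_mult_le] simp: degree_power_eq order_trans[OF degree_smult_le])
    moreover have "degree (?t ^ Suc ?n) = Suc ?n" by (subst degree_power_eq) auto
    ultimately show False unfolding eq[symmetric] by simp
  qed
qed

text \<open>Having no pole, a nonzero \<open>s\<close> would satisfy s = p(1/s) over the constants.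
  Cleared of denominators, the equation has the leading coefficient of \<open>p\<close> as constant
  term, which has value 0 at an infinite place, while all other terms have value at least 1
  there.\<close>

lemma no_poles:
  assumes s: "s \<in> K" and nonneg: "\<And>w. w \<in> places K \<Longrightarrow> s \<in> val_ge K w 0"
    and inf: "\<And>w. w \<in> places K \<Longrightarrow> w T < 0 \<Longrightarrow> s \<in> val_ge K w 1"
  shows "s = 0"
proof (rule ccontr)
  assume s0: "s \<noteq> 0"
  have "\<not> (\<exists>w\<in>places K. w s < 0)" using nonneg s0 by (force simp: val_ge_def)
  then have "s \<in> ring_adjoin (range ac_const) (inverse s)" using exists_pole[OF field s s0] by blast
  then obtain p where p: "\<forall>i. coeff p i \<in> range ac_const" "s = poly p (inverse s)"
    unfolding ring_adjoin_def by blast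
  have "\<forall>i. \<exists>c. coeff p i = ac_const c" using p(1) by blast
  from choice[OF this] obtain c where c: "\<And>i. coeff p i = ac_const (c i)" by blast
  let ?n = "degree p"
  have "p \<noteq> 0" using p(2) s0 by auto
  then have cn: "c ?n \<noteq> 0" using c[of ?n] by auto
  obtain w where wp: "w \<in> places K" "w T < 0" using exists_infinite_place by blast
  interpret valued_field K w by (rule valued[OF wp(1)])
  have s1: "s \<in> val_ge K w 1" "s \<in> val_ge K w 0" using inf[OF wp] nonneg[OF wp(1)] .
  have pow0: "s ^ k \<in> val_ge K w 0" for k
  proof (induction k)
    case (Suc k)
    then show ?case using val_ge_mult[OF s1(2) Suc] by simp
  qed (simp add: val_ge_def)
  have pow: "s ^ k \<in> val_ge K w 1" if "k > 0" for k
    using val_ge_mult[OF s1(1) pow0[of "k - 1"]] that by (cases k) auto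
  have const: "ac_const (c i) \<in> val_ge K w 0" for i
    using places_const[OF wp(1), of "c i"] by (cases "c i = 0") (auto simp: val_ge_def)
  have "s * s ^ ?n = (\<Sum>i\<le>?n. ac_const (c i) * s ^ (?n - i))"
    using poly_inverse_times_power[OF s0, of p] p(2) by (simp add: c)
  also have "\<dots> = (\<Sum>i<?n. ac_const (c i) * s ^ (?n - i)) + ac_const (c ?n)"
    by (simp add: lessThan_Suc_atMost[symmetric])
  finally have eq: "ac_const (c ?n) = s ^ Suc ?n - (\<Sum>i<?n. ac_const (c i) * s ^ (?n - i))" by simp
  have "s ^ Suc ?n - (\<Sum>i<?n. ac_const (c i) * s ^ (?n - i)) \<in> val_ge K w 1"
  proof (rule val_ge_diff[OF pow val_ge_sum])
    fix i assume "i \<in> {..<?n}"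
    then show "ac_const (c i) * s ^ (?n - i) \<in> val_ge K w 1"
      using val_ge_mult[OF const[of i] pow[of "?n - i"]] by simp
  qed simp
  then show False unfolding eq[symmetric] using places_const[OF wp(1) cn] cn by (simp add: val_ge_def)
qed

text \<open>The integral closure of A in K, described by its places: the condition on T selects
  those not above infinity.\<close>

definition integers :: "'a kbar set" where
  "integers = {y \<in> K. \<forall>w\<in>places K. 0 \<le> w T \<longrightarrow> y \<in> val_ge K w 0}"

lemma integers_subgroup: "add_subgroup integers"
proof -
  have "add_subgroup (val_ge K w 0)" if "w \<in> places K" for w
    using valued_field.val_ge_subgroup[OF valued[OF that]] .
  then show ?thesis using K_subgroup by (auto simp: integers_def add_subgroup_def)
qed

lemma integers_mult: "x \<in> integers \<Longrightarrow> y \<in> integers \<Longrightarrow> x * y \<in> integers"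
proof -
  assume xy: "x \<in> integers" "y \<in> integers"
  have "x * y \<in> val_ge K w 0" if "w \<in> places K" "0 \<le> w T" for w
    using valued_field.val_ge_mult[OF valued[OF that(1)], of x 0 y 0] xy that by (auto simp: integers_def)
  then show ?thesis using xy field by (auto simp: integers_def intermediate_field_def)
qed

lemma integers_of_A: "of_A a \<in> integers"
proof -
  have "of_A a \<in> val_ge K w 0" if "w \<in> places K" "0 \<le> w T" for w
    using finite_place_w[OF that, of a] K_0 by (cases "a = 0") (auto simp: val_ge_def)
  then show ?thesis using K_of_A by (simp add: integers_def)
qed

section \<open>Integers of K modulo powers of T\<close>

lemma polynomial_relation:
  assumes y: "\<And>i. i < r \<Longrightarrow> y i \<in> K" and r: "n < r"
  obtains a where "\<exists>i<r. a i \<noteq> 0" "(\<Sum>i<r. of_A (a i) * y i) = 0"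
proof -
  obtain c where c: "\<exists>i<r. c i \<noteq> 0" "(\<Sum>i<r. to_ac (c i) * y i) = 0"
    using rank y r unfolding rank_le_def by meson
  have "\<exists>a b. c i = Fract a b \<and> b \<noteq> 0" for i by (cases "c i") blast
  then obtain a b where ab: "\<And>i. c i = Fract (a i) (b i)" "\<And>i. b i \<noteq> 0" by metis
  define d where "d = (\<Prod>i<r. b i)"
  have d: "d \<noteq> 0" using ab(2) by (simp add: d_def)
  have "\<exists>e. d = b i * e" if "i < r" for i
    unfolding d_def using that prod.remove[of "{..<r}" i b] by auto
  then obtain e where e: "\<And>i. i < r \<Longrightarrow> d = b i * e i" by metis
  have eq: "of_A d * to_ac (c i) = of_A (a i * e i)" if "i < r" for i
    using ab[of i] e[OF that] by (simp add: to_ac_Fract)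
  have "(\<Sum>i<r. of_A (a i * e i) * y i) = (\<Sum>i<r. of_A d * (to_ac (c i) * y i))"
    using eq by (intro sum.cong) (simp_all add: mult.assoc[symmetric])
  also have "\<dots> = 0" using c(2) by (simp flip: sum_distrib_left)
  finally have "(\<Sum>i<r. of_A (a i * e i) * y i) = 0" .
  moreover have "\<exists>i<r. a i * e i \<noteq> 0"
  proof -
    obtain i where i: "i < r" "c i \<noteq> 0" using c(1) by blast
    then have "a i * e i \<noteq> 0" using eq[of i] d by (metis mult_eq_0_iff of_A_eq_0_iff to_ac_eq_0_iff)
    then show ?thesis using i by blast
  qed
  ultimately show ?thesis using that[of "\<lambda>i. a i * e i"] by blast
qed

text \<open>In a relation of least total degree the coefficients are not all divisible by T, for
  otherwise T could be cancelled. The relation hence stays nontrivial after reduction modulo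
  T.\<close>

lemma polynomial_relation_mod_T:
  assumes y: "\<And>i. i < r \<Longrightarrow> y i \<in> K" and r: "n < r"
  obtains a where "\<exists>i<r. coeff (a i) 0 \<noteq> 0" "(\<Sum>i<r. of_A (a i) * y i) = 0"
proof -
  define P where "P a \<longleftrightarrow> (\<exists>i<r. a i \<noteq> 0) \<and> (\<Sum>i<r. of_A (a i) * y i) = 0" for a
  define \<mu> where "\<mu> a = (\<Sum>i<r. degree (a i))" for a :: "nat \<Rightarrow> 'a poly"
  have "\<exists>a. P a" by (rule polynomial_relation[OF y r]) (auto simp: P_def)
  then obtain a where a: "P a" "\<And>a'. P a' \<Longrightarrow> \<mu> a \<le> \<mu> a'"
    using arg_min_natI[of P _ \<mu>] arg_min_nat_le[of P _ \<mu>] by blast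
  have "\<exists>i<r. coeff (a i) 0 \<noteq> 0"
  proof (rule ccontr)
    assume *: "\<not> ?thesis"
    have "\<exists>b. a i = pCons 0 b" if "i < r" for i
      using * that by (cases "a i") auto
    then obtain b where b: "\<And>i. i < r \<Longrightarrow> a i = pCons 0 (b i)" by metis
    have "of_A (a i) = T * of_A (b i)" if "i < r" for i
      using b[OF that] by (simp flip: of_A_mult)
    then have "(\<Sum>i<r. of_A (a i) * y i) = T * (\<Sum>i<r. of_A (b i) * y i)"
      by (simp add: sum_distrib_left mult.assoc)
    then have "(\<Sum>i<r. of_A (b i) * y i) = 0" using a(1) by (simp add: P_def)
    moreover obtain j where j: "j < r" "a j \<noteq> 0" using a(1) by (auto simp: P_def)
    moreover from j have "b j \<noteq> 0" using b by auto
    ultimately have "P b" by (auto simp: P_def)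
    then have "\<mu> a \<le> \<mu> b" by (rule a(2))
    moreover have "\<mu> b < \<mu> a"
      unfolding \<mu>_def
    proof (rule sum_strict_mono_ex1)
      show "\<forall>i\<in>{..<r}. degree (b i) \<le> degree (a i)" using b by (simp add: degree_pCons_eq_if)
      show "\<exists>i\<in>{..<r}. degree (b i) < degree (a i)"
        using j \<open>b j \<noteq> 0\<close> b[OF j(1)] by (intro bexI[of _ j]) (simp_all add: degree_pCons_eq)
    qed simp
    ultimately show False by simp
  qed
  then show ?thesis using that a(1) by (auto simp: P_def)
qed

text \<open>The integers modulo T form a vector space over the constants, and its dimension is at
  most \<open>n\<close> because n + 1 integers satisfy a relation that survives modulo T.\<close>

lemma integers_mod_T: "index_le integers ((*) T ` integers) (real (CARD('a) ^ n))"
proof -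
  let ?C = "range (ac_const :: 'a \<Rightarrow> 'a kbar)" and ?V = "(*) T ` integers"
  note C = const_subring_consts[where 'a = 'a]
  have V: "add_subgroup ?V" by (rule add_subgroup_mult[OF integers_subgroup])
  obtain r :: nat and y where ry: "r \<le> n" "\<And>i. i < r \<Longrightarrow> y i \<in> integers"
    "\<And>u. u \<in> integers \<Longrightarrow> \<exists>c. (\<forall>i<r. c i \<in> ?C) \<and> u - (\<Sum>i<r. c i * y i) \<in> ?V"
  proof (rule residue_basis[of ?C ?V "{0}" integers n])
    show "c * c' \<in> ?C" if "c \<in> ?C" "c' \<in> ?C" for c c' using const_subring_mult[OF C] that .
    show "- c \<in> ?C" if "c \<in> ?C" for c using const_subring_uminus[OF C] that .
    show "add_subgroup ?V" by (rule V)
    show "c * v \<in> ?V" if cv: "c \<in> ?C" "v \<in> ?V" for c v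
    proof -
      obtain u where u: "u \<in> integers" "v = T * u" using cv by blast
      have "c \<in> integers" using cv integers_of_A by blast
      then show ?thesis using u integers_mult by (intro image_eqI[of _ _ "c * u"]) auto
    qed
    show "p * u \<in> ?V" if "p \<in> {0}" "u \<in> integers" for p u using that add_subgroup_0[OF V] by simp
    show "\<exists>c'\<in>?C. c' * c - 1 \<in> {0}" if c: "c \<in> ?C" "c \<notin> {0}" for c
    proof -
      obtain d where d: "c = ac_const d" using c by blast
      then have "d \<noteq> 0" using c by auto
      then have "ac_const (inverse d) * c = 1" unfolding d by (simp flip: of_A_mult one_pCons)
      then show ?thesis by auto
    qed
  next
    fix r :: nat and y
    assume y: "\<And>i. i < r \<Longrightarrow> y i \<in> integers"
      and ind: "\<And>c. (\<forall>i<r. c i \<in> ?C) \<Longrightarrow> (\<Sum>i<r. c i * y i) \<in> ?V \<Longrightarrow> (\<forall>i<r. c i \<in> {0})"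
    show "r \<le> n"
    proof (rule ccontr)
      assume "\<not> r \<le> n"
      then have r: "n < r" by simp
      have yK: "y i \<in> K" if "i < r" for i using y[OF that] by (simp add: integers_def)
      obtain a where a: "\<exists>i<r. coeff (a i) 0 \<noteq> 0" "(\<Sum>i<r. of_A (a i) * y i) = 0"
        using polynomial_relation_mod_T[OF yK r] .
      have "\<exists>b. a i = pCons (coeff (a i) 0) b" for i by (cases "a i") auto
      then obtain b where b: "\<And>i. a i = pCons (coeff (a i) 0) (b i)" by metis
      have split: "of_A (a i) = ac_const (coeff (a i) 0) + T * of_A (b i)" for i
      proof -
        have "pCons (coeff (a i) 0) (b i) = [:coeff (a i) 0:] + [:0, 1:] * b i" by simp
        then show ?thesis using b[of i] by (metis of_A_add of_A_mult)
      qed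
      have "(\<Sum>i<r. ac_const (coeff (a i) 0) * y i) + T * (\<Sum>i<r. of_A (b i) * y i) = 0"
        using a(2) unfolding split by (simp add: algebra_simps sum.distrib sum_distrib_left)
      then have "(\<Sum>i<r. ac_const (coeff (a i) 0) * y i) = T * (- (\<Sum>i<r. of_A (b i) * y i))"
        by (simp add: add_eq_0_iff2)
      moreover have "- (\<Sum>i<r. of_A (b i) * y i) \<in> integers"
        using y by (intro add_subgroup_uminus[OF integers_subgroup] add_subgroup_sum[OF integers_subgroup]
            integers_mult integers_of_A) auto
      ultimately have "(\<Sum>i<r. ac_const (coeff (a i) 0) * y i) \<in> ?V" by blast
      from ind[of "\<lambda>i. ac_const (coeff (a i) 0)", OF _ this] have "\<forall>i<r. coeff (a i) 0 = 0" by simp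
      then show False using a(1) by blast
    qed
  next
    fix r :: nat and y
    assume "r \<le> n" "\<And>i. i < r \<Longrightarrow> y i \<in> integers"
      "\<And>u. u \<in> integers \<Longrightarrow> \<exists>c. (\<forall>i<r. c i \<in> ?C) \<and> u - (\<Sum>i<r. c i * y i) \<in> ?V"
    then show thesis by (rule that)
  qed
  have "index_le integers ?V (real CARD('a) ^ r)"
  proof (rule residue_index[OF const_subring_subgroup[OF C] V _ ry(2,3)])
    show "p * u \<in> ?V" if "p \<in> {0}" "u \<in> integers" for p u using that add_subgroup_0[OF V] by simp
    show "index_le ?C {0} (real CARD('a))"
    proof (rule index_leI)
      fix S assume "finite S" "S \<subseteq> ?C"
      then have "card S \<le> card ?C" by (intro card_mono) auto
      also have "card ?C \<le> CARD('a)" by (rule card_image_le) simp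
      finally show "real (card S) \<le> real CARD('a)" by simp
    qed
  qed
  moreover have "real CARD('a) ^ r \<le> real (CARD('a) ^ n)"
    using ry(1) power_increasing[of r n "real CARD('a)"] by (simp add: Suc_leI)
  ultimately show ?thesis using index_le_mono[of integers ?V _ integers ?V] by blast
qed

lemma integers_mod_T_power: "index_le integers ((*) (T ^ b) ` integers) (real (CARD('a) ^ (n * b)))"
proof (induction b)
  case 0
  have "(*) (T ^ 0) ` integers = integers" by auto
  then show ?case
    using index_le_INT[of "{}" integers "\<lambda>_. {}" "\<lambda>_. 0"] integers_subgroup by simp
next
  case (Suc b)
  have "index_le ((*) (T ^ b) ` integers) ((*) (T ^ b) ` ((*) T ` integers)) (real (CARD('a) ^ n))"
    by (rule index_le_mult[OF integers_mod_T]) simp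
  moreover have "(*) (T ^ b) ` ((*) T ` integers) = (*) (T ^ Suc b) ` integers"
    by (auto simp: image_image mult_ac)
  moreover have "add_subgroup ((*) (T ^ b) ` integers)" by (rule add_subgroup_mult[OF integers_subgroup])
  ultimately have "index_le integers ((*) (T ^ Suc b) ` integers) (real (CARD('a) ^ (n * b)) * real (CARD('a) ^ n))"
    using index_le_trans[OF Suc.IH] by (simp del: power_Suc)
  then show ?case by (simp add: power_add del: power_Suc) (simp add: mult.commute)
qed

text \<open>\<open>bounded_poles B\<close> is the Riemann--Roch space of \<open>B\<close> times the divisor of poles of \<open>T\<close>.\<close>

definition pole_bound :: "nat \<Rightarrow> ('a kbar \<Rightarrow> real) \<Rightarrow> real" where
  "pole_bound B w = (if 0 \<le> w T then 0 else real B)"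

definition bounded_poles :: "nat \<Rightarrow> 'a kbar set" where
  "bounded_poles B = {y \<in> K. \<forall>w\<in>places K. y \<in> val_ge K w (- pole_bound B w)}"

lemma bounded_poles_index: "index_le (bounded_poles B) {0} (real (CARD('a) ^ (n * Suc B)))"
proof (rule index_leI)
  fix S assume S: "finite S" "S \<subseteq> bounded_poles B"
    and d: "\<And>s s'. s \<in> S \<Longrightarrow> s' \<in> S \<Longrightarrow> s - s' \<in> {0} \<Longrightarrow> s = s'"
  show "real (card S) \<le> real (CARD('a) ^ (n * Suc B))"
  proof (rule index_leD[OF integers_mod_T_power S(1)])
    show "S \<subseteq> integers" using S(2) by (force simp: bounded_poles_def integers_def pole_bound_def)
    fix s s' assume s: "s \<in> S" "s' \<in> S" "s - s' \<in> (*) (T ^ Suc B) ` integers"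
    then obtain u where u: "u \<in> integers" "s - s' = T ^ Suc B * u" by blast
    have "u \<in> val_ge K w 1" if wp: "w \<in> places K" "w T < 0" for w
    proof -
      interpret valued_field K w by (rule valued[OF wp(1)])
      have wT: "w (T ^ Suc B) = - real (Suc B)"
        using infinite_place_w[OF wp, of "[:0, 1:] ^ Suc B"] by (simp add: degree_power_eq del: power_Suc of_A_power flip: of_A_power)
      have "s - s' \<in> val_ge K w (- real B)"
        using S(2) s wp by (intro val_ge_diff) (force simp: bounded_poles_def pole_bound_def)+
      moreover have "inverse (T ^ Suc B) \<in> val_ge K w (real (Suc B))"
        using wT w_inverse[of "T ^ Suc B"] K_power[OF K_T] by (simp add: val_ge_def del: power_Suc)
      ultimately have "inverse (T ^ Suc B) * (s - s') \<in> val_ge K w (real (Suc B) + - real B)"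
        by (intro val_ge_mult)
      moreover have "T ^ Suc B \<noteq> 0" by simp
      then have "inverse (T ^ Suc B) * (T ^ Suc B * u) = u"
        by (metis mult.assoc left_inverse mult_1)
      moreover have "real (Suc B) + - real B = 1" by simp
      ultimately show ?thesis unfolding u(2) by (simp only:)
    qed
    moreover have "u \<in> val_ge K w 0" if w: "w \<in> places K" for w
    proof (cases "0 \<le> w T")
      case True
      then show ?thesis using u(1) w by (simp add: integers_def)
    next
      case False
      then show ?thesis using calculation[OF w] by (auto simp: val_ge_def)
    qed
    ultimately have "u = 0" using u(1) by (intro no_poles) (auto simp: integers_def)
    then show "s = s'" using u by simp
  qed
qed

text \<open>Above infinity poles are only to be reduced to order \<open>B\<close>; multiplication by
  \<open>T ^ B\<close> transports the index to that level.\<close>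

lemma pole_index_shifted:
  fixes w :: "'a kbar \<Rightarrow> real"
  assumes wp: "w \<in> places K" and y: "y \<in> K" "w y < 0"
  shows "index_le (val_ge K w (w y - pole_bound B w)) (val_ge K w (- pole_bound B w))
    (real CARD('a) powr (local_degree K w * (- w y)))"
proof -
  obtain \<pi> \<delta> where "uniformized_place K w \<pi> \<delta> n" using uniformized[OF wp] .
  then interpret uniformized_place K w \<pi> \<delta> n .
  have idx: "index_le (val_ge K w (w y)) (val_ge K w 0) (real CARD('a) powr (local_degree K w * (- w y)))"
    by (rule pole_index[OF y])
  show ?thesis
  proof (cases "0 \<le> w T")
    case True
    then show ?thesis using idx by (simp add: pole_bound_def)
  next
    case False
    then have wT: "w (T ^ B) = - pole_bound B w"
      using infinite_place_w[OF wp, of "[:0, 1:] ^ B"] by (simp add: degree_power_eq pole_bound_def)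
    have TB: "T ^ B \<in> K" "T ^ B \<noteq> 0" using K_power[OF K_T] by auto
    have "index_le ((*) (T ^ B) ` val_ge K w (w y)) ((*) (T ^ B) ` val_ge K w 0)
        (real CARD('a) powr (local_degree K w * (- w y)))"
      by (rule index_le_mult[OF idx TB(2)])
    then show ?thesis unfolding val_ge_eq_mult[OF TB, symmetric] wT by simp
  qed
qed

section \<open>Removing the poles of a vector place by place\<close>

lemma finite_local_max:
  assumes I: "finite I" and y: "\<And>i. i \<in> I \<Longrightarrow> y i \<in> K"
  shows "finite {w \<in> places K. local_max w I y \<noteq> 0}"
proof (rule finite_subset)
  show "{w \<in> places K. local_max w I y \<noteq> 0} \<subseteq> (\<Union>i\<in>I. {w \<in> places K. w (y i) < 0})"
  proof
    fix w assume w: "w \<in> {w \<in> places K. local_max w I y \<noteq> 0}"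
    have "local_max w I y \<in> insert 0 ((\<lambda>i. - w (y i)) ` I)"
      unfolding local_max_def using I by (intro Max_in) auto
    moreover have "0 \<le> local_max w I y" unfolding local_max_def using I by (intro Max_ge) auto
    ultimately obtain i where "i \<in> I" "w (y i) < 0" using w by force
    then show "w \<in> (\<Union>i\<in>I. {w \<in> places K. w (y i) < 0})" using w by blast
  qed
qed (use I finite_poles y in blast)

lemma span_index:
  assumes I: "finite I" and y: "\<And>i. i \<in> I \<Longrightarrow> y i \<in> K"
  shows "index_le {\<Sum>i\<in>I. of_A (p i) * y i |p. \<forall>i\<in>I. degree (p i) \<le> B} {0}
    (real CARD('a) powr ((\<Sum>w\<in>{w \<in> places K. local_max w I y \<noteq> 0}. real (local_degree K w) * local_max w I y)
      + real (n * Suc B)))"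
proof -
  let ?m = "\<lambda>w. local_max w I y" and ?q = "real CARD('a)"
  let ?S = "{w \<in> places K. ?m w \<noteq> 0}"
  have fin: "finite ?S" by (rule finite_local_max[OF I y])
  \<comment> \<open>The group with the largest poles that the combinations can have. It is defined
    by independent conditions at the places, so it can be cut down one place at a time; the
    combinations form a subset.\<close>
  define A where "A = {u \<in> K. \<forall>w\<in>places K. u \<in> val_ge K w (- ?m w - pole_bound B w)}"
  have sgv: "add_subgroup (val_ge K w r)" if "w \<in> places K" for w r
    using valued_field.val_ge_subgroup[OF valued[OF that]] .
  have sgA: "add_subgroup A"
    using K_subgroup sgv unfolding A_def add_subgroup_def by auto
  have sub: "(\<Sum>i\<in>I. of_A (p i) * y i) \<in> A" if p: "\<forall>i\<in>I. degree (p i) \<le> B" for p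
  proof -
    have "of_A (p i) * y i \<in> A" if i: "i \<in> I" for i
    proof -
      have "of_A (p i) * y i \<in> val_ge K w (- ?m w - pole_bound B w)" if wp: "w \<in> places K" for w
      proof -
        interpret valued_field K w by (rule valued[OF wp])
        have "- w (y i) \<le> ?m w" unfolding local_max_def using I i by (intro Max_ge) auto
        then have 1: "y i \<in> val_ge K w (- ?m w)" using y[OF i] by (auto simp: val_ge_def)
        have 2: "of_A (p i) \<in> val_ge K w (- pole_bound B w)"
        proof (cases "p i = 0")
          case False
          have d: "degree (p i) \<le> B" using p i by blast
          show ?thesis
          proof (cases "0 \<le> w T")
            case True
            then show ?thesis using finite_place_w[OF wp True False] by (simp add: val_ge_def pole_bound_def)
          next
            case False2: False
            then show ?thesis using infinite_place_w[OF wp _ False] d by (simp add: val_ge_def pole_bound_def)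
          qed
        qed (simp add: val_ge_0)
        show ?thesis using val_ge_mult[OF 1 2] by (simp add: mult.commute)
      qed
      moreover have "of_A (p i) * y i \<in> K" using field y[OF i] K_of_A by (simp add: intermediate_field_def)
      ultimately show ?thesis by (simp add: A_def)
    qed
    then show ?thesis by (rule add_subgroup_sum[OF sgA])
  qed
  have "index_le A (val_ge K w (- pole_bound B w)) (?q powr (real (local_degree K w) * ?m w))" if w: "w \<in> ?S" for w
  proof -
    have "?m w \<in> insert 0 ((\<lambda>i. - w (y i)) ` I)"
      unfolding local_max_def using I by (intro Max_in) auto
    then obtain i where i: "i \<in> I" "?m w = - w (y i)" using w by auto
    have "0 \<le> ?m w" unfolding local_max_def using I by (intro Max_ge) auto
    then have "w (y i) < 0" using i w by auto
    moreover have "w \<in> places K" using w by simp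
    ultimately have "index_le (val_ge K w (w (y i) - pole_bound B w)) (val_ge K w (- pole_bound B w))
        (?q powr (real (local_degree K w) * - w (y i)))"
      using pole_index_shifted y[OF i(1)] by blast
    then have "index_le (val_ge K w (- ?m w - pole_bound B w)) (val_ge K w (- pole_bound B w))
        (?q powr (real (local_degree K w) * ?m w))" using w i(2) by simp
    then show ?thesis by (rule index_le_mono) (use w in \<open>auto simp: A_def\<close>)
  qed
  then have "index_le A (A \<inter> (\<Inter>w\<in>?S. val_ge K w (- pole_bound B w))) (\<Prod>w\<in>?S. ?q powr (real (local_degree K w) * ?m w))"
    using sgv by (intro index_le_INT[OF fin sgA]) auto
  moreover have "(\<Prod>w\<in>?S. ?q powr (real (local_degree K w) * ?m w)) = ?q powr (\<Sum>w\<in>?S. real (local_degree K w) * ?m w)"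
    using fin by (simp add: powr_sum)
  moreover have "A \<inter> (\<Inter>w\<in>?S. val_ge K w (- pole_bound B w)) \<subseteq> bounded_poles B"
  proof
    fix u assume u: "u \<in> A \<inter> (\<Inter>w\<in>?S. val_ge K w (- pole_bound B w))"
    have "u \<in> val_ge K w (- pole_bound B w)" if w: "w \<in> places K" for w
    proof (cases "?m w = 0")
      case True
      then show ?thesis using u w by (auto simp: A_def)
    next
      case False
      then show ?thesis using u w by auto
    qed
    then show "u \<in> bounded_poles B" using u by (auto simp: bounded_poles_def A_def)
  qed
  ultimately have 1: "index_le A (bounded_poles B) (?q powr (\<Sum>w\<in>?S. real (local_degree K w) * ?m w))"
    using index_le_mono by fastforce
  have "add_subgroup (bounded_poles B)"
    using K_subgroup sgv unfolding bounded_poles_def add_subgroup_def by auto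
  from index_le_trans[OF 1 bounded_poles_index this]
  have "index_le A {0} (?q powr (\<Sum>w\<in>?S. real (local_degree K w) * ?m w) * real (CARD('a) ^ (n * Suc B)))" .
  moreover have "real (CARD('a) ^ (n * Suc B)) = ?q powr real (n * Suc B)"
    using powr_realpow[of ?q "n * Suc B"] by simp
  ultimately have "index_le A {0} (?q powr ((\<Sum>w\<in>?S. real (local_degree K w) * ?m w) + real (n * Suc B)))"
    by (simp only: powr_add)
  then show ?thesis by (rule index_le_mono) (use sub in auto)
qed

end

section \<open>Degrees of field extensions\<close>

lemma kbar_field: "field (kbar_ring :: 'a::field kbar ring)"
  by (rule field_from_type_algebra)

lemma kbar_ring_simps [simp]:
  "carrier kbar_ring = (UNIV :: 'a::field kbar set)"
  "x \<otimes>\<^bsub>kbar_ring\<^esub> y = x * y" "x \<oplus>\<^bsub>kbar_ring\<^esub> y = x + y"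
  "\<one>\<^bsub>kbar_ring\<^esub> = 1" "\<zero>\<^bsub>kbar_ring\<^esub> = 0" for x y :: "'a::field kbar"
  by (simp_all add: ring_of_type_algebra_def)

lemma kbar_ring_uminus [simp]: "\<ominus>\<^bsub>kbar_ring\<^esub> x = - x" for x :: "'a::field kbar"
proof -
  interpret F: field "kbar_ring :: 'a kbar ring" by (rule kbar_field)
  show ?thesis by (rule F.minus_equality) auto
qed

lemma kbar_ring_inverse [simp]: "x \<noteq> 0 \<Longrightarrow> inv\<^bsub>kbar_ring\<^esub> x = inverse x" for x :: "'a::field kbar"
proof -
  interpret F: field "kbar_ring :: 'a kbar ring" by (rule kbar_field)
  show "x \<noteq> 0 \<Longrightarrow> ?thesis" by (rule F.comm_inv_char) auto
qed

lemma kbar_ring_power [simp]: "x [^]\<^bsub>kbar_ring\<^esub> (n::nat) = x ^ n" for x :: "'a::field kbar"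
proof -
  interpret F: field "kbar_ring :: 'a kbar ring" by (rule kbar_field)
  show ?thesis by (induction n) (auto simp: mult.commute)
qed

lemma base_subfield: "subfield base_field (kbar_ring :: 'a::field kbar ring)"
proof -
  interpret F: field "kbar_ring :: 'a kbar ring" by (rule kbar_field)
  show ?thesis
  proof (rule F.subfieldI'[OF F.subringI])
    fix k :: "'a kbar" assume "k \<in> base_field - {\<zero>\<^bsub>kbar_ring\<^esub>}"
    then show "inv\<^bsub>kbar_ring\<^esub> k \<in> base_field" by (auto simp flip: to_ac_inverse)
  qed (auto simp flip: to_ac_minus to_ac_add to_ac_mult intro: image_eqI[of _ _ 1])
qed

lemma adjoin_subfield: "subfield (adjoin S) (kbar_ring :: 'a::field kbar ring)"
proof -
  interpret F: field "kbar_ring :: 'a kbar ring" by (rule kbar_field)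
  show ?thesis unfolding adjoin_def by (rule F.generate_field_is_subfield) simp
qed

lemma adjoin_incl: "base_field \<union> S \<subseteq> adjoin S"
  unfolding adjoin_def by (auto intro: generate_field.incl)

lemma adjoin_intermediate: "intermediate_field (adjoin S)" for S :: "'a::field kbar set"
proof -
  interpret F: field "kbar_ring :: 'a kbar ring" by (rule kbar_field)
  note sf = adjoin_subfield[of S]
  note sr = subringE[OF subfieldE(1)[OF sf]]
  have "x - y \<in> adjoin S" if "x \<in> adjoin S" "y \<in> adjoin S" for x y
    using sr(7)[OF that(1) sr(5)[OF that(2)]] by simp
  moreover have "x * y \<in> adjoin S" if "x \<in> adjoin S" "y \<in> adjoin S" for x y
    using sr(6)[OF that] by simp
  moreover have "inverse x \<in> adjoin S" if "x \<in> adjoin S" for x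
    using F.subfield_m_inv(1)[OF sf, of x] that by (cases "x = 0") auto
  ultimately show ?thesis using adjoin_incl[of S] by (auto simp: intermediate_field_def)
qed

text \<open>Translates an algebraic equation into list polynomials, which carry the leading
  coefficient first; hence the reversal of \<open>coeffs\<close>.\<close>

lemma kbar_algebraic:
  fixes x :: "'a::field kbar"
  assumes E: "base_field \<subseteq> E"
  shows "(ring.algebraic kbar_ring over E) x"
proof -
  interpret F: field "kbar_ring :: 'a kbar ring" by (rule kbar_field)
  have eval: "F.eval l x = poly (Poly (rev l)) x" for l
    by (induction l) (auto simp: Poly_append poly_monom)
  obtain p :: "'a poly fract poly" where p: "p \<noteq> 0" "poly (map_poly to_ac p) x = 0"
    by (rule alg_closure_algebraic)
  let ?p = "map_poly to_ac p"
  have p0: "?p \<noteq> 0" using p(1) by (simp add: map_poly_eq_0_iff)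
  show ?thesis
    unfolding over_def
  proof (rule F.algebraicI[unfolded over_def])
    show "rev (coeffs ?p) \<noteq> []" using p0 by simp
    have "set (coeffs ?p) \<subseteq> E" using E by (auto simp: set_coeffs_map_poly)
    moreover have "hd (rev (coeffs ?p)) \<noteq> 0" using p0 by (simp add: hd_rev last_coeffs_eq_coeff_degree)
    ultimately show "rev (coeffs ?p) \<in> carrier (E[X]\<^bsub>kbar_ring\<^esub>)" by (simp add: univ_poly_def polynomial_def)
    show "F.eval (rev (coeffs ?p)) x = \<zero>\<^bsub>kbar_ring\<^esub>" using p(2) by (simp add: eval)
  qed
qed

lemma adjoin_insert: "adjoin (insert x S) = ring.simple_extension kbar_ring (adjoin S) x"
  for x :: "'a::field kbar"
proof -
  interpret F: field "kbar_ring :: 'a kbar ring" by (rule kbar_field)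
  let ?E = "F.simple_extension (adjoin S) x"
  have sr: "subring (adjoin S) kbar_ring" using subfieldE(1)[OF adjoin_subfield] .
  have alg: "(F.algebraic over adjoin S) x" using adjoin_incl[of S] by (intro kbar_algebraic) auto
  have sfE: "subfield ?E kbar_ring"
    using F.simple_extension_is_subfield[OF adjoin_subfield, of x S] alg by simp
  have incl: "adjoin S \<subseteq> ?E" "x \<in> ?E"
    using F.simple_extension_incl[of "adjoin S" x] F.simple_extension_mem[OF sr, of x] by auto
  show ?thesis
  proof
    show "adjoin (insert x S) \<subseteq> ?E"
      unfolding adjoin_def[of "insert x S"]
      by (rule F.generate_field_min_subfield1[OF _ sfE]) (use incl adjoin_incl[of S] in auto)
    have "adjoin S \<subseteq> adjoin (insert x S)"
      unfolding adjoin_def[of S]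
      by (rule F.generate_field_min_subfield1[OF _ adjoin_subfield]) (use adjoin_incl[of "insert x S"] in auto)
    then show "?E \<subseteq> adjoin (insert x S)"
      using adjoin_incl[of "insert x S"]
      by (intro F.simple_extension_subring_incl[OF subfieldE(1)[OF adjoin_subfield]]) auto
  qed
qed

lemma adjoin_empty: "adjoin {} = (base_field :: 'a::field kbar set)"
proof -
  interpret F: field "kbar_ring :: 'a kbar ring" by (rule kbar_field)
  show ?thesis
    using F.generate_field_min_subfield1[OF _ base_subfield] adjoin_incl[of "{} :: 'a kbar set"]
    by (auto simp: adjoin_def)
qed

text \<open>Guarantees that \<open>ext_degree\<close> is a genuine dimension of these
  fields.\<close>

lemma adjoin_finite_dimension:
  fixes S :: "'a::field kbar set"
  assumes "finite S"
  shows "ring.finite_dimension kbar_ring base_field (adjoin S)"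
  using assms
proof (induction S rule: finite_induct)
  interpret F: field "kbar_ring :: 'a kbar ring" by (rule kbar_field)
  case empty
  show ?case using F.dimension_one[OF base_subfield] F.finite_dimensionI by (simp add: adjoin_empty)
next
  interpret F: field "kbar_ring :: 'a kbar ring" by (rule kbar_field)
  case (insert x S)
  have "(F.algebraic over adjoin S) x" using adjoin_incl[of S] by (intro kbar_algebraic) auto
  then have "F.finite_dimension (adjoin S) (adjoin (insert x S))"
    using F.finite_dimension_simple_extension[OF adjoin_subfield, of x S] by (simp add: adjoin_insert)
  then show ?case by (rule F.telescopic_base_dim(1)[OF base_subfield adjoin_subfield insert.IH])
qed

lemma ext_degree_dimension:
  fixes S :: "'a::field kbar set"
  assumes "finite S"
  shows "ring.dimension kbar_ring (ext_degree (adjoin S)) base_field (adjoin S)"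
proof -
  interpret F: field "kbar_ring :: 'a kbar ring" by (rule kbar_field)
  show ?thesis
    using F.finite_dimensionE[OF base_subfield adjoin_finite_dimension[OF assms]]
    by (simp add: ext_degree_def over_def)
qed

text \<open>The minimal polynomial of \<open>x\<close> over the larger field divides the one over
  \<open>k\<close>, so its degree can only drop. With \<open>S\<close> the coefficients of the
  Drinfeld module this is [K : k] <= D c.\<close>

lemma ext_degree_insert_le:
  fixes x :: "'a::field kbar"
  assumes "finite S"
  shows "ext_degree (adjoin (insert x S)) \<le> ext_degree (adjoin {x}) * ext_degree (adjoin S)"
proof -
  interpret F: field "kbar_ring :: 'a kbar ring" by (rule kbar_field)
  let ?B = "base_field :: 'a kbar set" and ?E = "adjoin S"
  have algB: "(F.algebraic over ?B) x" by (rule kbar_algebraic) simp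
  have algE: "(F.algebraic over ?E) x" using adjoin_incl[of S] by (intro kbar_algebraic) auto
  note B = F.IrrE[OF base_subfield _ algB] and E = F.IrrE[OF adjoin_subfield _ algE]
  have sub: "carrier (?B[X]\<^bsub>kbar_ring\<^esub>) \<subseteq> carrier (?E[X]\<^bsub>kbar_ring\<^esub>)"
    using adjoin_incl[of S] by (auto simp: univ_poly_def polynomial_def)
  have "Polynomials.degree (F.Irr ?E x) \<le> Polynomials.degree (F.Irr ?B x)"
  proof (rule F.pdivides_imp_degree_le[OF subfieldE(1)[OF adjoin_subfield] E(1)])
    show "F.Irr ?B x \<in> carrier (?E[X]\<^bsub>kbar_ring\<^esub>)" using B(1) sub by auto
    then show "F.Irr ?E x pdivides\<^bsub>kbar_ring\<^esub> F.Irr ?B x"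
      using F.Irr_minimal[OF adjoin_subfield _ algE] B(4) by simp
    show "F.Irr ?B x \<noteq> []" using B(2) F.pirreducible_degree[OF base_subfield] B(1) by fastforce
  qed simp
  moreover have "ext_degree (adjoin {x}) = Polynomials.degree (F.Irr ?B x)"
    using F.simple_extension_dim[OF base_subfield _ algB] adjoin_insert[of x "{}"]
    by (simp add: ext_degree_def over_def adjoin_empty)
  moreover have "ext_degree (adjoin (insert x S)) = ext_degree ?E * Polynomials.degree (F.Irr ?E x)"
  proof -
    have "F.dimension (Polynomials.degree (F.Irr ?E x)) ?E (adjoin (insert x S))"
      using F.dimension_simple_extension[OF adjoin_subfield _ algE] by (simp add: adjoin_insert)
    from F.telescopic_base[OF base_subfield adjoin_subfield ext_degree_dimension[OF assms] this]
    show ?thesis using F.dimI[OF base_subfield] by (simp add: ext_degree_def over_def)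
  qed
  ultimately show ?thesis by (simp add: mult.commute)
qed

lemma ext_degree_pos:
  fixes S :: "'a::field kbar set"
  assumes "finite S"
  shows "0 < ext_degree (adjoin S)"
proof (rule ccontr)
  interpret F: field "kbar_ring :: 'a kbar ring" by (rule kbar_field)
  assume "\<not> 0 < ext_degree (adjoin S)"
  then have "adjoin S = {0}"
    using F.dimension_zero[OF base_subfield, of "adjoin S"] ext_degree_dimension[OF assms] by simp
  moreover have "to_ac 1 \<in> adjoin S" using adjoin_incl[of S] by blast
  ultimately show False by simp
qed

lemma adjoin_rank_le:
  fixes S :: "'a::field kbar set"
  assumes "finite S"
  shows "rank_le (adjoin S) (ext_degree (adjoin S))"
  unfolding rank_le_def
proof (intro allI impI)
  interpret F: field "kbar_ring :: 'a kbar ring" by (rule kbar_field)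
  fix r and y :: "nat \<Rightarrow> 'a kbar"
  assume y: "\<forall>i<r. y i \<in> adjoin S" and r: "ext_degree (adjoin S) < r"
  let ?Us = "map y [0..<r]"
  have "\<not> F.independent base_field ?Us"
    using F.independent_length_le_dimension[OF base_subfield ext_degree_dimension[OF assms], of ?Us] y r
    by (auto simp: image_subset_iff)
  then obtain Ks where Ks: "length Ks = length ?Us" "F.combine Ks ?Us = 0"
    "set Ks \<subseteq> base_field" "set Ks \<noteq> {0}"
    using F.dependent_imp_non_trivial_combine[OF base_subfield, of ?Us] by auto
  define c where "c i = of_ac (Ks ! i)" for i
  have c: "to_ac (c i) = Ks ! i" if "i < r" for i
    unfolding c_def using Ks(1,3) that nth_mem[of i Ks] by (intro to_ac_of_ac) auto
  have "F.combine (map f l) (map g l) = (\<Sum>i\<leftarrow>l. f i * g i)" for f g :: "nat \<Rightarrow> 'a kbar" and l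
    by (induction l) auto
  from this[of "\<lambda>i. Ks ! i" "[0..<r]" y] have "(\<Sum>i<r. Ks ! i * y i) = 0"
    using Ks(1,2) map_nth[of Ks] by (simp add: interv_sum_list_conv_sum_set_nat atLeast0LessThan)
  then have "(\<Sum>i<r. to_ac (c i) * y i) = 0" using c by simp
  moreover have "\<exists>i<r. c i \<noteq> 0"
  proof (rule ccontr)
    assume "\<not> ?thesis"
    then have "Ks ! i = 0" if "i < r" for i using c[OF that] that by auto
    then have "set Ks \<subseteq> {0}" using Ks(1) by (auto simp: in_set_conv_nth)
    moreover have "set Ks \<noteq> {}" using Ks(1) r by auto
    ultimately show False using Ks(4) by (simp add: subset_singleton_iff)
  qed
  ultimately show "\<exists>c. (\<exists>i<r. c i \<noteq> 0) \<and> (\<Sum>i<r. to_ac (c i) * y i) = 0" by blast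
qed

lemma adjoin_finite_extension_field:
  fixes S :: "'a::{field,finite} kbar set"
  assumes "finite S"
  shows "finite_extension_field (adjoin S) (ext_degree (adjoin S))"
  using adjoin_intermediate adjoin_rank_le[OF assms] by unfold_locales

text \<open>Each \<open>h\<close> is counted separately and the resulting cardinalities are
  multiplied, so the exponents add up to a sum of heights over \<open>h\<close>; this is the origin
  of the shape of \<open>\<Sigma>\<close>. The difference of two colliding families is the
  relation.\<close>

lemma (in finite_extension_field) simultaneous_relation:
  fixes y :: "nat \<Rightarrow> 'i \<Rightarrow> 'a kbar"
  assumes I: "finite I" and y: "\<And>h i. h < t \<Longrightarrow> i \<in> I \<Longrightarrow> y h i \<in> K"
    and less: "(\<Sum>h<t. \<Sum>w\<in>{w \<in> places K. local_max w I (y h) \<noteq> 0}. real (local_degree K w) * local_max w I (y h))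
      + real (t * n * Suc B) < real (card I * Suc B)"
  obtains p where "\<exists>i\<in>I. p i \<noteq> 0" "\<And>i. i \<in> I \<Longrightarrow> degree (p i) \<le> B"
    "\<And>h. h < t \<Longrightarrow> (\<Sum>i\<in>I. of_A (p i) * y h i) = 0"
proof -
  let ?q = "real CARD('a)"
  let ?H = "\<lambda>h. \<Sum>w\<in>{w \<in> places K. local_max w I (y h) \<noteq> 0}. real (local_degree K w) * local_max w I (y h)"
  have q: "1 < ?q" using one_less_card[where 'a = 'a] by simp
  define V where "V = (\<Pi>\<^sub>E i\<in>I. {p :: 'a poly. degree p < Suc B})"
  define f where "f h p = (\<Sum>i\<in>I. of_A (p i) * y h i)" for h and p :: "'i \<Rightarrow> 'a poly"
  define F where "F p = (\<lambda>h\<in>{..<t}. f h p)" for p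
  have finV: "finite V" unfolding V_def using I finite_poly_degree_less by (intro finite_PiE) auto
  have cardV: "real (card V) = ?q ^ (card I * Suc B)"
    using I by (simp add: V_def card_PiE card_poly_degree_less power_mult[symmetric] mult.commute del: mult_Suc_right power_Suc)
  have fV: "real (card (f h ` V)) \<le> ?q powr (?H h + real (n * Suc B))" if h: "h < t" for h
  proof (rule index_leD[OF span_index[OF I, of "y h" B]])
    show "y h i \<in> K" if "i \<in> I" for i using y h that .
    show "finite (f h ` V)" using finV by simp
    show "f h ` V \<subseteq> {\<Sum>i\<in>I. of_A (p i) * y h i |p. \<forall>i\<in>I. degree (p i) \<le> B}"
      by (fastforce simp: f_def V_def PiE_iff less_Suc_eq_le)
  qed simp
  have "\<not> inj_on F V"
  proof
    assume inj: "inj_on F V"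
    have "F ` V \<subseteq> (\<Pi>\<^sub>E h\<in>{..<t}. f h ` V)" by (auto simp: F_def PiE_iff extensional_def split: if_splits)
    moreover have "finite (\<Pi>\<^sub>E h\<in>{..<t}. f h ` V)" using finV by (intro finite_PiE) auto
    ultimately have "card V \<le> card (\<Pi>\<^sub>E h\<in>{..<t}. f h ` V)"
      using inj by (metis card_image card_mono)
    then have "real (card V) \<le> (\<Prod>h<t. real (card (f h ` V)))" by (simp add: card_PiE flip: of_nat_prod)
    also have "\<dots> \<le> (\<Prod>h<t. ?q powr (?H h + real (n * Suc B)))"
      by (intro prod_mono) (use fV in auto)
    also have "\<dots> = ?q powr ((\<Sum>h<t. ?H h) + real (t * n * Suc B))"
      by (simp add: powr_sum[symmetric] sum.distrib mult.assoc del: mult_Suc_right)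
    also have "\<dots> < ?q powr real (card I * Suc B)" using less q by (rule powr_less_mono)
    also have "\<dots> = ?q ^ (card I * Suc B)" using powr_realpow[of ?q "card I * Suc B"] by simp
    finally show False using cardV by simp
  qed
  then obtain p p' where p: "p \<in> V" "p' \<in> V" "F p = F p'" "p \<noteq> p'" unfolding inj_on_def by blast
  show ?thesis
  proof (rule that[of "\<lambda>i. p i - p' i"])
    show "\<exists>i\<in>I. p i - p' i \<noteq> 0"
    proof (rule ccontr)
      assume "\<not> ?thesis"
      then have "p = p'" using p(1,2) unfolding V_def by (intro PiE_ext) auto
      then show False using p by simp
    qed
    show "degree (p i - p' i) \<le> B" if "i \<in> I" for i
      using p(1,2) that by (intro degree_diff_le) (auto simp: V_def PiE_iff less_Suc_eq_le)
    show "(\<Sum>i\<in>I. of_A (p i - p' i) * y h i) = 0" if "h < t" for h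
      using fun_cong[OF p(3), of h] that by (simp add: F_def f_def left_diff_distrib sum_subtractf)
  qed
qed

section \<open>Divided derivatives and the auxiliary polynomial\<close>

text \<open>Evaluation of the inner variable commutes with the expansion in H, which turns divided
  derivatives at \<open>x\<close> into Taylor coefficients of P(x + H), a polynomial in one
  variable.\<close>

lemma divided_deriv_eval:
  fixes P :: "'b::comm_ring_1 poly"
  shows "poly (divided_deriv h P) x = coeff (pcompose P [:x, 1:]) h"
proof (induction P arbitrary: h)
  case 0
  show ?case by (simp add: divided_deriv_def)
next
  case (pCons a P)
  then have "map_poly (\<lambda>c. [:c:]) (pCons a P) = pCons [:a:] (map_poly (\<lambda>c. [:c:]) P)"
    by (intro map_poly_pCons) auto
  then show ?case using pCons.IH
    by (cases h) (auto simp: divided_deriv_def pcompose_pCons algebra_simps simp del: coeff_pcompose_0)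
qed

text \<open>Divided derivatives are the full set of Taylor coefficients in any characteristic: their
  vanishing makes X^t divide P(X + x), and substituting X - x returns to \<open>P\<close>.\<close>

lemma power_dvd_of_divided_derivs:
  fixes P :: "'b::field poly"
  assumes "\<And>h. h < t \<Longrightarrow> poly (divided_deriv h P) x = 0"
  shows "[:- x, 1:] ^ t dvd P"
proof -
  have "\<forall>k<t. coeff (pcompose P [:x, 1:]) k = 0" using assms by (simp add: divided_deriv_eval)
  then have "monom 1 t dvd pcompose P [:x, 1:]" by (simp add: monom_1_dvd_iff')
  then obtain Q where Q: "pcompose P [:x, 1:] = monom 1 t * Q" by (rule dvdE)
  have power: "pcompose (q ^ m) r = pcompose q r ^ m" for q r :: "'b poly" and m
    by (induction m) (auto simp: pcompose_mult pcompose_1)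
  have "P = pcompose (pcompose P [:x, 1:]) [:- x, 1:]"
    by (simp flip: pcompose_assoc add: pcompose_pCons)
  also have "\<dots> = [:- x, 1:] ^ t * pcompose Q [:- x, 1:]"
    unfolding Q by (simp add: pcompose_mult monom_altdef power pcompose_pCons)
  finally show ?thesis by (metis dvd_triv_left)
qed

lemma drinfeld_0:
  assumes "drinfeld_module \<Phi> d"
  shows "\<Phi> 0 = 0"
proof -
  have "\<Phi> (0 + 0) = \<Phi> 0 + \<Phi> 0" using assms unfolding drinfeld_module_def by blast
  then have "\<Phi> 0 + 0 = \<Phi> 0 + \<Phi> 0" by simp
  then show ?thesis by (simp only: add_left_cancel)
qed

section \<open>Coefficients and degree of a multiplication polynomial of a Drinfeld module\<close>

definition coeffs_in :: "'b::field set \<Rightarrow> 'b poly \<Rightarrow> bool" where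
  "coeffs_in K P \<longleftrightarrow> (\<forall>i. coeff P i \<in> K)"

context
  fixes K :: "'a::{field,finite} kbar set"
  assumes K: "intermediate_field K"
begin

lemma intermediate_0: "0 \<in> K" and intermediate_1: "1 \<in> K" and intermediate_of_A: "of_A a \<in> K"
  and intermediate_add: "u \<in> K \<Longrightarrow> v \<in> K \<Longrightarrow> u + v \<in> K"
  and intermediate_mult: "u \<in> K \<Longrightarrow> v \<in> K \<Longrightarrow> u * v \<in> K"
proof -
  have base: "to_ac c \<in> K" for c using K by (auto simp: intermediate_field_def)
  show "0 \<in> K" "1 \<in> K" "of_A a \<in> K" using base[of 0] base[of 1] base by (auto simp: of_A_def)
  then have "add_subgroup K" using K by (auto simp: intermediate_field_def add_subgroup_def)
  then show "u \<in> K \<Longrightarrow> v \<in> K \<Longrightarrow> u + v \<in> K" by (rule add_subgroup_add)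
  show "u \<in> K \<Longrightarrow> v \<in> K \<Longrightarrow> u * v \<in> K" using K by (auto simp: intermediate_field_def)
qed

lemma intermediate_sum: "(\<And>i. i \<in> I \<Longrightarrow> f i \<in> K) \<Longrightarrow> sum f I \<in> K"
  by (induction I rule: infinite_finite_induct) (auto simp: intermediate_0 intro: intermediate_add)

lemma intermediate_power: "u \<in> K \<Longrightarrow> u ^ m \<in> K"
  by (induction m) (auto simp: intermediate_1 intro: intermediate_mult)

lemma coeffs_in_add: "coeffs_in K P \<Longrightarrow> coeffs_in K Q \<Longrightarrow> coeffs_in K (P + Q)"
  by (simp add: coeffs_in_def intermediate_add)

lemma coeffs_in_mult: "coeffs_in K P \<Longrightarrow> coeffs_in K Q \<Longrightarrow> coeffs_in K (P * Q)"
  by (simp add: coeffs_in_def coeff_mult intermediate_sum intermediate_mult)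

lemma coeffs_in_0: "coeffs_in K 0"
  by (simp add: coeffs_in_def intermediate_0)

lemma coeffs_in_monom: "c \<in> K \<Longrightarrow> coeffs_in K (monom c m)"
  by (simp add: coeffs_in_def intermediate_0)

lemma coeffs_in_pCons: "c \<in> K \<Longrightarrow> coeffs_in K P \<Longrightarrow> coeffs_in K (pCons c P)"
  by (simp add: coeffs_in_def coeff_pCons split: nat.split)

lemma coeffs_in_power: "coeffs_in K P \<Longrightarrow> coeffs_in K (P ^ m)"
proof (induction m)
  case 0
  show ?case using coeffs_in_monom[of 1 0] intermediate_1 by (simp add: monom_0 one_pCons)
qed (simp add: coeffs_in_mult)

lemma coeffs_in_sum: "(\<And>i. i \<in> I \<Longrightarrow> coeffs_in K (f i)) \<Longrightarrow> coeffs_in K (sum f I)"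
  by (induction I rule: infinite_finite_induct) (auto simp: coeffs_in_0 intro: coeffs_in_add)

lemma coeffs_in_pcompose: "coeffs_in K P \<Longrightarrow> coeffs_in K Q \<Longrightarrow> coeffs_in K (pcompose P Q)"
proof (induction P)
  case (pCons a P)
  have "a \<in> K" using pCons.prems(1) by (auto simp: coeffs_in_def dest: spec[of _ 0])
  moreover have "coeffs_in K P" using pCons.prems(1) unfolding coeffs_in_def by (metis coeff_pCons_Suc)
  ultimately show ?case using pCons
    by (auto simp: pcompose_pCons intro!: coeffs_in_add coeffs_in_mult coeffs_in_pCons coeffs_in_0)
qed (simp add: coeffs_in_0)

lemma coeffs_in_twisted_mult: "coeffs_in K f \<Longrightarrow> coeffs_in K g \<Longrightarrow> coeffs_in K (twisted_mult f g)"
  unfolding twisted_mult_def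
  by (intro coeffs_in_sum coeffs_in_monom intermediate_mult intermediate_power) (auto simp: coeffs_in_def)

lemma coeffs_in_twisted_to_poly: "coeffs_in K f \<Longrightarrow> coeffs_in K (twisted_to_poly f)"
  unfolding twisted_to_poly_def
  by (intro coeffs_in_sum coeffs_in_monom) (auto simp: coeffs_in_def)

text \<open>Horner's scheme N = c + T b builds \<open>\<Phi> N\<close> from constants and
  \<open>\<Phi>\<close> at T by twisted products, which stay over K.\<close>

lemma coeffs_in_drinfeld:
  assumes \<Phi>: "drinfeld_module \<Phi> d" and coeffs: "drinfeld_coeffs \<Phi> d \<subseteq> K"
  shows "coeffs_in K (\<Phi> N)"
proof (induction N)
  case 0
  show ?case by (simp add: drinfeld_0[OF \<Phi>] coeffs_in_0)
next
  case (pCons c b)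
  have T: "coeffs_in K (\<Phi> [:0, 1:])"
    unfolding coeffs_in_def
  proof
    fix i
    consider "i = 0" | "1 \<le> i" "i \<le> d" | "i > degree (\<Phi> [:0, 1:])"
      using \<Phi> unfolding drinfeld_module_def by linarith
    then show "coeff (\<Phi> [:0, 1:]) i \<in> K"
    proof cases
      case 1
      then show ?thesis using \<Phi> intermediate_of_A by (simp add: drinfeld_module_def)
    next
      case 2
      then show ?thesis using coeffs by (auto simp: drinfeld_coeffs_def)
    qed (simp add: coeff_eq_0 intermediate_0)
  qed
  have "\<Phi> ([:c:] + [:0, 1:] * b) = [:of_A [:c:]:] + twisted_mult (\<Phi> [:0, 1:]) (\<Phi> b)"
    using \<Phi> unfolding drinfeld_module_def by metis
  moreover have "[:c:] + [:0, 1:] * b = pCons c b" by simp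
  ultimately show ?case
    using T pCons.IH by (simp only:) (intro coeffs_in_add coeffs_in_twisted_mult coeffs_in_pCons coeffs_in_0 intermediate_of_A)
qed

end

text \<open>The top exponent is reached by one pair of indices only, and the twist raises the
  leading coefficient of \<open>g\<close> to a power, which is still nonzero.\<close>

lemma degree_twisted_mult:
  fixes f g :: "'a::{field,finite} kbar poly"
  assumes "f \<noteq> 0" "g \<noteq> 0"
  shows "degree (twisted_mult f g) = degree f + degree g"
proof (rule antisym)
  show "degree (twisted_mult f g) \<le> degree f + degree g"
    unfolding twisted_mult_def
    by (intro degree_sum_le) (auto intro!: degree_sum_le order_trans[OF degree_monom_le])
  have "coeff (twisted_mult f g) (degree f + degree g) =
      (\<Sum>i\<le>degree f. \<Sum>j\<le>degree g. if i + j = degree f + degree g then coeff f i * coeff g j ^ (CARD('a) ^ i) else 0)"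
    by (simp add: twisted_mult_def coeff_sum)
  also have "\<dots> = (\<Sum>i\<le>degree f. if i = degree f then lead_coeff f * lead_coeff g ^ (CARD('a) ^ degree f) else 0)"
  proof (rule sum.cong[OF refl])
    fix i assume i: "i \<in> {..degree f}"
    have "(\<Sum>j\<le>degree g. if i + j = degree f + degree g then coeff f i * coeff g j ^ (CARD('a) ^ i) else 0)
        = (\<Sum>j\<le>degree g. if j = degree g then (if i = degree f then coeff f i * coeff g j ^ (CARD('a) ^ i) else 0) else 0)"
      using i by (intro sum.cong) auto
    then show "(\<Sum>j\<le>degree g. if i + j = degree f + degree g then coeff f i * coeff g j ^ (CARD('a) ^ i) else 0)
        = (if i = degree f then lead_coeff f * lead_coeff g ^ (CARD('a) ^ degree f) else 0)" by simp
  qed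
  also have "\<dots> = lead_coeff f * lead_coeff g ^ (CARD('a) ^ degree f)" by simp
  finally have "coeff (twisted_mult f g) (degree f + degree g) \<noteq> 0" using assms by simp
  then show "degree f + degree g \<le> degree (twisted_mult f g)" by (rule le_degree)
qed

lemma degree_drinfeld:
  assumes \<Phi>: "drinfeld_module \<Phi> d" and "N \<noteq> 0"
  shows "degree (\<Phi> N) = d * degree N"
  using assms(2)
proof (induction N)
  case (pCons c b)
  have "\<Phi> ([:c:] + [:0, 1:] * b) = [:of_A [:c:]:] + twisted_mult (\<Phi> [:0, 1:]) (\<Phi> b)"
    using \<Phi> unfolding drinfeld_module_def by metis
  then have eq: "\<Phi> (pCons c b) = [:of_A [:c:]:] + twisted_mult (\<Phi> [:0, 1:]) (\<Phi> b)" by simp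
  note \<Phi>0 = drinfeld_0[OF \<Phi>]
  have d: "d \<ge> 1" and dT: "degree (\<Phi> [:0, 1:]) = d" and inj: "inj \<Phi>"
    using \<Phi> by (auto simp: drinfeld_module_def)
  show ?case
  proof (cases "b = 0")
    case True
    have "\<Phi> [:c:] = [:of_A [:c:]:]" using \<Phi> by (auto simp: drinfeld_module_def)
    then show ?thesis using True by simp
  next
    case False
    then have "\<Phi> b \<noteq> 0" using inj \<Phi>0 by (metis injD)
    moreover have "\<Phi> [:0, 1:] \<noteq> 0" using dT d by auto
    ultimately have deg: "degree (twisted_mult (\<Phi> [:0, 1:]) (\<Phi> b)) = d + d * degree b"
      using dT pCons.IH[OF False] by (simp add: degree_twisted_mult)
    then have "degree ([:of_A [:c:]:] + twisted_mult (\<Phi> [:0, 1:]) (\<Phi> b)) = d + d * degree b"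
      using d by (subst degree_add_eq_right) auto
    then show ?thesis using False eq by simp
  qed
qed simp

lemma degree_twisted_to_poly_ge:
  fixes f :: "'a::{field,finite} kbar poly"
  assumes "f \<noteq> 0"
  shows "CARD('a) ^ degree f \<le> degree (twisted_to_poly f)"
proof (rule le_degree)
  have q: "1 < CARD('a)" by (rule one_less_card)
  have "coeff (twisted_to_poly f) (CARD('a) ^ degree f) = (\<Sum>i\<le>degree f. if i = degree f then coeff f i else 0)"
    using q by (auto simp: twisted_to_poly_def coeff_sum power_inject_exp intro!: sum.cong)
  then show "coeff (twisted_to_poly f) (CARD('a) ^ degree f) \<noteq> 0" using assms by simp
qed

text \<open>Uniqueness of an expansion in base \<open>F\<close> with digits of degree below that of
  \<open>F\<close>: the lowest digit is a multiple of \<open>F\<close>, hence 0, and the rest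
  follows by cancelling \<open>F\<close>.\<close>

lemma poly_eq_0_imp_eq_0:
  fixes Q :: "'b::field poly poly"
  assumes "\<And>j. degree (coeff Q j) < degree F" "poly Q F = 0"
  shows "Q = 0"
  using assms
proof (induction Q)
  case (pCons a Q)
  have a: "degree a < degree F" using pCons.prems(1)[of 0] by simp
  have eq: "a = - (F * poly Q F)" using pCons.prems(2) by (simp add: eq_neg_iff_add_eq_0)
  have F: "F \<noteq> 0" using a by auto
  have Q0: "poly Q F = 0"
  proof (rule ccontr)
    assume "poly Q F \<noteq> 0"
    then have "degree a = degree F + degree (poly Q F)" using F unfolding eq by (simp add: degree_mult_eq)
    then show False using a by simp
  qed
  have "degree (coeff Q j) < degree F" for j using pCons.prems(1)[of "Suc j"] by simp
  then have "Q = 0" using pCons.IH Q0 by blast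
  then show ?case using eq by simp
qed simp

section \<open>Substituting for Y in a bivariate polynomial\<close>

lemma map_poly_sum:
  assumes "f 0 = 0" "\<And>a b. f (a + b) = f a + f b"
  shows "map_poly f (sum g I) = (\<Sum>i\<in>I. map_poly f (g i))"
proof -
  have "map_poly f (p + q) = map_poly f p + map_poly f q" for p q
    using assms by (intro poly_eqI) (simp add: coeff_map_poly)
  then show ?thesis by (induction I rule: infinite_finite_induct) auto
qed

lemma map_poly_bivariate:
  "map_poly (map_poly of_A) (bivariate L p) = (\<Sum>i<L. \<Sum>j<L. monom (monom (of_A (p i j)) i) j)"
proof -
  have "map_poly of_A (a + b) = map_poly of_A a + map_poly of_A b" for a b :: "'a poly poly"
    by (intro poly_eqI) (simp add: coeff_map_poly)
  then show ?thesis
    by (simp add: bivariate_def map_poly_sum map_poly_monom)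
qed

lemma subst_Y_bivariate:
  "subst_Y (bivariate L p) F = (\<Sum>i<L. \<Sum>j<L. smult (of_A (p i j)) (monom 1 i * F ^ j))"
proof -
  have smult: "monom a i * F ^ j = smult a (monom 1 i * F ^ j)" for a i j
    by (metis mult.right_neutral mult_smult_left smult_monom)
  show ?thesis
    unfolding subst_Y_def map_poly_bivariate poly_sum poly_monom by (intro sum.cong refl smult)
qed

lemma coeff_bivariate: "coeff (coeff (bivariate L p) j) i = (if i < L \<and> j < L then p i j else 0)"
proof -
  have "coeff (coeff (bivariate L p) j) i = (\<Sum>i'<L. \<Sum>j'<L. if j' = j then (if i' = i then p i' j' else 0) else 0)"
    by (simp add: bivariate_def coeff_sum if_distrib[of "\<lambda>u. coeff u i"] cong: if_cong)
  also have "\<dots> = (\<Sum>i'<L. if i' = i then (if j < L then p i' j else 0) else 0)"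
    by (intro sum.cong) auto
  also have "\<dots> = (if i < L \<and> j < L then p i j else 0)" by auto
  finally show ?thesis .
qed

lemma subst_Y_nonzero:
  assumes G: "bivariate L p \<noteq> 0" and F: "L < degree F"
  shows "subst_Y (bivariate L p) F \<noteq> 0"
proof
  let ?Q = "map_poly (map_poly of_A) (bivariate L p)"
  have coeff: "coeff (coeff ?Q j) i = of_A (coeff (coeff (bivariate L p) j) i)" for i j
    by (simp add: coeff_map_poly)
  assume "subst_Y (bivariate L p) F = 0"
  moreover have "degree (coeff ?Q j) < degree F" for j
    using F by (intro le_less_trans[OF degree_le]) (auto simp: coeff coeff_bivariate)
  ultimately have "?Q = 0" using poly_eq_0_imp_eq_0 by (auto simp: subst_Y_def)
  then have "coeff (coeff (bivariate L p) j) i = 0" for i j using coeff[of j i] by simp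
  then have "bivariate L p = 0" by (intro poly_eqI) simp
  then show False using G by simp
qed

lemma finite_drinfeld_coeffs: "finite (drinfeld_coeffs \<Phi> d)"
proof -
  have "drinfeld_coeffs \<Phi> d = (\<lambda>i. coeff (\<Phi> [:0, 1:]) i) ` {1..d}" by (auto simp: drinfeld_coeffs_def)
  then show ?thesis by simp
qed

text \<open>The integer part plus 1 makes d deg N strictly larger than log L, so q to this power
  exceeds L, and the additive polynomial has at least that degree. Since L >= 1 the logarithm is
  non-negative, which makes deg N positive and \<open>N\<close> nonzero.\<close>

lemma drinfeld_degree_bound:
  fixes \<Phi> :: "'a::{field,finite} poly \<Rightarrow> 'a kbar poly"
  assumes \<Phi>: "drinfeld_module \<Phi> d" and L: "L > 0"
    and N: "int (degree N) = \<lfloor>1 / real d * log (real CARD('a)) (real L)\<rfloor> + 1"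
  shows "L < degree (twisted_to_poly (\<Phi> N))"
proof -
  have q: "1 < real CARD('a)" using one_less_card[where 'a = 'a] by simp
  have d: "d > 0" and inj: "inj \<Phi>" using \<Phi> by (auto simp: drinfeld_module_def)
  have log0: "0 \<le> log (real CARD('a)) (real L)" using q L by simp
  have "1 / real d * log (real CARD('a)) (real L) < real_of_int (int (degree N))" unfolding N by linarith
  then have "log (real CARD('a)) (real L) < real (d * degree N)" using d by (simp add: field_simps)
  then have "real L < real CARD('a) powr real (d * degree N)" using q L by (simp add: log_less_iff)
  also have "\<dots> = real (CARD('a) ^ (d * degree N))" using powr_realpow[of "real CARD('a)" "d * degree N"] q by simp
  finally have less: "L < CARD('a) ^ (d * degree N)" by linarith
  have "0 \<le> 1 / real d * log (real CARD('a)) (real L)" using log0 by simp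
  then have "int (degree N) > 0" unfolding N by (simp add: add_nonneg_pos)
  then have "N \<noteq> 0" by auto
  have "\<Phi> N \<noteq> 0" using inj \<open>N \<noteq> 0\<close> drinfeld_0[OF \<Phi>] by (metis injD)
  then show ?thesis
    using degree_twisted_to_poly_ge[of "\<Phi> N"] degree_drinfeld[OF \<Phi> \<open>N \<noteq> 0\<close>] less by simp
qed

theorem theorem8:
  fixes \<Phi> :: "'a::{field,finite} poly \<Rightarrow> 'a kbar poly"
    and x :: "'a kbar"
    and N :: "'a poly"
    and d D c L t :: nat
    and K :: "'a kbar set"
    and \<alpha> :: "nat \<Rightarrow> nat \<times> nat \<Rightarrow> 'a kbar"
    and \<Sigma> :: real
  assumes "drinfeld_module \<Phi> d"
    and "\<not> drinfeld_torsion \<Phi> x"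
    and "separable_over_k x"
    and "D = ext_degree (adjoin {x})"
    and "c = ext_degree (adjoin (drinfeld_coeffs \<Phi> d))"
    and "L ^ 2 > t * D * c"
    and "int (degree N) = \<lfloor>1 / real d * log (real CARD('a)) (real L)\<rfloor> + 1"
    and "K = adjoin (drinfeld_coeffs \<Phi> d \<union> {x})"
    and "\<And>h i j. \<alpha> h (i, j) =
           poly (divided_deriv h (monom 1 i * twisted_to_poly (\<Phi> N) ^ j)) x"
    and "\<Sigma> = (\<Sum>h<t. weil_height K ({..<L} \<times> {..<L}) (\<alpha> h))"
  shows "\<exists>(G :: 'a poly poly poly) (p :: nat \<Rightarrow> nat \<Rightarrow> 'a poly) (G\<^sub>N :: 'a kbar poly).
           G = bivariate L p \<and> G \<noteq> 0 \<and>
           G\<^sub>N = subst_Y G (twisted_to_poly (\<Phi> N)) \<and> G\<^sub>N \<noteq> 0 \<and>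
           (\<forall>h<t. poly (divided_deriv h G\<^sub>N) x = 0) \<and>
           order x G\<^sub>N \<ge> t \<and>
           (\<forall>i<L. \<forall>j<L.
              real (degree (p i j)) \<le>
                real (D * c) / (real (L ^ 2) - real (t * D * c)) * \<Sigma>)"
proof -
  let ?S = "drinfeld_coeffs \<Phi> d" and ?F = "twisted_to_poly (\<Phi> N)"
  let ?I = "{..<L} \<times> {..<L}"
  define n where "n = ext_degree K"
  have K: "K = adjoin (insert x ?S)" using assms(8) by simp
  have finS: "finite (insert x ?S)" using finite_drinfeld_coeffs by simp
  interpret finite_extension_field K n
    unfolding n_def K by (rule adjoin_finite_extension_field[OF finS])
  have n0: "n > 0" unfolding n_def K by (rule ext_degree_pos[OF finS])
  have n_le: "n \<le> D * c"
    unfolding n_def K assms(4,5) by (rule ext_degree_insert_le[OF finite_drinfeld_coeffs])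
  have L: "L > 0" using assms(6) by (cases "L = 0") auto
  note in_K = coeffs_in_drinfeld[OF field assms(1), of N]
  have inc: "?S \<subseteq> K" "x \<in> K" using adjoin_incl[of "insert x ?S"] unfolding K by auto
  have \<alpha>: "\<alpha> h (i, j) = coeff (pcompose (monom 1 i * ?F ^ j) [:x, 1:]) h" for h i j
    unfolding assms(9) by (rule divided_deriv_eval)
  have \<alpha>K: "\<alpha> h ij \<in> K" for h ij
  proof (cases ij)
    case (Pair i j)
    have "coeffs_in K (pcompose (monom 1 i * ?F ^ j) [:x, 1:])"
      using in_K[OF inc(1)] inc(2) intermediate_1[OF field]
      by (intro coeffs_in_pcompose[OF field] coeffs_in_mult[OF field] coeffs_in_power[OF field]
          coeffs_in_monom[OF field] coeffs_in_twisted_to_poly[OF field] coeffs_in_pCons[OF field] coeffs_in_0[OF field])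
    then show ?thesis by (simp add: Pair \<alpha> coeffs_in_def)
  qed
  let ?H = "\<lambda>h. \<Sum>w\<in>{w \<in> places K. local_max w ?I (\<alpha> h) \<noteq> 0}. real (local_degree K w) * local_max w ?I (\<alpha> h)"
  \<comment> \<open>The count yields unnormalized sums over places, whereas the height carries the
    factor 1/[K : k]; so \<open>n\<close> reappears in front of \<open>\<Sigma>\<close>.\<close>
  have H: "?H h = real n * weil_height K ?I (\<alpha> h)" for h
    using n0 by (simp add: weil_height_def n_def)
  have H0: "0 \<le> ?H h" for h
    by (intro sum_nonneg mult_nonneg_nonneg) (auto simp: local_max_def)
  have sumH: "(\<Sum>h<t. ?H h) = real n * \<Sigma>"
    unfolding H assms(10) by (simp add: sum_distrib_left)
  have "0 \<le> real n * \<Sigma>" unfolding sumH[symmetric] by (intro sum_nonneg H0)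
  then have \<Sigma>0: "0 \<le> \<Sigma>" using n0 by (simp add: zero_le_mult_iff)
  define M where "M = real (D * c) / (real (L ^ 2) - real (t * D * c)) * \<Sigma>"
  \<comment> \<open>The largest integer degree that the claim allows. What drives the pigeonhole
    principle is the strict inequality \<open>M < Suc B\<close>, since polynomials of degree at most
    \<open>B\<close> have \<open>Suc B\<close> coefficients.\<close>
  define B where "B = nat \<lfloor>M\<rfloor>"
  have pos: "0 < real (L ^ 2) - real (t * D * c)" using assms(6) by linarith
  have M0: "0 \<le> M" unfolding M_def using pos \<Sigma>0 by (intro mult_nonneg_nonneg divide_nonneg_pos) auto
  have B: "real B \<le> M" "M < real (Suc B)" using M0 unfolding B_def by linarith+
  have "real (D * c) * \<Sigma> = M * (real (L ^ 2) - real (t * D * c))" using pos by (simp add: M_def)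
  also have "\<dots> < real (Suc B) * (real (L ^ 2) - real (t * D * c))"
    using B(2) pos by (rule mult_strict_right_mono)
  finally have *: "real (D * c) * (\<Sigma> + real t * real (Suc B)) < real (L ^ 2) * real (Suc B)"
    by (simp add: algebra_simps)
  \<comment> \<open>Both the height term and the term for the \<open>t\<close> conditions are
    proportional to \<open>n\<close>, so a single comparison with D c suffices; it relies on the
    other factor being non-negative.\<close>
  have "real n * (\<Sigma> + real t * real (Suc B)) \<le> real (D * c) * (\<Sigma> + real t * real (Suc B))"
    using n_le \<Sigma>0 by (intro mult_right_mono) (simp_all only: of_nat_le_iff, simp)
  then have less: "(\<Sum>h<t. ?H h) + real (t * n * Suc B) < real (card ?I * Suc B)"
    using * unfolding sumH by (simp add: algebra_simps power2_eq_square)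
  obtain P where P: "\<exists>ij\<in>?I. P ij \<noteq> 0" "\<And>ij. ij \<in> ?I \<Longrightarrow> degree (P ij) \<le> B"
    "\<And>h. h < t \<Longrightarrow> (\<Sum>ij\<in>?I. of_A (P ij) * \<alpha> h ij) = 0"
    by (rule simultaneous_relation[of ?I t \<alpha> B]) (use \<alpha>K less in auto)
  define p where "p i j = P (i, j)" for i j
  let ?G = "bivariate L p"
  let ?GN = "subst_Y ?G ?F"
  have G0: "?G \<noteq> 0"
  proof -
    obtain i j where "i < L" "j < L" "p i j \<noteq> 0" using P(1) by (auto simp: p_def)
    then have "coeff (coeff ?G j) i \<noteq> 0" by (simp add: coeff_bivariate)
    then show ?thesis by auto
  qed
  have GN0: "?GN \<noteq> 0"
    by (rule subst_Y_nonzero[OF G0 drinfeld_degree_bound[OF assms(1) L assms(7)]])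
  \<comment> \<open>Taylor coefficients at \<open>x\<close> are linear in the polynomial, and the
    \<open>p i j\<close> are constants with respect to X; the relation found above is therefore the
    vanishing of the coefficient of order \<open>h\<close>.\<close>
  have deriv: "poly (divided_deriv h ?GN) x = 0" if "h < t" for h
  proof -
    have "poly (divided_deriv h ?GN) x = (\<Sum>i<L. \<Sum>j<L. of_A (p i j) * \<alpha> h (i, j))"
      unfolding divided_deriv_eval subst_Y_bivariate \<alpha>
      by (simp add: pcompose_sum pcompose_smult coeff_sum)
    also have "\<dots> = (\<Sum>ij\<in>?I. of_A (P ij) * \<alpha> h ij)"
      by (simp add: p_def sum.cartesian_product case_prod_beta)
    finally show ?thesis using P(3)[OF that] by simp
  qed
  have "[:- x, 1:] ^ t dvd ?GN" by (rule power_dvd_of_divided_derivs) (rule deriv)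
  then have "t \<le> order x ?GN" using GN0 by (simp add: order_divides)
  moreover have "real (degree (p i j)) \<le> M" if "i < L" "j < L" for i j
    using P(2)[of "(i, j)"] that B(1) by (auto simp: p_def)
  ultimately show ?thesis
    using G0 GN0 deriv unfolding M_def by blast
qed

end
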